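(* Let $V$ be a vertex operator algebra, $z\in\mathbb{C}^{\times}$, and let $W_1,W_2$ be $V$-modules. The vector space consisting of all elements of $(W_1\otimes W_2)^*$ satisfying the $P(z)$-compatibility condition and the $P(z)$-local grading-restriction condition, equipped with $Y'_{P(z)}$, is a generalized $V$-module and is equal to the generalized module $W_1\diamond_{P(z)}W_2$.
   Context: Basic conventions. Everything is over $\mathbb{C}$. $V=(V,Y,\mathbf 1,\omega)$ is a vertex operator algebra ($\mathbb{Z}$-graded, with finite-dimensional weight spaces that vanish for sufficiently negative weight), $Y(\omega,x)=\sum_n L(n)x^{-n-2}$. A $V$-module is a $\mathbb{C}$-graded space $W=\coprod_{n\in\mathbb{C}}W_{(n)}$, graded by $L(0)$-eigenvalues, with a vertex operator map satisfying the usual axioms (lower truncation, vacuum property, Jacobi identity, $L(-1)$-derivative property), such that $\dim W_{(n)}<\infty$ for all $n$ and $W_{(n)}=0$ for $n$ whose real part is sufficiently small. A generalized $V$-module satisfies all these axioms except the last two conditions on the grading. For modules $W_1,W_2$ the vertex operator maps are $Y_1,Y_2$. Formal delta function: $\delta(x)=\sum_{n\in\mathbb{Z}}x^n$; powers of binomials are expanded in nonnegative powers of the second summand. For a module with vertex operator map $Y$, $Y^*(v,x)=Y(e^{xL(1)}(-x^{-2})^{L(0)}v,x^{-1})$. For $v\in V$, $Y_t(v,x)=v\otimes t^{-1}\delta(x/t)$, so the coefficient of $x^{-n-1}$ is $v\otimes t^n$. $\iota_+$ denotes expansion of a rational function of $t$ in the direction of positive powers of $t$. The action $\tau_{P(z)}$.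 The linear map $\tau_{P(z)}:V\otimes\iota_+\mathbb{C}[t,t^{-1},(z^{-1}-t)^{-1}]\to\mathrm{End}\,(W_1\otimes W_2)^*$ is defined by $$\Bigl(\tau_{P(z)}\bigl(x_0^{-1}\delta\bigl(\tfrac{x_1^{-1}-z}{x_0}\bigr)Y_t(v,x_1)\bigr)\lambda\Bigr)(w_{(1)}\otimes w_{(2)})=z^{-1}\delta\bigl(\tfrac{x_1^{-1}-x_0}{z}\bigr)\lambda\bigl(Y_1(e^{x_1L(1)}(-x_1^{-2})^{L(0)}v,x_0)w_{(1)}\otimes w_{(2)}\bigr)+x_0^{-1}\delta\bigl(\tfrac{z-x_1^{-1}}{-x_0}\bigr)\lambda\bigl(w_{(1)}\otimes Y_2^*(v,x_1)w_{(2)}\bigr)$$ for $v\in V$, $\lambda\in(W_1\otimes W_2)^*$, $w_{(i)}\in W_i$ (an identity of generating functions in $x_0,x_1$). Put $Y'_{P(z)}(v,x)=\tau_{P(z)}(Y_t(v,x))$ and $Y'_{P(z)}(\omega,x)=\sum_nL'_{P(z)}(n)x^{-n-2}$. Weights and weight vectors in $(W_1\otimes W_2)^*$ are eigenvalues and eigenvectors of $L'_{P(z)}(0)$. $P(z)$-compatibility condition on $\lambda\in(W_1\otimes W_2)^*$: (a) for all $v\in V$, $Y'_{P(z)}(v,x)\lambda$ involves only finitely many negative powers of $x$; (b) for all $v\in V$, $\tau_{P(z)}\bigl(x_0^{-1}\delta(\tfrac{x_1^{-1}-z}{x_0})Y_t(v,x_1)\bigr)\lambda=x_0^{-1}\delta(\tfrac{x_1^{-1}-z}{x_0})Y'_{P(z)}(v,x_1)\lambda$.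 $P(z)$-local grading-restriction condition on $\lambda$: (a) $\lambda$ is a finite sum of weight vectors; (b) if $W_\lambda$ is the smallest subspace of $(W_1\otimes W_2)^*$ containing $\lambda$ and stable under all $\tau_{P(z)}(v\otimes t^n)$ ($v\in V$, $n\in\mathbb{Z}$), then the weight spaces of the (graded) space $W_\lambda$ satisfy $\dim(W_\lambda)_{(n)}<\infty$ for $n\in\mathbb{C}$ and $(W_\lambda)_{(n)}=0$ for $n$ whose real part is sufficiently small. The space $W_1\diamond_{P(z)}W_2$. A subspace $W\subset(W_1\otimes W_2)^*$ is called a $V$-module (resp. generalized $V$-module) if it is $\mathbb{C}$-graded by its $L'_{P(z)}(0)$-weight subspaces and is a module (resp. generalized module) with this grading and the action $Y'_{P(z)}(\cdot,x)$; it is $P(z)$-compatible if each of its elements satisfies the $P(z)$-compatibility condition. $W_1\diamond_{P(z)}W_2\subset(W_1\otimes W_2)^*$ is the sum (equivalently, the union) of all subspaces that are $P(z)$-compatible $V$-modules; it is a generalized module. *)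

theory Defs
  imports
    Complex_Main
    "HOL-Library.Function_Algebras"
    "HOL-Library.Groups_Big_Fun"
    "HOL-Computational_Algebra.Formal_Laurent_Series"
begin

text \<open>
  A complex vector space is a type of class \<^class>\<open>ab_group_add\<close> with a scalar multiplication
  satisfying the locale \<^locale>\<open>vector_space\<close>; subspaces are sets.
  A vertex operator map is given by its modes: \<open>Y v n w = v\<^sub>n w\<close>, where
  \<open>Y(v,x) = \<Sum>\<^sub>n v\<^sub>n x\<^bsup>-n-1\<^esup>\<close>.  Identities of formal series are stated coefficientwise.
  \<^const>\<open>Sum_any\<close> is the sum over all indices; it is used only where lower truncation
  leaves finitely many nonzero terms.
\<close>

record 'v vertex_data =
  scaleV :: "complex \<Rightarrow> 'v \<Rightarrow> 'v"
  opV :: "'v \<Rightarrow> int \<Rightarrow> 'v \<Rightarrow> 'v"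
  vacuum :: 'v
  conformal :: 'v

text \<open>\<open>Y(\<omega>,x) = \<Sum>\<^sub>n L(n) x\<^bsup>-n-2\<^esup>\<close>, so \<open>L(n) = \<omega>\<^bsub>n+1\<^esub>\<close>.\<close>

definition Vir :: "'v vertex_data \<Rightarrow> ('v \<Rightarrow> int \<Rightarrow> 'w \<Rightarrow> 'w) \<Rightarrow> int \<Rightarrow> 'w \<Rightarrow> 'w" where
  "Vir V Y n = Y (conformal V) (n + 1)"

definition weight_space ::
  "'v vertex_data \<Rightarrow> (complex \<Rightarrow> 'w \<Rightarrow> 'w) \<Rightarrow> 'w set \<Rightarrow> ('v \<Rightarrow> int \<Rightarrow> 'w \<Rightarrow> 'w) \<Rightarrow> complex \<Rightarrow> 'w set" where
  "weight_space V s W Y n = {w \<in> W. Vir V Y 0 w = s n w}"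

definition finite_dim :: "(complex \<Rightarrow> 'w::ab_group_add \<Rightarrow> 'w) \<Rightarrow> 'w set \<Rightarrow> bool" where
  "finite_dim s U \<longleftrightarrow> (\<exists>B. finite B \<and> module.span s B = U)"

text \<open>
  The coefficient of \<open>x\<^sub>0\<^bsup>-l-1\<^esup> x\<^sub>1\<^bsup>-m-1\<^esup> x\<^sub>2\<^bsup>-n-1\<^esup>\<close> in the Jacobi identity
  \<open>x\<^sub>0\<^bsup>-1\<^esup>\<delta>((x\<^sub>1-x\<^sub>2)/x\<^sub>0) Y(u,x\<^sub>1)Y(v,x\<^sub>2) - x\<^sub>0\<^bsup>-1\<^esup>\<delta>((x\<^sub>2-x\<^sub>1)/(-x\<^sub>0)) Y(v,x\<^sub>2)Y(u,x\<^sub>1)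
    = x\<^sub>2\<^bsup>-1\<^esup>\<delta>((x\<^sub>1-x\<^sub>0)/x\<^sub>2) Y(Y(u,x\<^sub>0)v,x\<^sub>2)\<close>, applied to \<open>w\<close>.
  On the right, \<open>x\<^sub>2\<^bsup>-1\<^esup>\<delta>((x\<^sub>1-x\<^sub>0)/x\<^sub>2)\<close> contributes
  \<open>(-1)\<^sup>i ((i-m-1) choose i) = m choose i\<close>.
\<close>

definition jacobi_identity ::
  "'v vertex_data \<Rightarrow> (complex \<Rightarrow> 'w::ab_group_add \<Rightarrow> 'w) \<Rightarrow> 'w set \<Rightarrow> ('v \<Rightarrow> int \<Rightarrow> 'w \<Rightarrow> 'w) \<Rightarrow> bool" where
  "jacobi_identity V s W Y \<longleftrightarrow> (\<forall>u v. \<forall>w\<in>W. \<forall>l m n.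
     Sum_any (\<lambda>i::nat. s ((-1) ^ i * (of_int l gchoose i)) (Y u (m + l - int i) (Y v (n + int i) w)))
     - Sum_any (\<lambda>i::nat. s ((-1) powi l * (-1) ^ i * (of_int l gchoose i))
                           (Y v (n + l - int i) (Y u (m + int i) w)))
     = Sum_any (\<lambda>i::nat. s (of_int m gchoose i) (Y (opV V u (l + int i) v) (m + n - int i) w)))"

text \<open>
  The axioms common to the algebra itself, modules and generalized modules: \<open>W\<close> is a subspace with
  a vertex operator map \<open>Y\<close> (bilinear, lower truncation, vacuum property, Jacobi identity,
  \<open>L(-1)\<close>-derivative property).  Only the values of \<open>Y\<close> on \<open>W\<close> matter.
\<close>

definition vertex_operator_map ::
  "'v::ab_group_add vertex_data \<Rightarrow> (complex \<Rightarrow> 'w::ab_group_add \<Rightarrow> 'w) \<Rightarrow> 'w set \<Rightarrow>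
   ('v \<Rightarrow> int \<Rightarrow> 'w \<Rightarrow> 'w) \<Rightarrow> bool" where
  "vertex_operator_map V s W Y \<longleftrightarrow>
     vector_space s \<and> module.subspace s W \<and>
     (\<forall>v n. \<forall>w\<in>W. Y v n w \<in> W) \<and>
     (\<forall>u v n. \<forall>w\<in>W. Y (u + v) n w = Y u n w + Y v n w) \<and>
     (\<forall>c v n. \<forall>w\<in>W. Y (scaleV V c v) n w = s c (Y v n w)) \<and>
     (\<forall>v n. \<forall>w\<in>W. \<forall>w'\<in>W. Y v n (w + w') = Y v n w + Y v n w') \<and>
     (\<forall>v n c. \<forall>w\<in>W. Y v n (s c w) = s c (Y v n w)) \<and>
     (\<forall>v. \<forall>w\<in>W. \<exists>N. \<forall>n\<ge>N. Y v n w = 0) \<and>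
     (\<forall>n. \<forall>w\<in>W. Y (vacuum V) n w = (if n = -1 then w else 0)) \<and>
     jacobi_identity V s W Y \<and>
     (\<forall>v n. \<forall>w\<in>W. Y (Vir V (opV V) (-1) v) n w = s (- of_int n) (Y v (n - 1) w))"

text \<open>
  Gradings are by \<open>L(0)\<close>-eigenspaces.  Eigenspaces are independent, so it suffices to require
  that they span.
\<close>

definition vertex_operator_algebra :: "'v::ab_group_add vertex_data \<Rightarrow> bool" where
  "vertex_operator_algebra V \<longleftrightarrow>
     (let s = scaleV V; Y = opV V; wt = (\<lambda>n::int. weight_space V s UNIV Y (of_int n)) in
     vertex_operator_map V s UNIV Y \<and>
     (\<forall>v. Y v (-1) (vacuum V) = v \<and> (\<forall>n\<ge>0. Y v n (vacuum V) = 0)) \<and>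
     (\<exists>c. \<forall>m n v. Vir V Y m (Vir V Y n v) - Vir V Y n (Vir V Y m v) =
        s (of_int (m - n)) (Vir V Y (m + n) v) +
        s (if m + n = 0 then of_int (m ^ 3 - m) / 12 * c else 0) v) \<and>
     module.span s (\<Union>n. wt n) = UNIV \<and>
     (\<forall>n. finite_dim s (wt n)) \<and>
     (\<exists>N. \<forall>n<N. wt n = {0}))"

definition generalized_module ::
  "'v::ab_group_add vertex_data \<Rightarrow> (complex \<Rightarrow> 'w::ab_group_add \<Rightarrow> 'w) \<Rightarrow> 'w set \<Rightarrow>
   ('v \<Rightarrow> int \<Rightarrow> 'w \<Rightarrow> 'w) \<Rightarrow> bool" where
  "generalized_module V s W Y \<longleftrightarrow>
     vertex_operator_map V s W Y \<and> module.span s (\<Union>n. weight_space V s W Y n) = W"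

definition grading_restricted ::
  "'v vertex_data \<Rightarrow> (complex \<Rightarrow> 'w::ab_group_add \<Rightarrow> 'w) \<Rightarrow> 'w set \<Rightarrow>
   ('v \<Rightarrow> int \<Rightarrow> 'w \<Rightarrow> 'w) \<Rightarrow> bool" where
  "grading_restricted V s W Y \<longleftrightarrow>
     (\<forall>n. finite_dim s (weight_space V s W Y n)) \<and>
     (\<exists>r::real. \<forall>n. Re n < r \<longrightarrow> weight_space V s W Y n = {0})"

definition voa_module ::
  "'v::ab_group_add vertex_data \<Rightarrow> (complex \<Rightarrow> 'w::ab_group_add \<Rightarrow> 'w) \<Rightarrow> 'w set \<Rightarrow>
   ('v \<Rightarrow> int \<Rightarrow> 'w \<Rightarrow> 'w) \<Rightarrow> bool" where
  "voa_module V s W Y \<longleftrightarrow> generalized_module V s W Y \<and> grading_restricted V s W Y"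

definition weight_component :: "'v::ab_group_add vertex_data \<Rightarrow> 'v \<Rightarrow> int \<Rightarrow> 'v" where
  "weight_component V v = (THE c. (\<forall>h. c h \<in> weight_space V (scaleV V) UNIV (opV V) (of_int h)) \<and>
     finite {h. c h \<noteq> 0} \<and> v = Sum_any c)"

text \<open>
  The coefficient of \<open>x\<^sup>r\<close> in \<open>e\<^bsup>xL(1)\<^esup>(-x\<^bsup>-2\<^esup>)\<^bsup>L(0)\<^esup>v\<close>.  A component of weight \<open>h\<close> contributes
  \<open>(-1)\<^sup>h/j! L(1)\<^sup>j v\<^sub>h\<close> with \<open>j - 2h = r\<close>.
\<close>

definition opposite_vector :: "'v::ab_group_add vertex_data \<Rightarrow> 'v \<Rightarrow> int \<Rightarrow> 'v" where
  "opposite_vector V v r = Sum_any (\<lambda>h::int.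
     if r + 2 * h \<ge> 0
     then scaleV V ((-1) powi h / fact (nat (r + 2 * h)))
            ((Vir V (opV V) 1 ^^ nat (r + 2 * h)) (weight_component V v h))
     else 0)"

text \<open>
  The modes of \<open>Y\<^sup>*(v,x) = Y(e\<^bsup>xL(1)\<^esup>(-x\<^bsup>-2\<^esup>)\<^bsup>L(0)\<^esup>v, x\<^bsup>-1\<^esup>) = \<Sum>\<^sub>m v\<^sup>*\<^sub>m x\<^bsup>-m-1\<^esup>\<close>.
\<close>

definition opposite_op ::
  "'v::ab_group_add vertex_data \<Rightarrow> ('v \<Rightarrow> int \<Rightarrow> 'w::ab_group_add \<Rightarrow> 'w) \<Rightarrow> 'v \<Rightarrow> int \<Rightarrow> 'w \<Rightarrow> 'w" where
  "opposite_op V Y v m w = Sum_any (\<lambda>r::int. Y (opposite_vector V v r) (- r - m - 2) w)"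

text \<open>
  By the universal property, \<open>(W\<^sub>1 \<otimes> W\<^sub>2)\<^sup>*\<close> is the space of bilinear forms on \<open>W\<^sub>1 \<times> W\<^sub>2\<close>, with
  \<open>\<Lambda> w\<^sub>1 w\<^sub>2\<close> standing for \<open>\<Lambda>(w\<^sub>1 \<otimes> w\<^sub>2)\<close>.
\<close>

definition tensor_dual ::
  "(complex \<Rightarrow> 'a::ab_group_add \<Rightarrow> 'a) \<Rightarrow> (complex \<Rightarrow> 'b::ab_group_add \<Rightarrow> 'b) \<Rightarrow> ('a \<Rightarrow> 'b \<Rightarrow> complex) set" where
  "tensor_dual s1 s2 = {\<Lambda>. (\<forall>w2. Vector_Spaces.linear s1 (*) (\<lambda>w1. \<Lambda> w1 w2)) \<and>
                           (\<forall>w1. Vector_Spaces.linear s2 (*) (\<lambda>w2. \<Lambda> w1 w2))}"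

definition scale_form :: "complex \<Rightarrow> ('a \<Rightarrow> 'b \<Rightarrow> complex) \<Rightarrow> 'a \<Rightarrow> 'b \<Rightarrow> complex" where
  "scale_form c \<Lambda> = (\<lambda>w1 w2. c * \<Lambda> w1 w2)"

text \<open>
  \<open>\<iota>\<^sub>+\<complex>[t,t\<^bsup>-1\<^esup>,(z\<^bsup>-1\<^esup>-t)\<^bsup>-1\<^esup>]\<close>, with \<open>t\<close> = \<^const>\<open>fls_X\<close>: inverses in the field of formal
  Laurent series in \<open>t\<close> are expansions in the direction of positive powers of \<open>t\<close>.
\<close>

definition scale_fls :: "complex \<Rightarrow> complex fls \<Rightarrow> complex fls" where
  "scale_fls c f = fls_const c * f"

definition iota_ring :: "complex \<Rightarrow> complex fls set" where
  "iota_ring z = module.span scale_fls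
     {fls_X powi m * inverse (fls_const (inverse z) - fls_X) ^ k | m k. True}"

text \<open>
  The coefficient of \<open>x\<^sub>0\<^bsup>-n-1\<^esup> x\<^sub>1\<^bsup>-m-1\<^esup>\<close> in \<open>x\<^sub>0\<^bsup>-1\<^esup>\<delta>((x\<^sub>1\<^bsup>-1\<^esup>-z)/x\<^sub>0) Y\<^sub>t(v,x\<^sub>1)\<close> is
  \<open>v \<otimes> \<Sum>\<^sub>i (n choose i) (-z)\<^sup>i t\<^bsup>m-n+i\<^esup> = v \<otimes> \<iota>\<^sub>+(t\<^sup>m (t\<^bsup>-1\<^esup>-z)\<^sup>n)\<close>.
\<close>

definition delta_coeff :: "complex \<Rightarrow> int \<Rightarrow> int \<Rightarrow> complex fls" where
  "delta_coeff z n m = fls_X powi m * (inverse fls_X - fls_const z) powi n"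

text \<open>
  The coefficient of \<open>x\<^sub>0\<^bsup>-n-1\<^esup> x\<^sub>1\<^bsup>-m-1\<^esup>\<close> in
  \<open>z\<^bsup>-1\<^esup>\<delta>((x\<^sub>1\<^bsup>-1\<^esup>-x\<^sub>0)/z) \<Lambda>(Y\<^sub>1(e\<^bsup>x\<^sub>1L(1)\<^esup>(-x\<^sub>1\<^bsup>-2\<^esup>)\<^bsup>L(0)\<^esup>v,x\<^sub>0)w\<^sub>1 \<otimes> w\<^sub>2)
    + x\<^sub>0\<^bsup>-1\<^esup>\<delta>((z-x\<^sub>1\<^bsup>-1\<^esup>)/(-x\<^sub>0)) \<Lambda>(w\<^sub>1 \<otimes> Y\<^sub>2\<^sup>*(v,x\<^sub>1)w\<^sub>2)\<close>.
  Here \<open>z\<^bsup>-1\<^esup>\<delta>((x\<^sub>1\<^bsup>-1\<^esup>-x\<^sub>0)/z) = \<Sum>\<^sub>k z\<^bsup>-k-1\<^esup> \<Sum>\<^sub>i (k choose i) (-1)\<^sup>i x\<^sub>1\<^bsup>i-k\<^esup> x\<^sub>0\<^sup>i\<close>; against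
  the coefficient of \<open>x\<^sub>1\<^sup>r\<close> in the argument of \<open>Y\<^sub>1\<close> this requires \<open>k = m + 1 + i + r\<close>.
\<close>

definition tau_rhs ::
  "'v::ab_group_add vertex_data \<Rightarrow> ('v \<Rightarrow> int \<Rightarrow> 'a::ab_group_add \<Rightarrow> 'a) \<Rightarrow> ('v \<Rightarrow> int \<Rightarrow> 'b::ab_group_add \<Rightarrow> 'b) \<Rightarrow>
   complex \<Rightarrow> 'v \<Rightarrow> int \<Rightarrow> int \<Rightarrow> ('a \<Rightarrow> 'b \<Rightarrow> complex) \<Rightarrow> 'a \<Rightarrow> 'b \<Rightarrow> complex" where
  "tau_rhs V Y1 Y2 z v n m \<Lambda> w1 w2 =
     Sum_any (\<lambda>r::int. Sum_any (\<lambda>i::nat. let k = m + 1 + int i + r in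
       z powi (- k - 1) * (of_int k gchoose i) * (-1) ^ i *
       \<Lambda> (Y1 (opposite_vector V v r) (n + int i) w1) w2))
     + Sum_any (\<lambda>i::nat. (-1) powi n * (of_int n gchoose i) * z powi (n - int i) * (-1) ^ i *
       \<Lambda> w1 (opposite_op V Y2 v (m - int i) w2))"

text \<open>
  \<open>\<tau>\<^bsub>P(z)\<^esub>(v \<otimes> f)\<close>: the linear map on \<open>V \<otimes> \<iota>\<^sub>+\<complex>[t,t\<^bsup>-1\<^esup>,(z\<^bsup>-1\<^esup>-t)\<^bsup>-1\<^esup>]\<close> with the values
  \<^const>\<open>tau_rhs\<close> on the coefficients \<^const>\<open>delta_coeff\<close>, which span the second factor
  (unique existence is shown below).
\<close>

definition tau ::
  "'v::ab_group_add vertex_data \<Rightarrow> ('v \<Rightarrow> int \<Rightarrow> 'a::ab_group_add \<Rightarrow> 'a) \<Rightarrow> ('v \<Rightarrow> int \<Rightarrow> 'b::ab_group_add \<Rightarrow> 'b) \<Rightarrow>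
   complex \<Rightarrow> 'v \<Rightarrow> complex fls \<Rightarrow> ('a \<Rightarrow> 'b \<Rightarrow> complex) \<Rightarrow> 'a \<Rightarrow> 'b \<Rightarrow> complex" where
  "tau V Y1 Y2 z v f \<Lambda> w1 w2 =
     (THE \<phi>. (\<forall>f\<in>iota_ring z. \<forall>g\<in>iota_ring z. \<phi> (f + g) = \<phi> f + \<phi> g) \<and>
             (\<forall>f\<in>iota_ring z. \<forall>c. \<phi> (scale_fls c f) = c * \<phi> f) \<and>
             (\<forall>f. f \<notin> iota_ring z \<longrightarrow> \<phi> f = 0) \<and>
             (\<forall>n m. \<phi> (delta_coeff z n m) = tau_rhs V Y1 Y2 z v n m \<Lambda> w1 w2)) f"

text \<open>\<open>Y'\<^bsub>P(z)\<^esub>(v,x) = \<tau>\<^bsub>P(z)\<^esub>(Y\<^sub>t(v,x))\<close>; the coefficient of \<open>x\<^bsup>-n-1\<^esup>\<close> in \<open>Y\<^sub>t(v,x)\<close> is \<open>v \<otimes> t\<^sup>n\<close>.\<close>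

definition Y_prime ::
  "'v::ab_group_add vertex_data \<Rightarrow> ('v \<Rightarrow> int \<Rightarrow> 'a::ab_group_add \<Rightarrow> 'a) \<Rightarrow> ('v \<Rightarrow> int \<Rightarrow> 'b::ab_group_add \<Rightarrow> 'b) \<Rightarrow>
   complex \<Rightarrow> 'v \<Rightarrow> int \<Rightarrow> ('a \<Rightarrow> 'b \<Rightarrow> complex) \<Rightarrow> 'a \<Rightarrow> 'b \<Rightarrow> complex" where
  "Y_prime V Y1 Y2 z v n = tau V Y1 Y2 z v (fls_X powi n)"

text \<open>
  In the second condition, the right-hand side is the coefficient of \<open>x\<^sub>0\<^bsup>-n-1\<^esup> x\<^sub>1\<^bsup>-m-1\<^esup>\<close> in
  \<open>x\<^sub>0\<^bsup>-1\<^esup>\<delta>((x\<^sub>1\<^bsup>-1\<^esup>-z)/x\<^sub>0) Y'\<^bsub>P(z)\<^esub>(v,x\<^sub>1)\<Lambda>\<close>; the sum is finite by the first condition.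
\<close>

definition P_compatible ::
  "'v::ab_group_add vertex_data \<Rightarrow> ('v \<Rightarrow> int \<Rightarrow> 'a::ab_group_add \<Rightarrow> 'a) \<Rightarrow> ('v \<Rightarrow> int \<Rightarrow> 'b::ab_group_add \<Rightarrow> 'b) \<Rightarrow>
   complex \<Rightarrow> ('a \<Rightarrow> 'b \<Rightarrow> complex) \<Rightarrow> bool" where
  "P_compatible V Y1 Y2 z \<Lambda> \<longleftrightarrow>
     (\<forall>v. \<exists>N. \<forall>n\<ge>N. Y_prime V Y1 Y2 z v n \<Lambda> = 0) \<and>
     (\<forall>v n m. tau V Y1 Y2 z v (delta_coeff z n m) \<Lambda> =
        Sum_any (\<lambda>i::nat. scale_form ((of_int n gchoose i) * (- z) ^ i)
                            (Y_prime V Y1 Y2 z v (m - n + int i) \<Lambda>)))"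

definition generated_space ::
  "'v::ab_group_add vertex_data \<Rightarrow> (complex \<Rightarrow> 'a::ab_group_add \<Rightarrow> 'a) \<Rightarrow> ('v \<Rightarrow> int \<Rightarrow> 'a \<Rightarrow> 'a) \<Rightarrow>
   (complex \<Rightarrow> 'b::ab_group_add \<Rightarrow> 'b) \<Rightarrow> ('v \<Rightarrow> int \<Rightarrow> 'b \<Rightarrow> 'b) \<Rightarrow>
   complex \<Rightarrow> ('a \<Rightarrow> 'b \<Rightarrow> complex) \<Rightarrow> ('a \<Rightarrow> 'b \<Rightarrow> complex) set" where
  "generated_space V s1 Y1 s2 Y2 z \<Lambda> =
     \<Inter>{U. U \<subseteq> tensor_dual s1 s2 \<and> module.subspace scale_form U \<and> \<Lambda> \<in> U \<and>
          (\<forall>v n. \<forall>\<mu>\<in>U. tau V Y1 Y2 z v (fls_X powi n) \<mu> \<in> U)}"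

definition P_local_grading_restricted ::
  "'v::ab_group_add vertex_data \<Rightarrow> (complex \<Rightarrow> 'a::ab_group_add \<Rightarrow> 'a) \<Rightarrow> ('v \<Rightarrow> int \<Rightarrow> 'a \<Rightarrow> 'a) \<Rightarrow>
   (complex \<Rightarrow> 'b::ab_group_add \<Rightarrow> 'b) \<Rightarrow> ('v \<Rightarrow> int \<Rightarrow> 'b \<Rightarrow> 'b) \<Rightarrow>
   complex \<Rightarrow> ('a \<Rightarrow> 'b \<Rightarrow> complex) \<Rightarrow> bool" where
  "P_local_grading_restricted V s1 Y1 s2 Y2 z \<Lambda> \<longleftrightarrow>
     \<Lambda> \<in> module.span scale_form
          (\<Union>n. weight_space V scale_form (tensor_dual s1 s2) (Y_prime V Y1 Y2 z) n) \<and>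
     grading_restricted V scale_form (generated_space V s1 Y1 s2 Y2 z \<Lambda>) (Y_prime V Y1 Y2 z)"

text \<open>\<open>W\<^sub>1 \<diamondop>\<^bsub>P(z)\<^esub> W\<^sub>2\<close>\<close>

definition P_diamond ::
  "'v::ab_group_add vertex_data \<Rightarrow> (complex \<Rightarrow> 'a::ab_group_add \<Rightarrow> 'a) \<Rightarrow> ('v \<Rightarrow> int \<Rightarrow> 'a \<Rightarrow> 'a) \<Rightarrow>
   (complex \<Rightarrow> 'b::ab_group_add \<Rightarrow> 'b) \<Rightarrow> ('v \<Rightarrow> int \<Rightarrow> 'b \<Rightarrow> 'b) \<Rightarrow>
   complex \<Rightarrow> ('a \<Rightarrow> 'b \<Rightarrow> complex) set" where
  "P_diamond V s1 Y1 s2 Y2 z = module.span scale_form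
     (\<Union>{W. W \<subseteq> tensor_dual s1 s2 \<and> voa_module V scale_form W (Y_prime V Y1 Y2 z) \<and>
          (\<forall>\<Lambda>\<in>W. P_compatible V Y1 Y2 z \<Lambda>)})"

text \<open>
  The remaining lemmas show that \<^const>\<open>tau\<close> is well defined: all linear relations between the
  \<^const>\<open>delta_coeff\<close> follow from the one in \<open>delta_coeff_rec\<close>, and \<^const>\<open>tau_rhs\<close>
  satisfies the same relation.
\<close>

lemma vector_space_scale_form: "vector_space scale_form"
  by standard (simp_all add: scale_form_def fun_eq_iff algebra_simps)

lemma delta_coeff_rec:
  assumes "z \<noteq> 0"
  shows "delta_coeff z (n + 1) m = delta_coeff z n (m - 1) - scale_fls z (delta_coeff z n m)"
proof -
  define u :: "complex fls" where "u = inverse fls_X - fls_const z"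
  have X: "(fls_X :: complex fls) \<noteq> 0" by simp
  have "fls_nth u (-1) = 1" by (simp add: u_def fls_inverse_X)
  then have u: "u \<noteq> 0" by auto
  have "fls_X powi m * u powi (n + 1) = fls_X powi m * u powi n * u"
    using u by (simp add: power_int_add)
  also have "\<dots> = fls_X powi m * inverse fls_X * u powi n - fls_const z * (fls_X powi m * u powi n)"
    by (simp add: u_def algebra_simps)
  also have "fls_X powi m * inverse fls_X = (fls_X powi (m - 1) :: complex fls)"
    using X power_int_diff[of "fls_X :: complex fls" m 1]
    by (simp only: divide_inverse power_int_1_right simp_thms)
  finally show ?thesis unfolding delta_coeff_def scale_fls_def u_def .
qed

interpretation fls_vs: vector_space scale_fls
  by standard (simp_all add: scale_fls_def algebra_simps flip: fls_const_mult_const fls_plus_const)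

lemma scale_fls_mult: "scale_fls c f * g = scale_fls c (f * g)" "f * scale_fls c g = scale_fls c (f * g)"
  by (simp_all add: scale_fls_def algebra_simps)

lemma generator_conv:
  assumes "z \<noteq> 0"
  shows "delta_coeff z (- int k) m = 
     scale_fls (inverse z ^ k) (fls_X powi (m + int k) * inverse (fls_const (inverse z) - fls_X) ^ k)"
proof -
  have X: "(fls_X :: complex fls) \<noteq> 0" by simp
  have "inverse fls_X - fls_const z = fls_const z * inverse fls_X * (fls_const (inverse z) - fls_X)"
    using assms X by (simp add: algebra_simps fls_const_mult_const)
  then have "(inverse fls_X - fls_const z) powi (- int k) =
     inverse (fls_const z * inverse fls_X * (fls_const (inverse z) - fls_X)) ^ k"
    by (simp only: power_int_minus power_inverse power_int_of_nat)
  also have "\<dots> = fls_const (inverse z ^ k) * fls_X ^ k * inverse (fls_const (inverse z) - fls_X) ^ k"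
    by (simp add: power_mult_distrib power_inverse flip: fls_inverse_const fls_const_power)
  finally have A: "(inverse fls_X - fls_const z) powi (- int k) = \<dots>" .
  show ?thesis unfolding delta_coeff_def scale_fls_def A using X
    by (simp only: power_int_add[OF disjI1] power_int_of_nat mult_ac not_False_eq_True simp_thms)
qed

lemma iota_ring_eq:
  assumes "z \<noteq> 0"
  shows "iota_ring z = fls_vs.span {delta_coeff z n m | n m. True}"
proof
  show "iota_ring z \<subseteq> fls_vs.span {delta_coeff z n m | n m. True}"
    unfolding iota_ring_def
  proof (rule fls_vs.span_minimal)
    show "fls_vs.subspace (fls_vs.span {delta_coeff z n m | n m. True})" by simp
    show "{fls_X powi m * inverse (fls_const (inverse z) - fls_X) ^ k |m k. True}
      \<subseteq> fls_vs.span {delta_coeff z n m |n m. True}"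
    proof clarify
      fix m :: int and k :: nat
      have "fls_X powi m * inverse (fls_const (inverse z) - fls_X) ^ k =
        scale_fls (z ^ k) (delta_coeff z (- int k) (m - int k))"
        using assms by (simp add: generator_conv flip: power_mult_distrib)
      moreover have "delta_coeff z (- int k) (m - int k) \<in> fls_vs.span {delta_coeff z n m |n m. True}"
        by (rule fls_vs.span_base) blast
      ultimately show "fls_X powi m * inverse (fls_const (inverse z) - fls_X) ^ k
        \<in> fls_vs.span {delta_coeff z n m |n m. True}"
        by (simp add: fls_vs.span_scale)
    qed
  qed
  have neg: "delta_coeff z (- int k) m \<in> iota_ring z" for k m
    unfolding generator_conv[OF assms] iota_ring_def
    by (rule fls_vs.span_scale, rule fls_vs.span_base) blast
  have sub: "fls_vs.subspace (iota_ring z)" unfolding iota_ring_def by simp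
  have pos: "delta_coeff z (int k) m \<in> iota_ring z" for k m
  proof (induction k arbitrary: m)
    case 0 then show ?case using neg[of 0] by simp
  next
    case (Suc k)
    have "int (Suc k) = int k + 1" by simp
    then show ?case unfolding delta_coeff_rec[OF assms] \<open>int (Suc k) = _\<close>
      by (intro fls_vs.subspace_diff fls_vs.subspace_scale sub Suc)
  qed
  show "fls_vs.span {delta_coeff z n m | n m. True} \<subseteq> iota_ring z"
  proof (rule fls_vs.span_minimal[OF _ sub], clarify)
    fix n m show "delta_coeff z n m \<in> iota_ring z"
      using neg[of "nat (-n)" m] pos[of "nat n" m] by (cases "n \<ge> 0") auto
  qed
qed

definition ext_poly :: "(int \<Rightarrow> int \<Rightarrow> complex) \<Rightarrow> nat \<Rightarrow> complex poly \<Rightarrow> complex" where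
  "ext_poly T N p = (\<Sum>i\<le>degree p. coeff p i * T (- int N) (int i - 2 * int N))"

lemma ext_poly_altdef: "degree p \<le> D \<Longrightarrow>
  ext_poly T N p = (\<Sum>i\<le>D. coeff p i * T (- int N) (int i - 2 * int N))"
  unfolding ext_poly_def
  by (rule sum.mono_neutral_left) (auto simp: coeff_eq_0)

lemma ext_poly_add: "ext_poly T N (p + q) = ext_poly T N p + ext_poly T N q"
  by (simp add: ext_poly_altdef[of _ "max (degree p) (degree q)"] degree_add_le sum.distrib algebra_simps)

lemma ext_poly_smult: "ext_poly T N (smult c p) = c * ext_poly T N p"
  by (simp add: ext_poly_altdef[of _ "degree p"] degree_smult_le sum_distrib_left algebra_simps)

lemma ext_poly_pCons: "ext_poly T N (pCons a p) =
   a * T (- int N) (- 2 * int N) + (\<Sum>i\<le>degree p. coeff p i * T (- int N) (int i + 1 - 2 * int N))"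
proof -
  have "ext_poly T N (pCons a p) = (\<Sum>i\<le>Suc (degree p). coeff (pCons a p) i * T (- int N) (int i - 2 * int N))"
    by (rule ext_poly_altdef) (simp add: degree_pCons_le)
  also have "\<dots> = a * T (- int N) (- 2 * int N) + (\<Sum>i\<le>degree p. coeff p i * T (- int N) (int i + 1 - 2 * int N))"
    by (subst sum.atMost_Suc_shift) (simp add: algebra_simps)
  finally show ?thesis .
qed

lemma powi_collect:
  fixes x u :: "'a::field"
  assumes "x \<noteq> 0" "u \<noteq> 0"
  shows "x powi m * inverse x powi n * u powi n * (x powi k * u powi k) = x powi (m - n + k) * u powi (n + k)"
  using assms by (simp add: power_int_add power_int_diff power_int_inverse field_simps)

lemma extend_from_coeffs:
  fixes T :: "int \<Rightarrow> int \<Rightarrow> complex"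
  assumes z: "z \<noteq> 0" and rec: "\<And>n m. T (n + 1) m = T n (m - 1) - z * T n m"
  shows "\<exists>!\<phi>. (\<forall>f\<in>iota_ring z. \<forall>g\<in>iota_ring z. \<phi> (f + g) = \<phi> f + \<phi> g) \<and>
             (\<forall>f\<in>iota_ring z. \<forall>c. \<phi> (scale_fls c f) = c * \<phi> f) \<and>
             (\<forall>f. f \<notin> iota_ring z \<longrightarrow> \<phi> f = 0) \<and>
             (\<forall>n m. \<phi> (delta_coeff z n m) = T n m)"
proof -
  define Q :: "complex poly" where "Q = [:0, 1, -z:]"
  define F :: "complex poly \<Rightarrow> complex fls" where "F p = fps_to_fls (fps_of_poly p)" for p
  have F_mult: "F (p * q) = F p * F q" for p q
    by (simp add: F_def fps_of_poly_mult fls_times_fps_to_fls)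
  have F_add: "F (p + q) = F p + F q" for p q
    by (simp add: F_def fps_of_poly_add)
  have F_smult: "F (smult c p) = scale_fls c (F p)" for c p
    by (simp add: F_def scale_fls_def fps_of_poly_smult fls_times_fps_to_fls)
  have F_power: "F (p ^ k) = F p ^ k" for p k
    by (induction k) (simp_all add: F_mult, simp add: F_def)
  have F_inj: "F p = F q \<longleftrightarrow> p = q" for p q
    by (simp add: F_def fps_of_poly_eq_iff)
  have Q0: "Q \<noteq> 0" by (simp add: Q_def)
  have step: "ext_poly T (Suc N) (Q * p) = ext_poly T N p" for N p
  proof -
    have e: "- int (Suc N) = - int N - 1" by simp
    have "Q * p = pCons 0 p + smult (-z) (pCons 0 (pCons 0 p))"
      by (simp add: Q_def)
    then have "ext_poly T (Suc N) (Q * p) = ext_poly T (Suc N) (pCons 0 p) - z * ext_poly T (Suc N) (pCons 0 (pCons 0 p))"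
      by (simp only: ext_poly_add ext_poly_smult, simp)
    also have "ext_poly T (Suc N) (pCons 0 (pCons 0 p)) =
       (\<Sum>i\<le>Suc (degree p). coeff (pCons 0 p) i * T (- int (Suc N)) (int i + 1 - 2 * int (Suc N)))"
      unfolding ext_poly_pCons by (cases "p = 0") simp_all
    also have "\<dots> = (\<Sum>i\<le>degree p. coeff p i * T (- int (Suc N)) (int i + 2 - 2 * int (Suc N)))"
      by (subst sum.atMost_Suc_shift) (simp add: algebra_simps)
    finally have "ext_poly T (Suc N) (Q * p) = (\<Sum>i\<le>degree p. coeff p i *
       (T (- int N - 1) (int i - 2 * int N - 1) - z * T (- int N - 1) (int i - 2 * int N)))"
      by (simp only: ext_poly_pCons e) (simp add: sum_subtractf sum_distrib_left algebra_simps)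
    also have "\<dots> = ext_poly T N p"
      using rec[of "- int N - 1"] by (simp add: ext_poly_def)
    finally show ?thesis .
  qed
  have steps: "ext_poly T (N + k) (Q ^ k * p) = ext_poly T N p" for N k p
    by (induction k) (simp_all add: step mult.assoc)
  have monom: "ext_poly T N ([:0,1:] ^ a * [:1, -z:] ^ b) = T (int b - int N) (int a + int b - 2 * int N)" for N a b
  proof (induction b arbitrary: a)
    case 0
    have "[:0, 1 :: complex:] ^ a = monom 1 a" by (simp add: monom_altdef)
    then show ?case by (simp add: ext_poly_altdef[of _ a] degree_monom_le mult_delta_left)
  next
    case (Suc b)
    have "[:0,1:] ^ a * [:1, -z:] ^ Suc b = [:0,1:] ^ a * [:1, -z:] ^ b + smult (-z) ([:0,1:] ^ Suc a * [:1, -z:] ^ b)"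
      by (simp add: distrib_left)
    then have "ext_poly T N ([:0,1:] ^ a * [:1, -z:] ^ Suc b) = 
       T (int b - int N) (int a + int b - 2 * int N) - z * T (int b - int N) (int (Suc a) + int b - 2 * int N)"
      by (simp only: ext_poly_add ext_poly_smult Suc, simp)
    also have "\<dots> = T (int (Suc b) - int N) (int a + int (Suc b) - 2 * int N)"
      using rec[of "int b - int N" "int a + int (Suc b) - 2 * int N"] by (simp add: algebra_simps)
    finally show ?case .
  qed
  define rep where "rep f N p \<longleftrightarrow> f * F Q ^ N = F p" for f N p
  have unique: "ext_poly T N p = ext_poly T M q" if "rep f N p" "rep f M q" for f N M p q
  proof -
    have "F (Q ^ M * p) = F (Q ^ N * q)"
      using that by (simp add: rep_def F_mult F_power flip: that[unfolded rep_def])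
    then have "Q ^ M * p = Q ^ N * q" by (simp add: F_inj)
    then have "ext_poly T (N + M) (Q ^ M * p) = ext_poly T (M + N) (Q ^ N * q)"
      by (simp add: add.commute)
    then show ?thesis by (simp add: steps)
  qed
  have rep_raise: "rep f (N + k) (Q ^ k * p)" if "rep f N p" for f N k p
    using that by (simp add: rep_def F_mult F_power power_add mult_ac flip: that[unfolded rep_def])
  have rep_add: "rep (f + g) (N + M) (Q ^ M * p + Q ^ N * q)" if "rep f N p" "rep g M q" for f g N M p q
    using rep_raise[OF that(1), of M] rep_raise[OF that(2), of N]
    by (simp add: rep_def F_add algebra_simps)
  have rep_scale: "rep (scale_fls c f) N (smult c p)" if "rep f N p" for c f N p
    using that by (simp add: rep_def F_smult scale_fls_mult)
  have FX: "F [:0,1:] = fls_X" by (simp add: F_def fps_of_poly_pCons)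
  have rep_delta: "\<exists>N p. rep (delta_coeff z n m) N p \<and> ext_poly T N p = T n m" for n m
  proof -
    define N where "N = nat (max (-n) (n - m))"
    define a where "a = nat (m - n + int N)"
    define b where "b = nat (n + int N)"
    have N: "int N \<ge> -n" "int N \<ge> n - m" by (auto simp: N_def)
    have X: "(fls_X :: complex fls) \<noteq> 0" by simp
    define U where "U = F [:1, -z:]"
    have U0: "U \<noteq> 0" using F_inj[of "[:1, -z:]" 0] by (simp add: U_def F_def)
    have U: "inverse fls_X - fls_const z = inverse fls_X * U"
      using X by (simp add: U_def F_def fps_of_poly_pCons algebra_simps fls_times_fps_to_fls)
    have "Q = [:0,1:] * [:1, -z:]" by (simp add: Q_def)
    then have FQ: "F Q = fls_X * U" by (simp only: F_mult FX U_def)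
    have "delta_coeff z n m * F Q ^ N = fls_X powi m * (inverse fls_X) powi n * U powi n * (fls_X powi int N * U powi int N)"
      by (simp add: delta_coeff_def U FQ power_int_mult_distrib power_mult_distrib)
    also have "\<dots> = fls_X powi (m - n + int N) * U powi (n + int N)"
      by (rule powi_collect[OF X U0])
    also have "\<dots> = fls_X ^ a * U ^ b"
      using N by (simp add: power_int_def a_def b_def)
    also have "\<dots> = F ([:0,1:] ^ a * [:1, -z:] ^ b)"
      by (simp only: F_mult F_power FX U_def)
    finally have "rep (delta_coeff z n m) N ([:0,1:] ^ a * [:1, -z:] ^ b)" by (simp add: rep_def)
    moreover have "ext_poly T N ([:0,1:] ^ a * [:1, -z:] ^ b) = T n m"
      unfolding monom using N by (simp add: a_def b_def)
    ultimately show ?thesis by blast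
  qed
  define R where "R = {f. \<exists>N p. rep f N p}"
  have "rep 0 0 0" by (simp add: rep_def F_def)
  then have "fls_vs.subspace R"
    unfolding fls_vs.subspace_def R_def using rep_add rep_scale by blast
  then have R: "iota_ring z \<subseteq> R"
    unfolding iota_ring_eq[OF z] using rep_delta by (intro fls_vs.span_minimal) (unfold R_def, blast+)
  define \<phi> where "\<phi> f = (if f \<in> iota_ring z then THE y. \<exists>N p. rep f N p \<and> y = ext_poly T N p else 0)" for f
  have phi: "\<phi> f = ext_poly T N p" if "f \<in> iota_ring z" "rep f N p" for f N p
  proof -
    have "(THE y. \<exists>N p. rep f N p \<and> y = ext_poly T N p) = ext_poly T N p"
      using that unique by (intro the_equality) blast+
    then show ?thesis using that by (simp add: \<phi>_def)
  qed
  have sub: "fls_vs.subspace (iota_ring z)" unfolding iota_ring_def by simp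
  have delta_in: "delta_coeff z n m \<in> iota_ring z" for n m
    unfolding iota_ring_eq[OF z] by (rule fls_vs.span_base) blast
  have phi_add: "\<phi> (f + g) = \<phi> f + \<phi> g" if fg: "f \<in> iota_ring z" "g \<in> iota_ring z" for f g
  proof -
    obtain N p M q where r: "rep f N p" "rep g M q" using R fg unfolding R_def by blast
    have "f + g \<in> iota_ring z" using fg sub by (simp add: fls_vs.subspace_add)
    then have "\<phi> (f + g) = ext_poly T (N + M) (Q ^ M * p + Q ^ N * q)"
      using rep_add[OF r] by (rule phi)
    also have "\<dots> = ext_poly T (N + M) (Q ^ M * p) + ext_poly T (M + N) (Q ^ N * q)"
      by (simp add: ext_poly_add add.commute)
    finally show ?thesis
      using fg r by (simp add: steps phi)
  qed
  have phi_scale: "\<phi> (scale_fls c f) = c * \<phi> f" if f: "f \<in> iota_ring z" for c f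
  proof -
    obtain N p where r: "rep f N p" using R f unfolding R_def by blast
    have "scale_fls c f \<in> iota_ring z" using f sub by (simp add: fls_vs.subspace_scale)
    then show ?thesis
      using phi[OF _ rep_scale[OF r]] phi[OF f r] by (simp add: ext_poly_smult)
  qed
  have phi_delta: "\<phi> (delta_coeff z n m) = T n m" for n m
    using rep_delta[of n m] phi[OF delta_in[of n m]] by auto
  show ?thesis
  proof (rule ex1I[of _ \<phi>])
    show "(\<forall>f\<in>iota_ring z. \<forall>g\<in>iota_ring z. \<phi> (f + g) = \<phi> f + \<phi> g) \<and>
             (\<forall>f\<in>iota_ring z. \<forall>c. \<phi> (scale_fls c f) = c * \<phi> f) \<and>
             (\<forall>f. f \<notin> iota_ring z \<longrightarrow> \<phi> f = 0) \<and>
             (\<forall>n m. \<phi> (delta_coeff z n m) = T n m)"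
      using phi_add phi_scale phi_delta by (simp add: \<phi>_def)
  next
    fix \<psi> :: "complex fls \<Rightarrow> complex" assume psi: "(\<forall>f\<in>iota_ring z. \<forall>g\<in>iota_ring z. \<psi> (f + g) = \<psi> f + \<psi> g) \<and>
             (\<forall>f\<in>iota_ring z. \<forall>c. \<psi> (scale_fls c f) = c * \<psi> f) \<and>
             (\<forall>f. f \<notin> iota_ring z \<longrightarrow> \<psi> f = 0) \<and>
             (\<forall>n m. \<psi> (delta_coeff z n m) = T n m)"
    have 0: "0 \<in> iota_ring z" using sub by (simp add: fls_vs.subspace_0)
    have eq: "f \<in> iota_ring z \<and> \<psi> f = \<phi> f" if "f \<in> fls_vs.span {delta_coeff z n m | n m. True}" for f
      using that
    proof (induction rule: fls_vs.span_induct_alt)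
      case base
      have "\<psi> (scale_fls 0 0) = 0 * \<psi> 0" "\<phi> (scale_fls 0 0) = 0 * \<phi> 0"
        using psi phi_scale 0 by blast+
      then show ?case using 0 by simp
    next
      case (step c x y)
      then obtain n m where x: "x = delta_coeff z n m" by blast
      then have cx: "scale_fls c x \<in> iota_ring z"
        using delta_in sub by (simp add: fls_vs.subspace_scale)
      then have mem: "scale_fls c x + y \<in> iota_ring z"
        using step.IH sub by (simp add: fls_vs.subspace_add)
      have "\<psi> (scale_fls c x + y) = c * \<psi> x + \<psi> y"
        using psi cx step.IH delta_in x by metis
      also have "\<dots> = \<phi> (scale_fls c x + y)"
        using cx step.IH delta_in[of n m] psi phi_delta x by (simp add: phi_add phi_scale)
      finally show ?case using mem by simp
    qed
    show "\<psi> = \<phi>"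
    proof
      fix f show "\<psi> f = \<phi> f"
        using eq[folded iota_ring_eq[OF z], of f] psi \<phi>_def by (cases "f \<in> iota_ring z") (blast, simp)
    qed
  qed
qed

lemma eigen_independent:
  fixes s :: "complex \<Rightarrow> 'v::ab_group_add \<Rightarrow> 'v"
  assumes "vector_space s"
    and add: "\<And>x y. L (x + y) = L x + L y" and sc: "\<And>c x. L (s c x) = s c (L x)"
    and "finite F" and "\<And>h. h \<in> F \<Longrightarrow> L (d h) = s (of_int h) (d h)" and "sum d F = 0" and "h \<in> F"
  shows "d (h::int) = 0"
  using assms(4-)
proof (induction F arbitrary: d h rule: finite_induct)
  case empty then show ?case by simp
next
  case (insert k F)
  interpret vector_space s by fact
  have L0: "L 0 = 0" using add[of 0 0] by simp
  have Lsum: "L (sum g A) = (\<Sum>h\<in>A. L (g h))" for g :: "int \<Rightarrow> 'v" and A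
    by (induction A rule: infinite_finite_induct) (simp_all add: L0 add)
  have "0 = L (sum d (insert k F)) - s (of_int k) (sum d (insert k F))"
    using insert.prems(2) by (simp add: L0)
  also have "\<dots> = (\<Sum>h\<in>insert k F. s (of_int (h - k)) (d h))"
    unfolding Lsum scale_sum_right sum_subtractf[symmetric]
    by (rule sum.cong) (simp_all add: insert.prems(1) scale_left_diff_distrib)
  also have "\<dots> = (\<Sum>h\<in>F. s (of_int (h - k)) (d h))"
    using insert.hyps by simp
  finally have "(\<Sum>h\<in>F. s (of_int (h - k)) (d h)) = 0" by simp
  then have "s (of_int (h - k)) (d h) = 0" if "h \<in> F" for h
    using insert.IH[of "\<lambda>h. s (of_int (h - k)) (d h)" h] that insert.prems(1)
    by (simp add: sc scale_left_commute)
  then have F: "d h = 0" if "h \<in> F" for h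
    using that insert.hyps by (auto simp: scale_eq_0_iff)
  then have "d k = 0" using insert.prems(2) insert.hyps by simp
  then show ?case using F insert.prems(3) by blast
qed

lemma finite_opposite_vector:
  fixes V :: "'v::ab_group_add vertex_data"
  assumes "vertex_operator_algebra V"
  shows "finite {r. opposite_vector V v r \<noteq> 0}"
proof -
  define s Y L where "s = scaleV V" and "Y = opV V" and "L = Vir V Y"
  define wt where "wt n = weight_space V s UNIV Y (of_int n)" for n :: int
  note defs = s_def[symmetric] Y_def[symmetric] L_def[symmetric] wt_def[symmetric]
  have voa: "vertex_operator_map V s UNIV Y"
    "\<exists>c. \<forall>m n v. L m (L n v) - L n (L m v) =
        s (of_int (m - n)) (L (m + n) v) + s (if m + n = 0 then of_int (m ^ 3 - m) / 12 * c else 0) v"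
    "module.span s (\<Union>n. wt n) = UNIV" "\<exists>N. \<forall>n<N. wt n = {0}"
    using assms unfolding vertex_operator_algebra_def Let_def defs by blast+
  interpret vector_space s using voa(1) unfolding vertex_operator_map_def by blast
  have L_add: "L n (x + y) = L n x + L n y" and L_scale: "L n (s c x) = s c (L n x)" for n x y c
    using voa(1) unfolding vertex_operator_map_def L_def Vir_def by blast+
  have wt_iff: "x \<in> wt n \<longleftrightarrow> L 0 x = s (of_int n) x" for x n
    by (simp add: wt_def weight_space_def L_def)
  have L_zero: "L n 0 = 0" for n using L_add[of n 0 0] by simp
  have wt0: "0 \<in> wt n" for n by (simp add: wt_iff L_zero)
  have wt_add: "x + y \<in> wt n" if "x \<in> wt n" "y \<in> wt n" for x y n
    using that by (simp add: wt_iff L_add scale_right_distrib)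
  have wt_scale: "s c x \<in> wt n" if "x \<in> wt n" for x c n
    using that by (simp add: wt_iff L_scale scale_left_commute)
  have wt_diff: "x - y \<in> wt n" if "x \<in> wt n" "y \<in> wt n" for x y n
    using wt_add[OF that(1) wt_scale[OF that(2), of "-1"]] by simp
  define dec where "dec v c \<longleftrightarrow> (\<forall>h. c h \<in> wt h) \<and> finite {h. c h \<noteq> 0} \<and> v = Sum_any c" for v and c :: "int \<Rightarrow> 'v"
  have fin_add: "finite {h. c h + d h \<noteq> 0}" if "finite {h. c h \<noteq> 0}" "finite {h. d h \<noteq> 0}" for c d :: "int \<Rightarrow> 'v"
    by (rule finite_subset[of _ "{h. c h \<noteq> 0} \<union> {h. d h \<noteq> 0}"]) (use that in auto)
  have "\<exists>c. dec v c"
  proof -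
    have "v \<in> span (\<Union>n. wt n)" using voa(3) by simp
    then show ?thesis
    proof (induction rule: span_induct_alt)
      case base
      show ?case by (rule exI[of _ "\<lambda>_. 0"]) (simp add: dec_def wt0)
    next
      case (step a x y)
      then obtain c n where c: "dec y c" and n: "x \<in> wt n" by blast
      let ?d = "\<lambda>h. if h = n then s a x else 0"
      have fd: "finite {h. ?d h \<noteq> 0}" by (rule finite_subset[of _ "{n}"]) auto
      have fc: "finite {h. c h \<noteq> 0}" using c by (simp add: dec_def)
      have "Sum_any (\<lambda>h. ?d h + c h) = s a x + y"
        using Sum_any.distrib[OF fd fc] c by (simp add: dec_def)
      moreover have "?d h + c h \<in> wt h" for h
        using c n by (auto simp: dec_def intro: wt_add wt_scale)
      ultimately have "dec (s a x + y) (\<lambda>h. ?d h + c h)"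
        using fin_add[OF fd fc] unfolding dec_def by metis
      then show ?case by (intro exI[where P = "dec (s a x + y)"])
    qed
  qed
  moreover have "c = d" if "dec v c" "dec v d" for c d
  proof
    fix h
    define F where "F = insert h ({h. c h \<noteq> 0} \<union> {h. d h \<noteq> 0})"
    have F: "finite F" using that by (simp add: F_def dec_def)
    have "Sum_any c = sum c F" "Sum_any d = sum d F"
      by (intro conjI Sum_any.expand_superset[OF F]; auto simp: F_def)+
    then have "(\<Sum>h\<in>F. c h - d h) = 0"
      using that by (simp add: sum_subtractf dec_def)
    then have "c h - d h = 0"
      using F that wt_diff by (intro eigen_independent[of s "L 0" F "\<lambda>h. c h - d h" h])
        (auto simp: L_add L_scale wt_iff[symmetric] dec_def F_def vector_space_axioms)
    then show "c h = d h" by simp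
  qed
  ultimately have "\<exists>!c. dec v c" by blast
  then have "dec v (weight_component V v)"
    unfolding weight_component_def defs dec_def[symmetric] by (rule theI')
  then have comp: "weight_component V v h \<in> wt h" "finite {h. weight_component V v h \<noteq> 0}" for h
    by (auto simp: dec_def)
  have L1: "L 1 x \<in> wt (n - 1)" if "x \<in> wt n" for x n
  proof -
    obtain c where "L 0 (L 1 x) - L 1 (L 0 x) =
        s (of_int (0 - 1)) (L (0 + 1) x) + s (if (0::int) + 1 = 0 then of_int (0 ^ 3 - 0) / 12 * c else 0) x"
      using voa(2) by metis
    then have "L 0 (L 1 x) - L 1 (L 0 x) = - L 1 x" by simp
    then show ?thesis using that by (simp add: wt_iff L_scale scale_left_diff_distrib algebra_simps)
  qed
  have L1_pow: "(L 1 ^^ j) x \<in> wt (n - int j)" if "x \<in> wt n" for x n j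
  proof (induction j)
    case (Suc j)
    have "n - int (Suc j) = n - int j - 1" by simp
    then show ?case using L1[OF Suc] by (simp only: funpow.simps o_apply)
  qed (use that in simp)
  obtain N where N: "\<forall>n<N. wt n = {0}" using voa(4) by blast
  have "{r. opposite_vector V v r \<noteq> 0} \<subseteq> (\<Union>h\<in>{h. weight_component V v h \<noteq> 0}. {- 2 * h .. - h - N})"
  proof
    fix r assume "r \<in> {r. opposite_vector V v r \<noteq> 0}"
    then obtain h where r: "r + 2 * h \<ge> 0" and
      "s ((-1) powi h / fact (nat (r + 2 * h))) ((L 1 ^^ nat (r + 2 * h)) (weight_component V v h)) \<noteq> 0"
      unfolding opposite_vector_def defs
      by (auto elim!: Sum_any.not_neutral_obtains_not_neutral split: if_splits)
    then have nz: "(L 1 ^^ nat (r + 2 * h)) (weight_component V v h) \<noteq> 0" by auto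
    have "(L 1 ^^ j) 0 = 0" for j by (induction j) (simp_all add: L_zero)
    then have "weight_component V v h \<noteq> 0" using nz by metis
    moreover have "\<not> h - int (nat (r + 2 * h)) < N"
      using nz N L1_pow[OF comp(1)[of h], of "nat (r + 2 * h)"] by auto
    ultimately show "r \<in> (\<Union>h\<in>{h. weight_component V v h \<noteq> 0}. {- 2 * h .. - h - N})"
      using r by (intro UN_I[of h]) auto
  qed
  then show ?thesis by (rule finite_subset) (use comp(2) in simp)
qed

lemma Sum_any_atMost:
  assumes "\<And>i. i > M \<Longrightarrow> f i = (0::complex)"
  shows "Sum_any f = (\<Sum>i\<le>(M::nat). f i)"
  by (rule Sum_any.expand_superset) (use assms not_le in auto)

lemma expansion_rec_1:
  fixes z :: complex and a :: "int \<Rightarrow> complex"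
  assumes z: "z \<noteq> 0" and a: "\<And>n. n \<ge> N \<Longrightarrow> a n = 0"
  defines "G \<equiv> \<lambda>n q. Sum_any (\<lambda>i::nat. z powi (- (q + int i) - 1) * (of_int (q + int i) gchoose i) * (-1) ^ i * a (n + int i))"
  shows "G (n + 1) q = G n (q - 1) - z * G n q"
proof -
  define M where "M = nat (N - n)"
  define g where "g n q i = z powi (- (q + int i) - 1) * (of_int (q + int i) gchoose i) * (-1) ^ i * a (n + int i)" for n q i
  have M: "a (n + int i) = 0" if "i > M" for i
    using that by (intro a) (auto simp: M_def)
  have G1: "G (n + 1) q = (\<Sum>i\<le>M. g (n + 1) q i)" for q
    unfolding G_def g_def using M[of "Suc i" for i] by (intro Sum_any_atMost) (simp add: add_ac)
  have G0: "G n q = (\<Sum>i\<le>Suc M. g n q i)" for q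
    unfolding G_def g_def using M by (intro Sum_any_atMost) simp
  have 0: "g n (q - 1) 0 - z * g n q 0 = 0"
    using z by (simp add: g_def power_int_diff)
  have S: "g n (q - 1) (Suc i) - z * g n q (Suc i) = g (n + 1) q i" for i
  proof -
    have e: "z * z powi (- (q + int (Suc i)) - 1) = z powi (- (q + int i) - 1)"
      using z by (simp add: power_int_diff power_int_minus power_int_add power2_eq_square field_simps)
    have e': "- (q - 1 + int (Suc i)) - 1 = - (q + int i) - 1" by simp
    have b: "((of_int (q + int (Suc i)) :: complex) gchoose Suc i) =
      (of_int (q + int i) gchoose i) + (of_int (q + int i) gchoose Suc i)"
      using gbinomial_Suc_Suc[of "of_int (q + int i) :: complex" i] by (simp add: add_ac)
    have b': "q - 1 + int (Suc i) = q + int i" by simp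
    have "z * g n q (Suc i) = z powi (- (q + int i) - 1) * (of_int (q + int (Suc i)) gchoose Suc i) * (-1) ^ Suc i * a (n + int (Suc i))"
      unfolding g_def e[symmetric] by simp
    then show ?thesis unfolding b unfolding g_def e' unfolding b'
      by (simp add: algebra_simps)
  qed
  have "G n (q - 1) - z * G n q = (\<Sum>i\<le>Suc M. g n (q - 1) i - z * g n q i)"
    unfolding G0 by (simp only: sum_subtractf sum_distrib_left)
  also have "\<dots> = (\<Sum>i\<le>M. g (n + 1) q i)"
    by (subst sum.atMost_Suc_shift) (simp only: 0 S add_0_left)
  finally show ?thesis by (simp add: G1)
qed

lemma expansion_rec_2:
  fixes z :: complex and b :: "int \<Rightarrow> complex"
  assumes z: "z \<noteq> 0" and b: "\<And>n. n \<le> N \<Longrightarrow> b n = 0"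
  defines "H \<equiv> \<lambda>n m. Sum_any (\<lambda>i::nat. (-1) powi n * (of_int n gchoose i) * z powi (n - int i) * (-1) ^ i * b (m - int i))"
  shows "H (n + 1) m = H n (m - 1) - z * H n m"
proof -
  define M where "M = nat (m - N)"
  define h where "h n m i = (-1) powi n * (of_int n gchoose i) * z powi (n - int i) * (-1) ^ i * b (m - int i)" for n m i
  have M: "b (m - int i) = 0" if "i > M" for i
    using that by (intro b) (auto simp: M_def)
  have H1: "H n (m - 1) = (\<Sum>i\<le>M. h n (m - 1) i)" for n
    unfolding H_def h_def using M[of "Suc i" for i] by (intro Sum_any_atMost) (simp add: algebra_simps)
  have H0: "H n m = (\<Sum>i\<le>Suc M. h n m i)" for n
    unfolding H_def h_def using M by (intro Sum_any_atMost) simp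
  have p: "(-1) powi (n + 1) = - ((-1) powi n :: complex)"
    by (simp add: power_int_add)
  have 0: "h (n + 1) m 0 + z * h n m 0 = 0"
    using z p by (simp add: h_def power_int_add)
  have S: "h (n + 1) m (Suc i) + z * h n m (Suc i) = h n (m - 1) i" for i
  proof -
    have e: "z * z powi (n - int (Suc i)) = z powi (n - int i)"
      using z by (simp add: power_int_diff power_int_add field_simps)
    have e': "n + 1 - int (Suc i) = n - int i" "m - int (Suc i) = m - 1 - int i" by simp_all
    have c: "((of_int (n + 1) :: complex) gchoose Suc i) = (of_int n gchoose i) + (of_int n gchoose Suc i)"
      using gbinomial_Suc_Suc[of "of_int n :: complex" i] by simp
    have q: "z * h n m (Suc i) = (-1) powi n * (of_int n gchoose Suc i) * z powi (n - int i) * (-1) ^ Suc i * b (m - 1 - int i)"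
      by (simp only: h_def e'(2) e[symmetric] mult_ac)
    have q': "h (n + 1) m (Suc i) = - ((-1) powi n) * ((of_int n gchoose i) + (of_int n gchoose Suc i)) *
        z powi (n - int i) * (-1) ^ Suc i * b (m - 1 - int i)"
      by (simp only: h_def e' c p)
    show ?thesis unfolding q q' unfolding h_def by (simp add: algebra_simps)
  qed
  have "H (n + 1) m + z * H n m = (\<Sum>i\<le>Suc M. h (n + 1) m i + z * h n m i)"
    unfolding H0 by (simp only: sum.distrib sum_distrib_left)
  also have "\<dots> = (\<Sum>i\<le>M. h n (m - 1) i)"
    by (subst sum.atMost_Suc_shift) (simp only: 0 S add_0_left)
  finally show ?thesis by (simp add: H1 algebra_simps)
qed

lemma tau_rhs_rec:
  assumes V: "vertex_operator_algebra V" and z: "z \<noteq> 0"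
    and Y1: "vertex_operator_map V s1 UNIV Y1" and Y2: "vertex_operator_map V s2 UNIV Y2"
    and lam: "\<Lambda> \<in> tensor_dual s1 s2"
  shows "tau_rhs V Y1 Y2 z v (n + 1) m \<Lambda> w1 w2 =
    tau_rhs V Y1 Y2 z v n (m - 1) \<Lambda> w1 w2 - z * tau_rhs V Y1 Y2 z v n m \<Lambda> w1 w2"
proof -
  define P where "P = opposite_vector V v"
  have P: "finite {r. P r \<noteq> 0}" unfolding P_def by (rule finite_opposite_vector[OF V])
  have "module_hom s1 (*) (\<lambda>x. \<Lambda> x y)" "module_hom s2 (*) (\<lambda>y. \<Lambda> x y)" for x y
    using lam by (simp_all add: tensor_dual_def module_hom_iff_linear)
  then have lam0: "\<Lambda> 0 y = 0" "\<Lambda> x 0 = 0" for x y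
    using module_hom.zero by blast+
  have tr1: "\<exists>N. \<forall>n\<ge>N. Y1 u n w = 0" for u w using Y1 unfolding vertex_operator_map_def by blast
  have tr2: "\<exists>N. \<forall>n\<ge>N. Y2 u n w = 0" for u w using Y2 unfolding vertex_operator_map_def by blast
  have "Y1 (u + v) n w = Y1 u n w + Y1 v n w" for u v n w
    using Y1 by (simp add: vertex_operator_map_def)
  from this[of 0 0] have Y10: "Y1 0 n w = 0" for n w by simp
  have "Y2 (u + v) n w = Y2 u n w + Y2 v n w" for u v n w
    using Y2 by (simp add: vertex_operator_map_def)
  from this[of 0 0] have Y20: "Y2 0 n w = 0" for n w by simp
  define G where "G r n q = Sum_any (\<lambda>i::nat. z powi (- (q + int i) - 1) * (of_int (q + int i) gchoose i) * (-1) ^ i *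
      \<Lambda> (Y1 (P r) (n + int i) w1) w2)" for r n q
  have G: "G r (n + 1) q = G r n (q - 1) - z * G r n q" for r n q
  proof -
    obtain N where "\<forall>n\<ge>N. Y1 (P r) n w1 = 0" using tr1 by blast
    then show ?thesis unfolding G_def
      by (intro expansion_rec_1[OF z, of N "\<lambda>n. \<Lambda> (Y1 (P r) n w1) w2"]) (simp add: lam0)
  qed
  have Gsupp: "G r n q = 0" if "P r = 0" for r n q
    using that by (simp add: G_def Y10 lam0)
  define H where "H n m = Sum_any (\<lambda>i::nat. (-1) powi n * (of_int n gchoose i) * z powi (n - int i) * (-1) ^ i *
       \<Lambda> w1 (opposite_op V Y2 v (m - int i) w2))" for n m
  have H: "H (n + 1) m = H n (m - 1) - z * H n m" for n m
  proof -
    have "\<exists>N. \<forall>r. \<forall>n\<le>N. Y2 (P r) (- r - n - 2) w2 = 0"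
    proof -
      have "\<forall>r. \<exists>N. \<forall>n\<ge>N. Y2 (P r) n w2 = 0" using tr2 by blast
      from choice[OF this] obtain K where K: "\<And>r n. n \<ge> K r \<Longrightarrow> Y2 (P r) n w2 = 0" by blast
      define N where "N = Min (insert 0 ((\<lambda>r. - r - 2 - K r) ` {r. P r \<noteq> 0}))"
      have "Y2 (P r) (- r - n - 2) w2 = 0" if "n \<le> N" for r n
      proof (cases "P r = 0")
        case False
        then have "N \<le> - r - 2 - K r" unfolding N_def using P by (intro Min_le) auto
        then show ?thesis using that by (intro K) simp
      qed (simp add: Y20)
      then show ?thesis by blast
    qed
    then obtain N where N: "\<And>r n. n \<le> N \<Longrightarrow> Y2 (P r) (- r - n - 2) w2 = 0" by blast
    have "opposite_op V Y2 v n w2 = 0" if "n \<le> N" for n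
      using N[OF that] by (simp add: opposite_op_def P_def)
    then show ?thesis unfolding H_def
      by (intro expansion_rec_2[OF z, of N "\<lambda>p. \<Lambda> w1 (opposite_op V Y2 v p w2)"]) (simp add: lam0)
  qed
  have T: "tau_rhs V Y1 Y2 z v n m \<Lambda> w1 w2 = (\<Sum>r\<in>{r. P r \<noteq> 0}. G r n (m + 1 + r)) + H n m" for n m
  proof -
    have "tau_rhs V Y1 Y2 z v n m \<Lambda> w1 w2 = Sum_any (\<lambda>r. G r n (m + 1 + r)) + H n m"
      unfolding tau_rhs_def G_def H_def P_def Let_def by (simp add: add_ac)
    also have "Sum_any (\<lambda>r. G r n (m + 1 + r)) = (\<Sum>r\<in>{r. P r \<noteq> 0}. G r n (m + 1 + r))"
      by (rule Sum_any.expand_superset[OF P]) (use Gsupp in auto)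
    finally show ?thesis .
  qed
  show ?thesis
    unfolding T H G by (simp add: sum_subtractf sum_distrib_left algebra_simps)
qed

lemma tau_unique_existence:
  fixes V :: "'v::ab_group_add vertex_data"
  assumes "vertex_operator_algebra V" and "z \<noteq> 0"
    and "vertex_operator_map V s1 UNIV Y1" and "vertex_operator_map V s2 UNIV Y2"
    and "\<Lambda> \<in> tensor_dual s1 s2"
  shows "\<exists>!\<phi>. (\<forall>f\<in>iota_ring z. \<forall>g\<in>iota_ring z. \<phi> (f + g) = \<phi> f + \<phi> g) \<and>
             (\<forall>f\<in>iota_ring z. \<forall>c. \<phi> (scale_fls c f) = c * \<phi> f) \<and>
             (\<forall>f. f \<notin> iota_ring z \<longrightarrow> \<phi> f = 0) \<and>
             (\<forall>n m. \<phi> (delta_coeff z n m) = tau_rhs V Y1 Y2 z v n m \<Lambda> w1 w2)"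
  by (rule extend_from_coeffs[of z "\<lambda>n m. tau_rhs V Y1 Y2 z v n m \<Lambda> w1 w2", OF assms(2) tau_rhs_rec[OF assms]])

lemma tau_delta_coeff:
  fixes V :: "'v::ab_group_add vertex_data"
  assumes "vertex_operator_algebra V" and "z \<noteq> 0"
    and "vertex_operator_map V s1 UNIV Y1" and "vertex_operator_map V s2 UNIV Y2"
    and "\<Lambda> \<in> tensor_dual s1 s2"
  shows "tau V Y1 Y2 z v (delta_coeff z n m) \<Lambda> w1 w2 = tau_rhs V Y1 Y2 z v n m \<Lambda> w1 w2"
  using theI'[OF tau_unique_existence[OF assms, of v w1 w2]] unfolding tau_def by blast

end

theory Submission
  imports Defs
begin

text \<open>
  Think of \<open>W\<^sub>1\<close> at \<open>z\<close> and of \<open>W\<^sub>2\<close> at \<open>0\<close> on the projective line.  Up to the coordinate change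
  \<open>x \<mapsto> x\<^bsup>-1\<^esup>\<close>, \<open>\<tau>\<^bsub>P(z)\<^esub>\<close> is the action of \<open>V \<otimes> \<complex>[x,x\<^bsup>-1\<^esup>,(x - z)\<^bsup>-1\<^esup>]\<close> on functionals obtained by
  expanding a rational function at \<open>0\<close> and at \<open>z\<close>, and \<open>\<Lambda>\<close> is compatible iff, for each \<open>v\<close>, all \<open>v \<otimes> f\<close> with
  \<open>f\<close> vanishing to high order at infinity annihilate \<open>\<Lambda>\<close>.  By the commutator formula this
  property is preserved by the action.  For compatible \<open>\<Lambda>\<close> the product of two actions can be expanded near
  \<open>0\<close> and \<open>z\<close>, and the Jacobi identities of \<open>W\<^sub>1\<close> and \<open>W\<^sub>2\<close> give an opposite Jacobi identity, which
  the conjugation formula for \<open>e\<^bsup>xL(1)\<^esup>\<close> turns into the Jacobi identity for \<open>Y'\<^bsub>P(z)\<^esub>\<close>.  Hence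
  every \<open>\<Lambda>\<close> satisfying both conditions generates a compatible module; conversely every element of a
  compatible module satisfies them, and the sum of two compatible modules is again one.
\<close>

subsection \<open>Binomial coefficients and finite sums\<close>

text \<open>The commutator formula for the action holds for every bilinear form. Compatibility is
  needed for the Jacobi identity: its sums over products of two modes are infinite without
  truncation, and once \<open>v\<close> has moved to z a power of x1 - x2 must be re-expanded in
  another region, which is legitimate only for functionals that annihilate functions of high order
  at infinity. The condition as given mixes this vanishing with the vectors
  \<open>(L 1 ^^ j) v\<close> of the coordinate change; \<open>bounded_at_infinity\<close> isolates
  the vanishing, and in this form the commutator formula visibly preserves it. Rational functions do
  not occur as objects: x^m (x - z)^l is represented by its exponents. Expansions at infinity use
  only the recursion for multiplication by x - z and the vanishing for l + m \<le> N, where - l - m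
  is the order of vanishing at infinity. Infinite sums are compared through partial sums with one
  large cutoff, so bounds often have to be uniform in an auxiliary mode. A second obstacle is the
  grading restriction for a sum of two modules, which rests on the independence of the eigenspaces
  of L(0).\<close>

abbreviation ibinom :: "int \<Rightarrow> nat \<Rightarrow> complex" where
  "ibinom n k \<equiv> of_int n gchoose k"

lemma ibinom_Vandermonde: "(\<Sum>a\<le>p. ibinom x a * ibinom y (p - a)) = ibinom (x + y) p"
  using gbinomial_Vandermonde[of "of_int x :: complex" "of_int y" p] by (simp add: atMost_atLeast0)

lemma ibinom_trinomial:
  "k \<le> m \<Longrightarrow> ibinom x m * ibinom (int m) k = ibinom x k * ibinom (x - int k) (m - k)"
  using gbinomial_trinomial_revision[of k m "of_int x :: complex"] by simp

text \<open>Both sides are \<open>ibinom l (p + q)\<close> times the number of ways to split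
  \<open>p + q\<close> elements into \<open>p\<close> and \<open>q\<close>.\<close>

lemma ibinom_swap: "ibinom l q * ibinom (l - int q) p = ibinom l p * ibinom (l - int p) q"
proof -
  have "ibinom l (p + q) * ibinom (int (p + q)) q = ibinom l q * ibinom (l - int q) p"
    using ibinom_trinomial[of q "p + q" l] by simp
  moreover have "ibinom l (p + q) * ibinom (int (p + q)) p = ibinom l p * ibinom (l - int p) q"
    using ibinom_trinomial[of p "p + q" l] by simp
  moreover have "ibinom (int (p + q)) q = ibinom (int (p + q)) p"
    using binomial_symmetric[of q "p + q"] by (simp add: binomial_gbinomial[symmetric] del: of_nat_add)
  ultimately show ?thesis by simp
qed

lemma ibinom_uminus: "ibinom (- x) k = (-1) ^ k * ibinom (x + int k - 1) k"
  using gbinomial_minus[of "of_int x :: complex" k] by simp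

lemma ibinom_of_nat_eq_0: "k < q \<Longrightarrow> ibinom (int k) q = 0"
  by (simp add: binomial_gbinomial[symmetric] binomial_eq_0)

lemma ibinom_Suc: "ibinom (n + 1) (Suc k) = ibinom n k + ibinom n (Suc k)"
  using gbinomial_Suc_Suc[of "of_int n :: complex" k] by simp

text \<open>Upper negation replaces \<open>ibinom (X - int i) (I - i)\<close> by a coefficient whose
  upper index is independent of \<open>i\<close>; what remains is a Vandermonde convolution.\<close>

lemma ibinom_alternating:
  "(\<Sum>i\<le>I. (-1) ^ i * ibinom m i * ibinom (X - int i) (I - i)) = ibinom (X - m) I"
proof -
  have 1: "ibinom (X - int i) (I - i) = (-1) ^ (I - i) * ibinom (int I - X - 1) (I - i)" if "i \<le> I" for i
    using ibinom_uminus[of "int i - X" "I - i"] that by (simp add: of_nat_diff)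
  have "(\<Sum>i\<le>I. (-1) ^ i * ibinom m i * ibinom (X - int i) (I - i)) =
     (\<Sum>i\<le>I. (-1) ^ I * (ibinom m i * ibinom (int I - X - 1) (I - i)))"
  proof (rule sum.cong)
    fix i assume "i \<in> {..I}"
    then have i: "i \<le> I" by simp
    have "(-1) ^ I = (-1) ^ i * (-1 :: complex) ^ (I - i)"
      using i by (simp flip: power_add)
    then show "(-1) ^ i * ibinom m i * ibinom (X - int i) (I - i) = (-1) ^ I * (ibinom m i * ibinom (int I - X - 1) (I - i))"
      unfolding 1[OF i] by simp
  qed simp
  also have "\<dots> = (-1) ^ I * ibinom (m + (int I - X - 1)) I"
    by (simp only: sum_distrib_left[symmetric] ibinom_Vandermonde)
  also have "\<dots> = ibinom (X - m) I"
    using ibinom_uminus[of "m - X" I] by (simp add: algebra_simps)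
  finally show ?thesis .
qed

text \<open>Up to a power of z, the left side is the p-th Taylor coefficient at z of g f^(k)/k! for
  f = x^m and g = x^n. The right side multiplies the Taylor coefficients of g by those of f^(k)/k!,
  read off from the coefficients of f.\<close>

lemma ibinom_translate:
  "ibinom m k * ibinom (m + n - int k) p =
   (\<Sum>a\<le>p. ibinom n a * ibinom m (k + (p - a)) * ibinom (int (k + (p - a))) k)"
proof -
  have "ibinom m k * ibinom (m + n - int k) p = ibinom m k * (\<Sum>a\<le>p. ibinom n a * ibinom (m - int k) (p - a))"
    by (subst ibinom_Vandermonde) (simp add: algebra_simps)
  also have "\<dots> = (\<Sum>a\<le>p. ibinom n a * (ibinom m k * ibinom (m - int k) (p - a)))"
    by (simp add: sum_distrib_left mult_ac)
  also have "\<dots> = (\<Sum>a\<le>p. ibinom n a * (ibinom m (k + (p - a)) * ibinom (int (k + (p - a))) k))"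
    by (subst ibinom_trinomial) simp_all
  finally show ?thesis by (simp only: mult.assoc)
qed

text \<open>Up to signs and powers of z, both sides are the coefficient of y^k x^p in (z + y)^n (x -
  z - y)^l; the left side expands in y before x, the right side in x before y.\<close>

lemma ibinom_cross:
  "(\<Sum>q\<le>k. ibinom n (k - q) * ibinom l q * ibinom (l - int q) p) = ibinom l p * ibinom (n + l - int p) k"
proof -
  have "(\<Sum>q\<le>k. ibinom n (k - q) * ibinom l q * ibinom (l - int q) p) =
        ibinom l p * (\<Sum>q\<le>k. ibinom (l - int p) q * ibinom n (k - q))"
    unfolding sum_distrib_left mult.assoc ibinom_swap[of l _ p] by (simp add: mult_ac)
  then show ?thesis unfolding ibinom_Vandermonde by (simp add: algebra_simps)
qed

text \<open>The analogue of \<open>ibinom_cross\<close> for large x, with the coefficient of y^k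
  x^(l - i). The guard is needed because truncated subtraction makes \<open>i - q\<close> zero for
  \<open>q > i\<close>.\<close>

lemma ibinom_cross':
  "(\<Sum>q\<le>k. if q \<le> i then ibinom n (k - q) * ibinom l q * ibinom (l - int q) (i - q) else 0) =
   ibinom l i * ibinom (n + int i) k"
proof -
  have "(\<Sum>q\<le>k. if q \<le> i then ibinom n (k - q) * ibinom l q * ibinom (l - int q) (i - q) else 0) =
     (\<Sum>q\<le>k. ibinom l i * (ibinom (int i) q * ibinom n (k - q)))"
  proof (rule sum.cong)
    fix q assume "q \<in> {..k}"
    show "(if q \<le> i then ibinom n (k - q) * ibinom l q * ibinom (l - int q) (i - q) else 0) =
       ibinom l i * (ibinom (int i) q * ibinom n (k - q))"
    proof (cases "q \<le> i")
      case True
      have "ibinom l q * ibinom (l - int q) (i - q) = ibinom l i * ibinom (int i) q"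
        by (rule ibinom_trinomial[OF True, symmetric])
      then show ?thesis using True by (simp del: of_int_diff of_int_of_nat_eq)
    next
      case False
      then have "ibinom (int i) q = 0" by (intro ibinom_of_nat_eq_0) simp
      with False show ?thesis by (simp del: of_int_of_nat_eq)
    qed
  qed simp
  also have "\<dots> = ibinom l i * ibinom (n + int i) k"
    by (simp only: sum_distrib_left[symmetric] ibinom_Vandermonde) (simp add: add.commute)
  finally show ?thesis .
qed

lemma Sum_any_lessThan: "(\<And>i. i \<ge> K \<Longrightarrow> f i = 0) \<Longrightarrow> Sum_any f = (\<Sum>i<(K::nat). f i)"
  by (rule Sum_any.expand_superset) (auto simp: not_less[symmetric])

lemma sum_lessThan_extend:
  "(\<And>i. i \<ge> K \<Longrightarrow> f i = 0) \<Longrightarrow> K \<le> M \<Longrightarrow> (\<Sum>i<M. f i) = (\<Sum>i<(K::nat). f i)"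
  by (rule sum.mono_neutral_right) auto

text \<open>The bound on \<open>M\<close> makes the triangle \<open>a + b < M\<close> contain the
  rectangle that supports \<open>h\<close>.\<close>

lemma sum_convolution:
  fixes h :: "nat \<Rightarrow> nat \<Rightarrow> 'c::comm_monoid_add"
  assumes "\<And>a b. a \<ge> A \<or> b \<ge> B \<Longrightarrow> h a b = 0" and "A + B \<le> M"
  shows "(\<Sum>c<M. \<Sum>a\<le>c. h a (c - a)) = (\<Sum>a<A. \<Sum>b<B. h a b)"
proof -
  have "(\<Sum>c<M. \<Sum>a\<le>c. h a (c - a)) = (\<Sum>(c, a)\<in>(SIGMA c:{..<M}. {..c}). h a (c - a))"
    by (simp add: sum.Sigma)
  also have "\<dots> = (\<Sum>(a, b)\<in>{(a, b). a + b < M}. h a b)"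
    by (rule sum.reindex_bij_witness[of _ "\<lambda>(a, b). (a + b, a)" "\<lambda>(c, a). (a, c - a)"]) auto
  also have "\<dots> = (\<Sum>(a, b)\<in>{..<A} \<times> {..<B}. h a b)"
  proof (rule sum.mono_neutral_right)
    have "{(a, b). a + b < M} \<subseteq> {..<M} \<times> {..<M}" by auto
    then show "finite {(a, b). a + b < M}" by (rule finite_subset) simp
    show "\<forall>i\<in>{(a, b). a + b < M} - {..<A} \<times> {..<B}. (case i of (a, b) \<Rightarrow> h a b) = 0"
      using assms(1) by (auto simp flip: not_le)
  qed (use assms(2) in auto)
  finally show ?thesis by (simp add: sum.cartesian_product)
qed

section \<open>Expansion at infinity from the recursion for multiplication by x - z\<close>

lemma expansion_recursion_unique:
  fixes E :: "int \<Rightarrow> int \<Rightarrow> complex"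
  assumes rec: "\<And>l m. E (l + 1) m = E l (m + 1) - z * E l m"
    and vanish: "\<And>l m. l + m \<le> N \<Longrightarrow> E l m = 0"
    and zero: "\<And>m. E 0 m = 0"
  shows "E l m = 0"
proof (induction l arbitrary: m rule: int_induct[of _ 0])
  case base
  show ?case by (rule zero)
next
  case (step1 l)
  then show ?case by (simp add: rec)
next
  \<comment> \<open>Downwards in \<open>l\<close> the recursion only says that the values form a
    geometric progression in \<open>m\<close> with ratio z; it vanishes because it starts in the
    region covered by \<open>vanish\<close>.\<close>
  case (step2 l)
  have E: "E (l - 1) (m + 1) = z * E (l - 1) m" for m
    using rec[of "l - 1" m] step2 by simp
  have "E (l - 1) (N - l + int k) = 0" for k
  proof (induction k)
    case 0 then show ?case by (simp add: vanish)
  next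
    case (Suc k)
    then show ?case using E[of "N - l + int k"] by (simp add: algebra_simps)
  qed
  from this[of "nat (m - (N - l))"] show ?case
    by (cases "m \<ge> N - l") (auto intro: vanish)
qed

text \<open>This is the expansion of x^m (x - z)^l in powers of z/x. The right side satisfies the
  same recursion and agrees with \<open>D\<close> for \<open>l = 0\<close>, so uniqueness identifies
  the two.\<close>

lemma expansion_recursion_formula:
  fixes D :: "int \<Rightarrow> int \<Rightarrow> complex"
  assumes rec: "\<And>l m. D (l + 1) m = D l (m + 1) - z * D l m"
    and vanish: "\<And>l m. l + m \<le> N \<Longrightarrow> D l m = 0"
    and K: "l + m - int K \<le> N"
  shows "D l m = (\<Sum>i<K. (-1) ^ i * ibinom l i * z ^ i * D 0 (m + l - int i))"
proof -
  define F where "F l m = Sum_any (\<lambda>i. (-1) ^ i * ibinom l i * z ^ i * D 0 (m + l - int i))" for l m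
  have F: "F l m = (\<Sum>i<K. (-1) ^ i * ibinom l i * z ^ i * D 0 (m + l - int i))"
    if "l + m - int K \<le> N" for l m and K :: nat
    unfolding F_def using that by (intro Sum_any_lessThan) (simp add: vanish del: of_int_diff)
  have F_rec: "F (l + 1) m = F l (m + 1) - z * F l m" for l m
  proof -
    define K where "K = nat (l + m - N)"
    define d where "d i = D 0 (m + l + 1 - int i)" for i
    have d: "D 0 (m + l - int i) = d (Suc i)" for i by (simp add: d_def algebra_simps)
    have "F (l + 1) m = (\<Sum>i<Suc K. (-1) ^ i * ibinom (l + 1) i * z ^ i * d i)"
      by (subst F[of _ _ "Suc K"]) (auto simp: K_def d_def add_ac)
    also have "\<dots> = d 0 + (\<Sum>i<K. (-1) ^ Suc i * ibinom (l + 1) (Suc i) * z ^ Suc i * d (Suc i))"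
      by (subst sum.lessThan_Suc_shift) simp
    also have "(\<Sum>i<K. (-1) ^ Suc i * ibinom (l + 1) (Suc i) * z ^ Suc i * d (Suc i)) =
       (\<Sum>i<K. (-1) ^ Suc i * ibinom l (Suc i) * z ^ Suc i * d (Suc i)) -
       z * (\<Sum>i<K. (-1) ^ i * ibinom l i * z ^ i * d (Suc i))"
      unfolding ibinom_Suc sum_distrib_left sum_subtractf[symmetric]
      by (intro sum.cong) (simp_all add: algebra_simps)
    also have "d 0 + (\<dots>) = (\<Sum>i<Suc K. (-1) ^ i * ibinom l i * z ^ i * d i) -
       z * (\<Sum>i<K. (-1) ^ i * ibinom l i * z ^ i * d (Suc i))"
      by (subst sum.lessThan_Suc_shift) simp
    also have "(\<Sum>i<Suc K. (-1) ^ i * ibinom l i * z ^ i * d i) = F l (m + 1)"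
      by (subst F[of _ _ "Suc K"]) (auto simp: K_def d_def add_ac)
    also have "(\<Sum>i<K. (-1) ^ i * ibinom l i * z ^ i * d (Suc i)) = F l m"
      by (subst F[of _ _ "K"]) (auto simp: K_def d)
    finally show ?thesis .
  qed
  have "D l m - F l m = 0"
  proof (rule expansion_recursion_unique[of "\<lambda>l m. D l m - F l m" z N])
    show "D (l + 1) m - F (l + 1) m = D l (m + 1) - F l (m + 1) - z * (D l m - F l m)" for l m
      unfolding rec F_rec by (simp add: right_diff_distrib)
    show "D l m - F l m = 0" if "l + m \<le> N" for l m
      using that F[of l m 0] by (simp add: vanish)
    have "F 0 m = (\<Sum>i<Suc (nat (m - N)). if i = 0 then D 0 m else 0)" for m
      by (subst F[of _ _ "Suc (nat (m - N))"]) (arith, intro sum.cong, simp_all add: gbinomial_0_left)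
    then show "D 0 m - F 0 m = 0" for m by (simp del: sum.lessThan_Suc)
  qed
  then show ?thesis using F[OF K] by simp
qed

text \<open>Let \<open>D l m\<close> be the value of a functional on x^m (x - z)^l. Both sides are
  its value on the coefficient of y^k in x^m (z + y)^n (x - z - y)^l, which is expanded in powers of
  (z + y)/x on the left and of y/(x - z) on the right.\<close>

lemma expansion_recursion_translate:
  fixes D :: "int \<Rightarrow> int \<Rightarrow> complex"
  assumes z: "z \<noteq> 0" and rec: "\<And>l m. D (l + 1) m = D l (m + 1) - z * D l m"
    and vanish: "\<And>l m. l + m \<le> N \<Longrightarrow> D l m = 0"
    and I: "l + m - int I \<le> N"
  shows "(\<Sum>i<I. (-1) ^ i * ibinom l i * (ibinom (n + int i) k * z powi (n + int i - int k) * D 0 (m + l - int i))) =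
    (\<Sum>q\<le>k. ibinom n (k - q) * z powi (n - int k + int q) * ((-1) ^ q * ibinom l q * D (l - int q) m))"
proof -
  \<comment> \<open>Lowering \<open>l\<close> by \<open>q\<close> lowers the required number of
    terms by \<open>q\<close>; shifting the index by \<open>q\<close> aligns the arguments of
    \<open>D 0\<close> for all \<open>q\<close>.\<close>
  have D: "D (l - int q) m = (\<Sum>i<I. if q \<le> i then
      (-1) ^ (i - q) * ibinom (l - int q) (i - q) * z ^ (i - q) * D 0 (m + l - int i) else 0)" for q
  proof -
    have "D (l - int q) m = (\<Sum>i<I - q. (-1) ^ i * ibinom (l - int q) i * z ^ i * D 0 (m + (l - int q) - int i))"
      using rec vanish by (rule expansion_recursion_formula[where D = D and N = N]) (use I in arith)+
    also have "\<dots> = (\<Sum>i\<in>{..<I} \<inter> {i. q \<le> i}. (-1) ^ (i - q) * ibinom (l - int q) (i - q) * z ^ (i - q) * D 0 (m + l - int i))"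
      by (rule sum.reindex_bij_witness[of _ "\<lambda>i. i - q" "\<lambda>i. i + q"]) (auto simp: algebra_simps)
    finally show ?thesis by (simp add: sum.inter_restrict del: of_int_diff)
  qed
  have "(\<Sum>q\<le>k. ibinom n (k - q) * z powi (n - int k + int q) * ((-1) ^ q * ibinom l q * D (l - int q) m)) =
    (\<Sum>i<I. \<Sum>q\<le>k. ibinom n (k - q) * z powi (n - int k + int q) * ((-1) ^ q * ibinom l q * (if q \<le> i then
      (-1) ^ (i - q) * ibinom (l - int q) (i - q) * z ^ (i - q) * D 0 (m + l - int i) else 0)))"
    unfolding D by (simp only: sum_distrib_left sum.swap[of _ "{..<I}" "{..k}"])
  also have "\<dots> = (\<Sum>i<I. (-1) ^ i * ibinom l i * (ibinom (n + int i) k * z powi (n + int i - int k) * D 0 (m + l - int i)))"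
  proof (rule sum.cong[OF refl])
    fix i assume "i \<in> {..<I}"
    have "(\<Sum>q\<le>k. ibinom n (k - q) * z powi (n - int k + int q) * ((-1) ^ q * ibinom l q * (if q \<le> i then
      (-1) ^ (i - q) * ibinom (l - int q) (i - q) * z ^ (i - q) * D 0 (m + l - int i) else 0))) =
      (\<Sum>q\<le>k. (if q \<le> i then ibinom n (k - q) * ibinom l q * ibinom (l - int q) (i - q) else 0) *
       ((-1) ^ i * z powi (n + int i - int k) * D 0 (m + l - int i)))"
    proof (rule sum.cong[OF refl])
      fix q assume "q \<in> {..k}"
      show "ibinom n (k - q) * z powi (n - int k + int q) * ((-1) ^ q * ibinom l q * (if q \<le> i then
        (-1) ^ (i - q) * ibinom (l - int q) (i - q) * z ^ (i - q) * D 0 (m + l - int i) else 0)) =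
        (if q \<le> i then ibinom n (k - q) * ibinom l q * ibinom (l - int q) (i - q) else 0) *
       ((-1) ^ i * z powi (n + int i - int k) * D 0 (m + l - int i))"
      proof (cases "q \<le> i")
        case True
        have s: "(-1) ^ i = (-1) ^ q * (-1 :: complex) ^ (i - q)"
          using True by (simp flip: power_add)
        have "n + int i - int k = (n - int k + int q) + int (i - q)" using True by simp
        then have t: "z powi (n + int i - int k) = z powi (n - int k + int q) * z ^ (i - q)"
          using z by (simp only: power_int_add[OF disjI1] power_int_of_nat not_False_eq_True)
        show ?thesis unfolding s t using True by simp
      qed simp
    qed
    also have "\<dots> = (-1) ^ i * ibinom l i * (ibinom (n + int i) k * z powi (n + int i - int k) * D 0 (m + l - int i))"
      unfolding sum_distrib_right[symmetric] ibinom_cross' by (simp only: mult_ac)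
    finally show "(\<Sum>q\<le>k. ibinom n (k - q) * z powi (n - int k + int q) * ((-1) ^ q * ibinom l q * (if q \<le> i then
      (-1) ^ (i - q) * ibinom (l - int q) (i - q) * z ^ (i - q) * D 0 (m + l - int i) else 0))) = \<dots>" .
  qed
  finally show ?thesis by simp
qed

subsection \<open>Conjugation by \<open>e\<^bsup>xL(1)\<^esup>\<close>\<close>

lemma (in vector_space) subspace_eigenspace:
  assumes "\<And>x y. L (x + y) = L x + L y" and "\<And>c x. L (scale c x) = scale c (L x)"
  shows "subspace {x. L x = scale a x}"
  using assms(1)[of 0 0] by (simp add: subspace_def assms scale_right_distrib scale_left_commute)

section \<open>Commutator formulas from the Jacobi identity\<close>

locale vertex_map =
  fixes V :: "'v::ab_group_add vertex_data" and s :: "complex \<Rightarrow> 'w::ab_group_add \<Rightarrow> 'w"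
    and W :: "'w set" and Y :: "'v \<Rightarrow> int \<Rightarrow> 'w \<Rightarrow> 'w"
  assumes VM: "vertex_operator_map V s W Y"
begin

sublocale vector_space s using VM unfolding vertex_operator_map_def by blast

lemma subspace_W: "subspace W"
  and Y_add_left: "w \<in> W \<Longrightarrow> Y (u + v) n w = Y u n w + Y v n w"
  and Y_scale_left: "w \<in> W \<Longrightarrow> Y (scaleV V c v) n w = s c (Y v n w)"
  and Y_add: "w \<in> W \<Longrightarrow> w' \<in> W \<Longrightarrow> Y v n (w + w') = Y v n w + Y v n w'"
  and Y_scale: "w \<in> W \<Longrightarrow> Y v n (s c w) = s c (Y v n w)"
  and Y_vacuum: "w \<in> W \<Longrightarrow> Y (vacuum V) n w = (if n = -1 then w else 0)"
  and Y_translation: "w \<in> W \<Longrightarrow> Y (Vir V (opV V) (-1) v) n w = s (- of_int n) (Y v (n - 1) w)"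
  using VM by (simp_all add: vertex_operator_map_def)

lemma Y_zero: "Y v n 0 = 0"
  using Y_add[of 0 0 v n] subspace_0[OF subspace_W] by simp

lemma Y_zero_left: "w \<in> W \<Longrightarrow> Y 0 n w = 0"
  using Y_add_left[of w 0 0 n] by simp

lemma Y_truncation: "w \<in> W \<Longrightarrow> \<exists>N. \<forall>n\<ge>N. Y v n w = 0"
  using VM unfolding vertex_operator_map_def by blast

lemma Y_truncation_nat:
  assumes "w \<in> W"
  shows "\<exists>K::nat. \<forall>i\<ge>K. Y v (n + int i) w = 0"
proof -
  obtain N where N: "\<forall>n\<ge>N. Y v n w = 0" using Y_truncation[OF assms] by blast
  have "Y v (n + int i) w = 0" if "i \<ge> nat (N - n)" for i using that N by auto
  then show ?thesis by blast
qed

lemma Y_eventually_zero: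
  assumes "w \<in> W"
  shows "\<forall>\<^sub>F K in sequentially. \<forall>i\<ge>K. Y v (n + int i) w = 0"
  using Y_truncation_nat[OF assms] unfolding eventually_sequentially by (meson order_trans)

lemma jacobi:
  assumes "w \<in> W"
  shows "Sum_any (\<lambda>i::nat. s ((-1) ^ i * ibinom l i) (Y u (m + l - int i) (Y v (n + int i) w)))
     - Sum_any (\<lambda>i::nat. s ((-1) powi l * (-1) ^ i * ibinom l i) (Y v (n + l - int i) (Y u (m + int i) w)))
     = Sum_any (\<lambda>i::nat. s (ibinom m i) (Y (opV V u (l + int i) v) (m + n - int i) w))"
  using VM assms unfolding vertex_operator_map_def jacobi_identity_def by blast

text \<open>The Jacobi identity with \<open>l = 0\<close>: the sums on the left reduce to
  \<open>i = 0\<close>, and the nonnegative mode of \<open>u\<close> bounds the sum on the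
  right.\<close>

lemma commutator:
  assumes "w \<in> W"
  shows "Y u (int m) (Y v n w) - Y v n (Y u (int m) w) =
    (\<Sum>i\<le>m. s (of_nat (m choose i)) (Y (opV V u (int i) v) (int m + n - int i) w))"
proof -
  have 0: "s ((-1) ^ i * ibinom 0 i) x = (if i = 0 then x else 0)"
    "s ((-1) powi 0 * (-1) ^ i * ibinom 0 i) x = (if i = 0 then x else 0)" for i x
    by (simp_all add: gbinomial_0_left)
  have "Sum_any (\<lambda>i::nat. s (ibinom (int m) i) (Y (opV V u (0 + int i) v) (int m + n - int i) w)) =
    (\<Sum>i<Suc m. s (ibinom (int m) i) (Y (opV V u (0 + int i) v) (int m + n - int i) w))"
    by (rule Sum_any_lessThan) (simp add: ibinom_of_nat_eq_0 del: of_int_of_nat_eq)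
  also have "\<dots> = (\<Sum>i\<le>m. s (of_nat (m choose i)) (Y (opV V u (int i) v) (int m + n - int i) w))"
    by (simp add: binomial_gbinomial lessThan_Suc_atMost)
  finally have R: "Sum_any (\<lambda>i::nat. s (ibinom (int m) i) (Y (opV V u (0 + int i) v) (int m + n - int i) w)) = \<dots>" .
  have "Sum_any (\<lambda>i::nat. if i = 0 then f i else 0) = f 0" for f :: "nat \<Rightarrow> 'w"
    by (subst Sum_any_lessThan[of 1]) auto
  then show ?thesis
    using jacobi[OF assms, of 0 u "int m" v n] unfolding 0 R by simp
qed

text \<open>L(0) is mode 1 of the conformal vector, so the commutator has two terms: L(-1)v, which
  the translation axiom turns back into a mode of \<open>v\<close>, and L(0)v.\<close>

lemma L0_commutator:
  assumes "w \<in> W" and "Vir V (opV V) 0 v = scaleV V a v"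
  shows "Vir V Y 0 (Y v n w) = Y v n (Vir V Y 0 w) + s (a - of_int n - 1) (Y v n w)"
proof -
  have "opV V (conformal V) 0 v = Vir V (opV V) (-1) v" "opV V (conformal V) 1 v = scaleV V a v"
    using assms(2) by (simp_all add: Vir_def)
  then have "Y (conformal V) 1 (Y v n w) - Y v n (Y (conformal V) 1 w) =
    s (- of_int (n + 1)) (Y v n w) + s a (Y v n w)"
    using commutator[OF assms(1), of "conformal V" 1 v n] assms(1)
    by (simp add: Y_translation Y_scale_left)
  also have "\<dots> = s (a - of_int n - 1) (Y v n w)"
    by (simp only: scale_left_distrib[symmetric]) (simp add: algebra_simps del: scale_minus_left)
  finally show ?thesis by (simp add: Vir_def algebra_simps)
qed

lemma L1_commutator:
  assumes "w \<in> W" and "Vir V (opV V) 0 v = scaleV V a v"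
  shows "Vir V Y 1 (Y v n w) =
    Y (Vir V (opV V) 1 v) n w + s (2 * a - of_int n - 2) (Y v (n + 1) w) + Y v n (Vir V Y 1 w)"
proof -
  have o: "opV V (conformal V) 0 v = Vir V (opV V) (-1) v" "opV V (conformal V) 1 v = scaleV V a v"
    "opV V (conformal V) 2 v = Vir V (opV V) 1 v"
    using assms(2) by (simp_all add: Vir_def)
  have "{..2::nat} = {0, 1, 2}" by auto
  then have "Y (conformal V) 2 (Y v n w) - Y v n (Y (conformal V) 2 w) =
    s (- of_int (n + 2)) (Y v (n + 1) w) + (s (2 * a) (Y v (n + 1) w) + Y (Vir V (opV V) 1 v) n w)"
    using commutator[OF assms(1), of "conformal V" 2 v n] assms(1)
    by (simp add: o Y_translation Y_scale_left) (simp add: algebra_simps)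
  also have "\<dots> = s (2 * a - of_int n - 2) (Y v (n + 1) w) + Y (Vir V (opV V) 1 v) n w"
    by (simp only: scale_left_distrib[symmetric] add.assoc[symmetric]) (simp add: algebra_simps del: scale_minus_left)
  finally show ?thesis by (simp add: Vir_def algebra_simps)
qed

end

section \<open>The algebra acting on itself\<close>

locale voa =
  fixes V :: "'v::ab_group_add vertex_data"
  assumes VOA: "vertex_operator_algebra V"
begin

abbreviation sV where "sV \<equiv> scaleV V"
abbreviation L where "L \<equiv> Vir V (opV V)"
abbreviation wt :: "int \<Rightarrow> 'v set" where "wt n \<equiv> weight_space V sV UNIV (opV V) (of_int n)"

sublocale V: vertex_map V sV UNIV "opV V"
  using VOA unfolding vertex_operator_algebra_def Let_def by unfold_locales blast

lemma creation: "opV V v (-1) (vacuum V) = v" "n \<ge> 0 \<Longrightarrow> opV V v n (vacuum V) = 0"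
  and Virasoro: "\<exists>c. \<forall>m n v. L m (L n v) - L n (L m v) =
        sV (of_int (m - n)) (L (m + n) v) + sV (if m + n = 0 then of_int (m ^ 3 - m) / 12 * c else 0) v"
  and span_wt: "V.span (\<Union>n. wt n) = UNIV"
  and wt_bounded: "\<exists>N. \<forall>n<N. wt n = {0}"
  using VOA unfolding vertex_operator_algebra_def Let_def by blast+

lemma mem_wt: "v \<in> weight_space V sV UNIV (opV V) a \<longleftrightarrow> L 0 v = sV a v"
  by (simp add: weight_space_def)

lemma L_add: "L n (u + v) = L n u + L n v" and L_scale: "L n (sV c v) = sV c (L n v)" and L_zero: "L n 0 = 0"
  by (simp_all add: Vir_def V.Y_add V.Y_scale V.Y_zero)

lemma subspace_wt: "V.subspace (wt n)"
  using V.subspace_eigenspace[of "L 0" "of_int n"] by (simp add: weight_space_def L_add L_scale)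

lemma vacuum_mem_wt: "vacuum V \<in> wt 0" and L1_vacuum: "L 1 (vacuum V) = 0"
  by (simp_all add: mem_wt Vir_def creation)

lemma L1_mem_wt: "v \<in> wt n \<Longrightarrow> L 1 v \<in> wt (n - 1)"
proof -
  assume v: "v \<in> wt n"
  obtain c where "L 0 (L 1 v) - L 1 (L 0 v) =
      sV (of_int (0 - 1)) (L (0 + 1) v) + sV (if (0::int) + 1 = 0 then of_int (0 ^ 3 - 0) / 12 * c else 0) v"
    using Virasoro by metis
  then have "L 0 (L 1 v) - L 1 (L 0 v) = - L 1 v" by simp
  then show "L 1 v \<in> wt (n - 1)"
    using v by (simp add: mem_wt L_scale V.scale_left_diff_distrib algebra_simps)
qed

lemma L1_pow_mem_wt: "v \<in> wt n \<Longrightarrow> (L 1 ^^ j) v \<in> wt (n - int j)"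
proof (induction j)
  case (Suc j)
  have "n - int (Suc j) = n - int j - 1" by simp
  then show ?case using L1_mem_wt[OF Suc.IH[OF Suc.prems]] by (simp only: funpow.simps o_apply)
qed simp

lemma L1_pow_linear:
  "(L 1 ^^ j) (u + v) = (L 1 ^^ j) u + (L 1 ^^ j) v" "(L 1 ^^ j) (sV c v) = sV c ((L 1 ^^ j) v)" "(L 1 ^^ j) 0 = 0"
  by (induction j) (simp_all add: L_add L_scale L_zero)

text \<open>L(1) lowers weights by 1 and weights are bounded below; hence all exponentials of L(1)
  below are finite sums.\<close>

lemma L1_nilpotent:
  assumes "v \<in> wt n"
  shows "\<exists>J. \<forall>j\<ge>J. (L 1 ^^ j) v = 0"
proof -
  obtain N where N: "\<forall>n<N. wt n = {0}" using wt_bounded by blast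
  have "(L 1 ^^ j) v = 0" if "j \<ge> nat (n - N + 1)" for j
  proof -
    have "n - int j < N" using that by linarith
    then show ?thesis using N L1_pow_mem_wt[OF assms, of j] by auto
  qed
  then show ?thesis by blast
qed

lemma op_mem_wt:
  assumes "u \<in> wt a" "v \<in> wt b"
  shows "opV V u n v \<in> wt (a + b - n - 1)"
proof -
  have "L 0 (opV V u n v) = sV (of_int a - of_int n - 1) (opV V u n v) + sV (of_int b) (opV V u n v)"
    using V.L0_commutator[of v u "of_int a" n] assms by (simp add: mem_wt V.Y_scale)
  then show ?thesis by (simp add: mem_wt V.scale_left_distrib[symmetric])
qed

lemma L1_pow_op_step:
  assumes u: "u \<in> wt a"
  shows "L 1 (opV V ((L 1 ^^ j) u) n x) =
    opV V ((L 1 ^^ Suc j) u) n x + sV (of_int (2 * a - 2 * int j - n - 2)) (opV V ((L 1 ^^ j) u) (n + 1) x)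
    + opV V ((L 1 ^^ j) u) n (L 1 x)"
proof -
  have "2 * of_int (a - int j) - of_int n - 2 = (of_int (2 * a - 2 * int j - n - 2) :: complex)" by simp
  moreover have "L 0 ((L 1 ^^ j) u) = sV (of_int (a - int j)) ((L 1 ^^ j) u)"
    using L1_pow_mem_wt[OF u] by (simp only: mem_wt)
  ultimately show ?thesis
    using V.L1_commutator[of x "(L 1 ^^ j) u" "of_int (a - int j)" n] by (simp only: funpow.simps o_apply UNIV_I simp_thms)
qed

end

section \<open>Coefficients of the conjugation formula\<close>

definition simplex :: "nat \<Rightarrow> (nat \<times> nat \<times> nat) set" where
  "simplex c = {(i, j, k). i + j + k = c}"

lemma finite_simplex: "finite (simplex c)"
proof -
  have "simplex c \<subseteq> {..c} \<times> {..c} \<times> {..c}" by (auto simp: simplex_def)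
  then show ?thesis by (rule finite_subset) simp
qed

lemma simplex_shift:
  fixes f :: "nat \<Rightarrow> nat \<Rightarrow> nat \<Rightarrow> 'c::comm_monoid_add"
  shows "(\<And>j k. f 0 j k = 0) \<Longrightarrow> (\<Sum>(i, j, k)\<in>simplex c. f (Suc i) j k) = (\<Sum>(i, j, k)\<in>simplex (Suc c). f i j k)"
    and "(\<And>i k. f i 0 k = 0) \<Longrightarrow> (\<Sum>(i, j, k)\<in>simplex c. f i (Suc j) k) = (\<Sum>(i, j, k)\<in>simplex (Suc c). f i j k)"
    and "(\<And>i j. f i j 0 = 0) \<Longrightarrow> (\<Sum>(i, j, k)\<in>simplex c. f i j (Suc k)) = (\<Sum>(i, j, k)\<in>simplex (Suc c). f i j k)"
proof -
  assume z: "\<And>j k. f 0 j k = 0"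
  have "(\<Sum>(i, j, k)\<in>simplex c. f (Suc i) j k) = (\<Sum>(i, j, k)\<in>{(i, j, k)\<in>simplex (Suc c). i \<noteq> 0}. f i j k)"
    by (rule sum.reindex_bij_witness[of _ "\<lambda>(i, j, k). (i - 1, j, k)" "\<lambda>(i, j, k). (Suc i, j, k)"])
      (auto simp: simplex_def)
  also have "\<dots> = (\<Sum>(i, j, k)\<in>simplex (Suc c). f i j k)"
    by (rule sum.mono_neutral_left) (auto simp: finite_simplex z intro!: gr0I)
  finally show "(\<Sum>(i, j, k)\<in>simplex c. f (Suc i) j k) = (\<Sum>(i, j, k)\<in>simplex (Suc c). f i j k)" .
next
  assume z: "\<And>i k. f i 0 k = 0"
  have "(\<Sum>(i, j, k)\<in>simplex c. f i (Suc j) k) = (\<Sum>(i, j, k)\<in>{(i, j, k)\<in>simplex (Suc c). j \<noteq> 0}. f i j k)"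
    by (rule sum.reindex_bij_witness[of _ "\<lambda>(i, j, k). (i, j - 1, k)" "\<lambda>(i, j, k). (i, Suc j, k)"])
      (auto simp: simplex_def)
  also have "\<dots> = (\<Sum>(i, j, k)\<in>simplex (Suc c). f i j k)"
    by (rule sum.mono_neutral_left) (auto simp: finite_simplex z intro!: gr0I)
  finally show "(\<Sum>(i, j, k)\<in>simplex c. f i (Suc j) k) = (\<Sum>(i, j, k)\<in>simplex (Suc c). f i j k)" .
next
  assume z: "\<And>i j. f i j 0 = 0"
  have "(\<Sum>(i, j, k)\<in>simplex c. f i j (Suc k)) = (\<Sum>(i, j, k)\<in>{(i, j, k)\<in>simplex (Suc c). k \<noteq> 0}. f i j k)"
    by (rule sum.reindex_bij_witness[of _ "\<lambda>(i, j, k). (i, j, k - 1)" "\<lambda>(i, j, k). (i, j, Suc k)"])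
      (auto simp: simplex_def)
  also have "\<dots> = (\<Sum>(i, j, k)\<in>simplex (Suc c). f i j k)"
    by (rule sum.mono_neutral_left) (auto simp: finite_simplex z intro!: gr0I)
  finally show "(\<Sum>(i, j, k)\<in>simplex c. f i j (Suc k)) = (\<Sum>(i, j, k)\<in>simplex (Suc c). f i j k)" .
qed

lemma ibinom_absorb: "of_nat (Suc i) * ibinom X (Suc i) = of_int (X - int i) * ibinom X i"
  using gbinomial_mult_1[of "of_int X :: complex" i] by (simp add: algebra_simps)

text \<open>Applying L(1) once more reaches a given term from lower \<open>j\<close>, lower
  \<open>i\<close> or lower \<open>k\<close>. Pascal's rule cancels the parts of the first two
  contributions proportional to \<open>j * ibinom X (i - 1)\<close>; absorption turns the rest of
  the second into \<open>i * ibinom X i\<close>.\<close>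

lemma conjugation_coefficient:
  assumes "c + 1 = i + j + k"
  shows "of_nat j * ibinom (X + 1) i + (if i = 0 then 0 else of_int (X - int j - int i + 1) * ibinom X (i - 1))
    + of_nat k * ibinom X i = of_nat (c + 1) * ibinom X i"
proof (cases i)
  case 0
  then show ?thesis using assms by (simp add: algebra_simps flip: of_nat_add)
next
  case (Suc i')
  have "of_nat (c + 1) = (of_nat i + of_nat j + of_nat k :: complex)" unfolding assms by simp
  moreover have "of_nat (Suc i') * ibinom X (Suc i') = of_int (X - int i') * ibinom X i'"
    by (rule ibinom_absorb)
  ultimately show ?thesis unfolding Suc using ibinom_Suc[of X i'] by (simp add: algebra_simps)
qed


context voa
begin

text \<open>
  The coefficient of \<open>x\<^sup>c\<close> in \<open>e\<^bsup>xL(1)\<^esup> Y(u,x\<^sub>0) e\<^bsup>-xL(1)\<^esup> =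
  Y(e\<^bsup>x(1-xx\<^sub>0)L(1)\<^esup>(1-xx\<^sub>0)\<^bsup>-2L(0)\<^esup>u, x\<^sub>0/(1-xx\<^sub>0))\<close>.
\<close>

lemma exp_L1_conjugation:
  assumes u: "u \<in> wt a"
  shows "sV (1 / fact c) ((L 1 ^^ c) (opV V u l v)) =
    (\<Sum>(i, j, k)\<in>simplex c. sV (ibinom (2 * a - int j - l - 2) i / (fact j * fact k))
      (opV V ((L 1 ^^ j) u) (l + int i) ((L 1 ^^ k) v)))"
proof (induction c)
  case 0
  have "simplex 0 = {(0, 0, 0)}" by (auto simp: simplex_def)
  then show ?case by simp
next
  case (Suc c)
  define g where "g i j k = sV (1 / (fact j * fact k)) (opV V ((L 1 ^^ j) u) (l + int i) ((L 1 ^^ k) v))" for i j k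
  define X where "X j = 2 * a - int j - l - 2" for j
  have g: "sV (r / (fact j * fact k)) (opV V ((L 1 ^^ j) u) (l + int i) ((L 1 ^^ k) v)) = sV r (g i j k)" for r i j k
    by (simp add: g_def)
  \<comment> \<open>The factors \<open>Suc j\<close> and \<open>Suc k\<close> come from the
    factorials built into \<open>g\<close>; the middle term is the failure of L(1) to be a
    derivation.\<close>
  have L1_g: "L 1 (g i j k) = sV (of_nat (Suc j)) (g i (Suc j) k) +
      sV (of_int (X j - int j - int i)) (g (Suc i) j k) + sV (of_nat (Suc k)) (g i j (Suc k))" for i j k
  proof -
    have T1: "sV (1 / (fact j * fact k)) (opV V ((L 1 ^^ Suc j) u) (l + int i) ((L 1 ^^ k) v)) =
      sV (of_nat (Suc j)) (g i (Suc j) k)"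
      by (simp add: g_def field_simps del: funpow.simps of_nat_Suc)
    have T2: "sV (1 / (fact j * fact k)) (opV V ((L 1 ^^ j) u) (l + int i) ((L 1 ^^ Suc k) v)) =
      sV (of_nat (Suc k)) (g i j (Suc k))"
      by (simp add: g_def field_simps del: funpow.simps of_nat_Suc)
    have T3: "sV (1 / (fact j * fact k)) (sV (of_int (X j - int j - int i)) (opV V ((L 1 ^^ j) u) (l + int (Suc i)) ((L 1 ^^ k) v))) =
      sV (of_int (X j - int j - int i)) (g (Suc i) j k)"
      unfolding g_def by (rule V.scale_left_commute)
    have "L 1 (g i j k) = sV (1 / (fact j * fact k)) (L 1 (opV V ((L 1 ^^ j) u) (l + int i) ((L 1 ^^ k) v)))"
      by (simp only: g_def L_scale)
    also have "\<dots> = sV (1 / (fact j * fact k)) (opV V ((L 1 ^^ Suc j) u) (l + int i) ((L 1 ^^ k) v)) +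
      sV (1 / (fact j * fact k)) (sV (of_int (X j - int j - int i)) (opV V ((L 1 ^^ j) u) (l + int (Suc i)) ((L 1 ^^ k) v))) +
      sV (1 / (fact j * fact k)) (opV V ((L 1 ^^ j) u) (l + int i) ((L 1 ^^ Suc k) v))"
    proof -
      have "2 * a - 2 * int j - (l + int i) - 2 = X j - int j - int i" "l + int i + 1 = l + int (Suc i)"
        by (simp_all add: X_def)
      then show ?thesis unfolding L1_pow_op_step[OF u] by (simp only: V.scale_right_distrib funpow.simps o_apply)
    qed
    finally show ?thesis unfolding T1 T2 T3 .
  qed
  have L1_sum: "L 1 (\<Sum>x\<in>A. f x) = (\<Sum>x\<in>A. L 1 (f x))" if "finite A" for f :: "nat \<times> nat \<times> nat \<Rightarrow> 'v" and A
    using that by (induction A) (simp_all add: L_zero L_add)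
  \<comment> \<open>Writing \<open>X (Suc j) + 1\<close> for \<open>X j\<close> makes the summand a
    function of the shifted index, so that all three sums can be taken over the next
    simplex.\<close>
  have S1: "(\<Sum>(i, j, k)\<in>simplex c. sV (of_nat (Suc j) * ibinom (X (Suc j) + 1) i) (g i (Suc j) k)) =
      (\<Sum>(i, j, k)\<in>simplex (Suc c). sV (of_nat j * ibinom (X j + 1) i) (g i j k))"
    by (rule simplex_shift(2)[of "\<lambda>i j k. sV (of_nat j * ibinom (X j + 1) i) (g i j k)"]) simp
  have S2: "(\<Sum>(i, j, k)\<in>simplex c. sV (of_int (X j - int j - int (Suc i) + 1) * ibinom (X j) i) (g (Suc i) j k)) =
      (\<Sum>(i, j, k)\<in>simplex (Suc c). sV (if i = 0 then 0 else of_int (X j - int j - int i + 1) * ibinom (X j) (i - 1)) (g i j k))"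
    using simplex_shift(1)[of "\<lambda>i j k. sV (if i = 0 then 0 else of_int (X j - int j - int i + 1) * ibinom (X j) (i - 1)) (g i j k)" c]
    by (simp only: nat.distinct if_False diff_Suc_1 if_True V.scale_zero_left simp_thms)
  have S3: "(\<Sum>(i, j, k)\<in>simplex c. sV (of_nat (Suc k) * ibinom (X j) i) (g i j (Suc k))) =
      (\<Sum>(i, j, k)\<in>simplex (Suc c). sV (of_nat k * ibinom (X j) i) (g i j k))"
    by (rule simplex_shift(3)[of "\<lambda>i j k. sV (of_nat k * ibinom (X j) i) (g i j k)"]) simp
  have "sV (of_nat (Suc c)) (sV (1 / fact (Suc c)) ((L 1 ^^ Suc c) (opV V u l v))) =
      L 1 (sV (1 / fact c) ((L 1 ^^ c) (opV V u l v)))"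
    by (simp add: L_scale field_simps del: of_nat_Suc)
  also have "\<dots> = (\<Sum>(i, j, k)\<in>simplex c. sV (ibinom (X j) i) (L 1 (g i j k)))"
    unfolding Suc.IH g X_def[symmetric] L1_sum[OF finite_simplex]
    by (intro sum.cong) (simp_all only: split_beta L_scale)
  also have "\<dots> = (\<Sum>(i, j, k)\<in>simplex c. sV (of_nat (Suc j) * ibinom (X (Suc j) + 1) i) (g i (Suc j) k)) +
      (\<Sum>(i, j, k)\<in>simplex c. sV (of_int (X j - int j - int (Suc i) + 1) * ibinom (X j) i) (g (Suc i) j k)) +
      (\<Sum>(i, j, k)\<in>simplex c. sV (of_nat (Suc k) * ibinom (X j) i) (g i j (Suc k)))"
  proof -
    have X: "X (Suc j) + 1 = X j" "X j - int j - int (Suc i) + 1 = X j - int j - int i" for i j by (simp_all add: X_def)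
    show ?thesis
      unfolding L1_g sum.distrib[symmetric] X
      by (intro sum.cong) (simp_all only: split_beta V.scale_right_distrib V.scale_scale mult.commute)
  qed
  also have "\<dots> = (\<Sum>(i, j, k)\<in>simplex (Suc c). sV (of_nat (Suc c) * ibinom (X j) i) (g i j k))"
  proof -
    have "(case x of (i, j, k) \<Rightarrow> sV (of_nat j * ibinom (X j + 1) i) (g i j k)) +
      (case x of (i, j, k) \<Rightarrow> sV (if i = 0 then 0 else of_int (X j - int j - int i + 1) * ibinom (X j) (i - 1)) (g i j k)) +
      (case x of (i, j, k) \<Rightarrow> sV (of_nat k * ibinom (X j) i) (g i j k)) =
      (case x of (i, j, k) \<Rightarrow> sV (of_nat (Suc c) * ibinom (X j) i) (g i j k))" if "x \<in> simplex (Suc c)" for x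
    proof -
      obtain i j k where x: "x = (i, j, k)" by (rule prod_cases3)
      with that have c: "c + 1 = i + j + k" by (simp add: simplex_def)
      show ?thesis unfolding x split V.scale_left_distrib[symmetric] conjugation_coefficient[OF c] by (simp only: Suc_eq_plus1)
    qed
    then show ?thesis unfolding S1 S2 S3 sum.distrib[symmetric] by (rule sum.cong[OF refl])
  qed
  also have "\<dots> = sV (of_nat (Suc c)) (\<Sum>(i, j, k)\<in>simplex (Suc c). sV (ibinom (X j) i) (g i j k))"
    unfolding V.scale_sum_right by (intro sum.cong) (simp_all only: split_beta V.scale_scale)
  finally have "sV (1 / fact (Suc c)) ((L 1 ^^ Suc c) (opV V u l v)) =
      (\<Sum>(i, j, k)\<in>simplex (Suc c). sV (ibinom (X j) i) (g i j k))"
    by (simp only: V.scale_cancel_left) (simp del: of_nat_Suc)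
  then show ?case unfolding g X_def .
qed

text \<open>
  The coefficients with which the iterate \<open>Y(Y(u,x\<^sub>0)v,x\<^sub>2)\<close> is transformed under \<open>x \<mapsto> x\<^bsup>-1\<^esup>\<close>.
\<close>

lemma exp_L1_iterate:
  assumes u: "u \<in> wt a"
  shows "(\<Sum>i\<le>c. sV ((-1) ^ i * ibinom m i / fact (c - i)) ((L 1 ^^ (c - i)) (opV V u (l + int i) v))) =
    (\<Sum>(i, j, k)\<in>simplex c. sV (ibinom (2 * a - int j - l - m - 2) i / (fact j * fact k))
      (opV V ((L 1 ^^ j) u) (l + int i) ((L 1 ^^ k) v)))"
proof -
  define X where "X j = 2 * a - int j - l - 2" for j
  define g where "g i j k = sV (1 / (fact j * fact k)) (opV V ((L 1 ^^ j) u) (l + int i) ((L 1 ^^ k) v))" for i j k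
  have g: "sV (r / (fact j * fact k)) (opV V ((L 1 ^^ j) u) (l + int i) ((L 1 ^^ k) v)) = sV r (g i j k)" for r i j k
    by (simp add: g_def)
  have "(\<Sum>i\<le>c. sV ((-1) ^ i * ibinom m i / fact (c - i)) ((L 1 ^^ (c - i)) (opV V u (l + int i) v))) =
    (\<Sum>i\<le>c. \<Sum>(i', j, k)\<in>simplex (c - i). sV ((-1) ^ i * ibinom m i * ibinom (X j - int i) i') (g (i + i') j k))"
  proof (rule sum.cong[OF refl])
    fix i
    have "sV ((-1) ^ i * ibinom m i / fact (c - i)) ((L 1 ^^ (c - i)) (opV V u (l + int i) v)) =
      sV ((-1) ^ i * ibinom m i) (sV (1 / fact (c - i)) ((L 1 ^^ (c - i)) (opV V u (l + int i) v)))"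
      by simp
    also have "\<dots> = (\<Sum>(i', j, k)\<in>simplex (c - i). sV ((-1) ^ i * ibinom m i * ibinom (X j - int i) i') (g (i + i') j k))"
    proof -
      have e: "2 * a - int j - (l + int i) - 2 = X j - int i" "l + int i + int i' = l + int (i + i')" for i' j
        by (simp_all add: X_def)
      show ?thesis unfolding exp_L1_conjugation[OF u] e g V.scale_sum_right
        by (intro sum.cong) (simp_all only: split_beta V.scale_scale)
    qed
    finally show "sV ((-1) ^ i * ibinom m i / fact (c - i)) ((L 1 ^^ (c - i)) (opV V u (l + int i) v)) = \<dots>" .
  qed
  also have "\<dots> = (\<Sum>(i, i', j, k)\<in>(SIGMA i:{..c}. simplex (c - i)).
      sV ((-1) ^ i * ibinom m i * ibinom (X j - int i) i') (g (i + i') j k))"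
    by (subst sum.Sigma) (auto simp: finite_simplex split_beta)
  \<comment> \<open>For fixed \<open>I = i + i'\<close> the vectors no longer depend on
    \<open>i\<close>, and the scalars form the sum in \<open>ibinom_alternating\<close>.\<close>
  also have "\<dots> = (\<Sum>((I, j, k), i)\<in>(SIGMA x:simplex c. {..fst x}).
      sV ((-1) ^ i * ibinom m i * ibinom (X j - int i) (I - i)) (g I j k))"
    by (rule sum.reindex_bij_witness[of _ "\<lambda>((I, j, k), i). (i, I - i, j, k)" "\<lambda>(i, i', j, k). ((i + i', j, k), i)"])
      (auto simp: simplex_def)
  also have "\<dots> = (\<Sum>(I, j, k)\<in>simplex c. \<Sum>i\<le>I. sV ((-1) ^ i * ibinom m i * ibinom (X j - int i) (I - i)) (g I j k))"
    by (subst sum.Sigma[symmetric]) (auto simp: finite_simplex split_beta)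
  also have "\<dots> = (\<Sum>(I, j, k)\<in>simplex c. sV (ibinom (X j - m) I) (g I j k))"
    unfolding V.scale_sum_left[symmetric] ibinom_alternating ..
  also have "\<dots> = (\<Sum>(i, j, k)\<in>simplex c. sV (ibinom (2 * a - int j - l - m - 2) i / (fact j * fact k))
      (opV V ((L 1 ^^ j) u) (l + int i) ((L 1 ^^ k) v)))"
  proof -
    have e: "2 * a - int j - l - m - 2 = X j - m" for j by (simp add: X_def)
    show ?thesis unfolding e g ..
  qed
  finally show ?thesis .
qed


section \<open>Weight decompositions and opposite vectors\<close>

definition weight_decomposition :: "'v \<Rightarrow> (int \<Rightarrow> 'v) \<Rightarrow> bool" where
  "weight_decomposition v c \<longleftrightarrow> (\<forall>h. c h \<in> wt h) \<and> finite {h. c h \<noteq> 0} \<and> v = Sum_any c"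

lemma weight_decomposition_single:
  assumes "v \<in> wt a"
  shows "weight_decomposition v (\<lambda>h. if h = a then v else 0)"
proof -
  have "(if h = a then v else 0) \<in> wt h" for h
    using assms V.subspace_0[OF subspace_wt] by simp
  then show ?thesis by (simp add: weight_decomposition_def)
qed

lemma weight_decomposition_add:
  assumes "weight_decomposition u c" "weight_decomposition v d"
  shows "weight_decomposition (u + v) (\<lambda>h. c h + d h)"
proof -
  have "finite {h. c h + d h \<noteq> 0}"
    by (rule finite_subset[of _ "{h. c h \<noteq> 0} \<union> {h. d h \<noteq> 0}"])
      (use assms in \<open>auto simp: weight_decomposition_def\<close>)
  moreover have "c h + d h \<in> wt h" for h
    using assms V.subspace_add[OF subspace_wt] by (simp add: weight_decomposition_def)
  ultimately show ?thesis
    using assms by (simp add: weight_decomposition_def Sum_any.distrib)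
qed

lemma weight_decomposition_scale:
  assumes "weight_decomposition v c"
  shows "weight_decomposition (sV r v) (\<lambda>h. sV r (c h))"
proof -
  have fin: "finite {h. c h \<noteq> 0}" using assms by (simp add: weight_decomposition_def)
  have "Sum_any (\<lambda>h. sV r (c h)) = (\<Sum>h\<in>{h. c h \<noteq> 0}. sV r (c h))"
    by (rule Sum_any.expand_superset[OF fin]) auto
  also have "\<dots> = sV r (Sum_any c)"
    by (simp add: V.scale_sum_right Sum_any.expand_set)
  finally have "Sum_any (\<lambda>h. sV r (c h)) = sV r v"
    using assms by (simp add: weight_decomposition_def)
  moreover have "finite {h. sV r (c h) \<noteq> 0}"
    by (rule finite_subset[OF _ fin]) auto
  ultimately show ?thesis
    using assms V.subspace_scale[OF subspace_wt] by (simp add: weight_decomposition_def)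
qed

lemma weight_decomposition_exists: "\<exists>c. weight_decomposition v c"
proof -
  have "v \<in> V.span (\<Union>n. wt n)" by (simp add: span_wt)
  then show ?thesis
  proof (induction rule: V.span_induct)
    case base
    have "weight_decomposition 0 (\<lambda>h. if h = 0 then 0 else 0)"
      by (rule weight_decomposition_single) (rule V.subspace_0[OF subspace_wt])
    then show ?case
      unfolding V.subspace_def using weight_decomposition_add weight_decomposition_scale by blast
  next
    case (step x)
    then show ?case using weight_decomposition_single by blast
  qed
qed

lemma weight_decomposition_unique:
  assumes "weight_decomposition v c" "weight_decomposition v d"
  shows "c = d"
proof
  fix h
  define F where "F = insert h ({h. c h \<noteq> 0} \<union> {h. d h \<noteq> 0})"
  have F: "finite F" using assms by (simp add: F_def weight_decomposition_def)
  have "Sum_any c = sum c F" "Sum_any d = sum d F"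
    by (intro conjI Sum_any.expand_superset[OF F]; auto simp: F_def)+
  then have "(\<Sum>h\<in>F. c h - d h) = 0"
    using assms by (simp add: sum_subtractf weight_decomposition_def)
  moreover have "L 0 (c h - d h) = sV (of_int h) (c h - d h)" for h
    using V.subspace_diff[OF subspace_wt] assms by (simp flip: mem_wt add: weight_decomposition_def)
  ultimately have "c h - d h = 0"
    using F by (intro eigen_independent[of sV "L 0" F "\<lambda>h. c h - d h" h])
      (auto simp: L_add L_scale V.vector_space_axioms F_def)
  then show "c h = d h" by simp
qed

lemma weight_component_eq:
  assumes "weight_decomposition v c"
  shows "weight_component V v = c"
  unfolding weight_component_def
  by (rule the_equality) (use assms weight_decomposition_unique in \<open>auto simp: weight_decomposition_def\<close>)

lemma weight_decomposition_component: "weight_decomposition v (weight_component V v)"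
  using weight_decomposition_exists weight_component_eq by metis

lemma weight_component_homogeneous:
  "v \<in> wt a \<Longrightarrow> weight_component V v = (\<lambda>h. if h = a then v else 0)"
  and weight_component_add: "weight_component V (u + v) = (\<lambda>h. weight_component V u h + weight_component V v h)"
  and weight_component_scale: "weight_component V (sV r v) = (\<lambda>h. sV r (weight_component V v h))"
  by (intro weight_component_eq weight_decomposition_single weight_decomposition_add
      weight_decomposition_scale weight_decomposition_component; assumption)+

lemma opposite_vector_add:
  "opposite_vector V (u + v) r = opposite_vector V u r + opposite_vector V v r"
  and opposite_vector_scale:
  "opposite_vector V (sV c v) r = sV c (opposite_vector V v r)"
proof -
  define f where "f v h = (if r + 2 * h \<ge> 0
     then sV ((-1) powi h / fact (nat (r + 2 * h))) ((L 1 ^^ nat (r + 2 * h)) (weight_component V v h)) else 0)" for v h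
  have f: "opposite_vector V v r = Sum_any (f v)" for v
    by (simp add: opposite_vector_def f_def)
  have fin: "finite {h. f v h \<noteq> 0}" for v
    by (rule finite_subset[of _ "{h. weight_component V v h \<noteq> 0}"])
      (use weight_decomposition_component in \<open>auto simp: f_def L1_pow_linear weight_decomposition_def split: if_splits\<close>)
  have "f (u + v) = (\<lambda>h. f u h + f v h)"
    by (auto simp: f_def weight_component_add L1_pow_linear V.scale_right_distrib)
  then show "opposite_vector V (u + v) r = opposite_vector V u r + opposite_vector V v r"
    unfolding f using Sum_any.distrib[OF fin fin] by simp
  have "f (sV c v) h = sV c (f v h)" for h
    using V.scale_left_commute by (simp add: f_def weight_component_scale L1_pow_linear)
  then have "Sum_any (f (sV c v)) = (\<Sum>h\<in>{h. f v h \<noteq> 0}. sV c (f v h))"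
    by (intro Sum_any.expand_superset[OF fin, THEN trans]) auto
  then show "opposite_vector V (sV c v) r = sV c (opposite_vector V v r)"
    unfolding f by (simp add: V.scale_sum_right Sum_any.expand_set)
qed

lemma opposite_vector_homogeneous:
  assumes "v \<in> wt a"
  shows "opposite_vector V v r = (if r + 2 * a \<ge> 0
    then sV ((-1) powi a / fact (nat (r + 2 * a))) ((L 1 ^^ nat (r + 2 * a)) v) else 0)"
proof -
  have "opposite_vector V v r = Sum_any (\<lambda>h. if h = a then (if r + 2 * a \<ge> 0
    then sV ((-1) powi a / fact (nat (r + 2 * a))) ((L 1 ^^ nat (r + 2 * a)) v) else 0) else 0)"
    unfolding opposite_vector_def weight_component_homogeneous[OF assms]
    by (intro arg_cong[where f = Sum_any]) (auto simp: L1_pow_linear)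
  then show ?thesis by simp
qed

end

subsection \<open>Compatibility as vanishing at infinity\<close>

text \<open>The coefficient of y^i in (c + y)^n: the function x^n seen at x = c with local
  coordinate y = x - c.\<close>

definition taylor :: "complex \<Rightarrow> int \<Rightarrow> nat \<Rightarrow> complex" where
  "taylor c n i = ibinom n i * c powi (n - int i)"

lemma taylor_add_one:
  assumes "c \<noteq> 0"
  shows "taylor c (n + 1) 0 = c * taylor c n 0"
    and "taylor c (n + 1) (Suc i) = taylor c n i + c * taylor c n (Suc i)"
proof -
  show "taylor c (n + 1) 0 = c * taylor c n 0"
    using assms by (simp add: taylor_def power_int_add)
  have e: "n + 1 - int (Suc i) = n - int i" by simp
  have "c * c powi (n - int (Suc i)) = c powi (n - int i)"
    using assms power_int_add[of c 1 "n - int (Suc i)"] by (simp add: algebra_simps)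
  then have "c * taylor c n (Suc i) = ibinom n (Suc i) * c powi (n - int i)"
    by (simp only: taylor_def mult.left_commute[of c])
  then show "taylor c (n + 1) (Suc i) = taylor c n i + c * taylor c n (Suc i)"
    by (simp only: taylor_def e ibinom_Suc distrib_right)
qed

lemma sum_taylor_add_one:
  assumes "c \<noteq> 0"
  shows "(\<Sum>i<Suc K. taylor c (n + 1) i * a i) =
    (\<Sum>i<K. taylor c n i * a (Suc i)) + c * (\<Sum>i<Suc K. taylor c n i * a i)"
  unfolding sum.lessThan_Suc_shift
  by (simp add: taylor_add_one[OF assms] distrib_right distrib_left sum.distrib sum_distrib_left mult.assoc)

lemma taylor_0: "taylor c 0 i = (if i = 0 then 1 else 0)"
  by (simp add: taylor_def gbinomial_0_left)

lemma taylor_uminus: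
  "z \<noteq> 0 \<Longrightarrow> taylor (- z) n i = (-1) powi n * (-1) ^ i * ibinom n i * z powi (n - int i)"
proof -
  assume "z \<noteq> 0"
  have "(- z) powi (n - int i) = (-1) powi (n - int i) * z powi (n - int i)"
    using power_int_mult_distrib[of "-1" z "n - int i"] by simp
  moreover have "(-1) powi (n - int i) = (-1) powi n * (-1 :: complex) ^ i"
    using power_int_add[of "-1 :: complex" n "- int i"] by (simp add: power_int_minus_one_minus)
  ultimately show ?thesis by (simp add: taylor_def)
qed

text \<open>
  The action of \<open>v \<otimes> x\<^sup>m(x - z)\<^sup>l\<close> on functionals on \<open>W\<^sub>1 \<otimes> W\<^sub>2\<close>: the rational function is expanded
  at \<open>x = 0\<close>, where \<open>W\<^sub>2\<close> sits, and at \<open>x = z\<close>, where \<open>W\<^sub>1\<close> sits.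
\<close>

definition rational_action ::
  "('v \<Rightarrow> int \<Rightarrow> 'a \<Rightarrow> 'a) \<Rightarrow> ('v \<Rightarrow> int \<Rightarrow> 'b \<Rightarrow> 'b) \<Rightarrow> complex \<Rightarrow> 'v \<Rightarrow> int \<Rightarrow> int \<Rightarrow>
   ('a \<Rightarrow> 'b \<Rightarrow> complex) \<Rightarrow> 'a \<Rightarrow> 'b \<Rightarrow> complex" where
  "rational_action Y1 Y2 z v l m \<Lambda> w1 w2 =
     Sum_any (\<lambda>i::nat. taylor (- z) l i * \<Lambda> w1 (Y2 v (m + int i) w2)) +
     Sum_any (\<lambda>i::nat. taylor z m i * \<Lambda> (Y1 v (l + int i) w1) w2)"

text \<open>Allows an equation that does not mention the cutoff to be proved for partial sums with a
  large common cutoff, without naming the individual supports.\<close>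

lemma eventually_sequentially_const: "\<forall>\<^sub>F K in sequentially. P \<Longrightarrow> P"
  by simp

section \<open>The action of x^m (x - z)^l on bilinear forms\<close>

locale P_z =
  voa V + M1: vertex_map V s1 UNIV Y1 + M2: vertex_map V s2 UNIV Y2
  for V :: "'v::ab_group_add vertex_data"
    and s1 :: "complex \<Rightarrow> 'a::ab_group_add \<Rightarrow> 'a" and Y1
    and s2 :: "complex \<Rightarrow> 'b::ab_group_add \<Rightarrow> 'b" and Y2 +
  fixes z :: complex
  assumes z: "z \<noteq> 0"
begin

sublocale F: vector_space "scale_form :: complex \<Rightarrow> ('a \<Rightarrow> 'b \<Rightarrow> complex) \<Rightarrow> 'a \<Rightarrow> 'b \<Rightarrow> complex"
  by (rule vector_space_scale_form)

abbreviation T where "T \<equiv> tensor_dual s1 s2"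
abbreviation Y' where "Y' \<equiv> Y_prime V Y1 Y2 z"
abbreviation act where "act \<equiv> rational_action Y1 Y2 z"
abbreviation tau_coeff where "tau_coeff v n m \<equiv> tau V Y1 Y2 z v (delta_coeff z n m)"

lemma mem_T_iff: "\<Lambda> \<in> T \<longleftrightarrow>
    (\<forall>x x' y. \<Lambda> (x + x') y = \<Lambda> x y + \<Lambda> x' y) \<and> (\<forall>c x y. \<Lambda> (s1 c x) y = c * \<Lambda> x y) \<and>
    (\<forall>x y y'. \<Lambda> x (y + y') = \<Lambda> x y + \<Lambda> x y') \<and> (\<forall>c x y. \<Lambda> x (s2 c y) = c * \<Lambda> x y)"
proof -
  have "vector_space ((*) :: complex \<Rightarrow> complex \<Rightarrow> complex)" by unfold_locales (simp_all add: algebra_simps)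
  then show ?thesis
    unfolding tensor_dual_def Vector_Spaces.linear_iff
    using M1.vector_space_axioms M2.vector_space_axioms by auto
qed

lemma T_add1: "\<Lambda> \<in> T \<Longrightarrow> \<Lambda> (x + x') y = \<Lambda> x y + \<Lambda> x' y"
  and T_scale1: "\<Lambda> \<in> T \<Longrightarrow> \<Lambda> (s1 c x) y = c * \<Lambda> x y"
  and T_add2: "\<Lambda> \<in> T \<Longrightarrow> \<Lambda> x (y + y') = \<Lambda> x y + \<Lambda> x y'"
  and T_scale2: "\<Lambda> \<in> T \<Longrightarrow> \<Lambda> x (s2 c y) = c * \<Lambda> x y"
  by (simp_all add: mem_T_iff)

lemma T_zero1: "\<Lambda> \<in> T \<Longrightarrow> \<Lambda> 0 y = 0" and T_zero2: "\<Lambda> \<in> T \<Longrightarrow> \<Lambda> x 0 = 0"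
  using T_add1[of \<Lambda> 0 0 y] T_add2[of \<Lambda> x 0 0] by simp_all

lemma T_sum1: "\<Lambda> \<in> T \<Longrightarrow> \<Lambda> (\<Sum>i\<in>A. f i) y = (\<Sum>i\<in>A. \<Lambda> (f i) y)"
  and T_sum2: "\<Lambda> \<in> T \<Longrightarrow> \<Lambda> x (\<Sum>i\<in>A. g i) = (\<Sum>i\<in>A. \<Lambda> x (g i))"
  by (induction A rule: infinite_finite_induct) (simp_all add: T_add1 T_add2 T_zero1 T_zero2)

lemma subspace_T: "F.subspace T"
  by (auto simp: F.subspace_def mem_T_iff scale_form_def algebra_simps)

lemma act_eventually:
  assumes "\<Lambda> \<in> T"
  shows "\<forall>\<^sub>F K in sequentially. act v l m \<Lambda> w1 w2 =
    (\<Sum>i<K. taylor (- z) l i * \<Lambda> w1 (Y2 v (m + int i) w2)) + (\<Sum>i<K. taylor z m i * \<Lambda> (Y1 v (l + int i) w1) w2)"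
  using M1.Y_eventually_zero[OF UNIV_I, of v l w1] M2.Y_eventually_zero[OF UNIV_I, of v m w2]
proof eventually_elim
  case (elim K)
  then show ?case
    unfolding rational_action_def using assms by (intro arg_cong2[where f = "(+)"] Sum_any_lessThan)
      (simp_all add: T_zero1 T_zero2)
qed

lemma act_add_left: "\<Lambda> \<in> T \<Longrightarrow> act (u + v) l m \<Lambda> = act u l m \<Lambda> + act v l m \<Lambda>"
proof (intro ext)
  fix w1 w2 assume L: "\<Lambda> \<in> T"
  show "act (u + v) l m \<Lambda> w1 w2 = (act u l m \<Lambda> + act v l m \<Lambda>) w1 w2"
  proof (rule eventually_sequentially_const)
    show "\<forall>\<^sub>F K in sequentially. act (u + v) l m \<Lambda> w1 w2 = (act u l m \<Lambda> + act v l m \<Lambda>) w1 w2"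
      using act_eventually[OF L, of u l m w1 w2] act_eventually[OF L, of v l m w1 w2] act_eventually[OF L, of "u + v" l m w1 w2]
      by eventually_elim (simp add: M1.Y_add_left M2.Y_add_left T_add1 T_add2 L distrib_left sum.distrib)
  qed
qed

lemma act_scale_left: "\<Lambda> \<in> T \<Longrightarrow> act (sV c v) l m \<Lambda> = scale_form c (act v l m \<Lambda>)"
proof (intro ext)
  fix w1 w2 assume L: "\<Lambda> \<in> T"
  show "act (sV c v) l m \<Lambda> w1 w2 = scale_form c (act v l m \<Lambda>) w1 w2"
  proof (rule eventually_sequentially_const)
    show "\<forall>\<^sub>F K in sequentially. act (sV c v) l m \<Lambda> w1 w2 = scale_form c (act v l m \<Lambda>) w1 w2"
      using act_eventually[OF L, of v l m w1 w2] act_eventually[OF L, of "sV c v" l m w1 w2]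
      by eventually_elim (simp add: M1.Y_scale_left M2.Y_scale_left T_scale1 T_scale2 L scale_form_def distrib_left sum_distrib_left mult_ac)
  qed
qed

lemma act_zero_left: "\<Lambda> \<in> T \<Longrightarrow> act 0 l m \<Lambda> = 0"
  using act_add_left[of \<Lambda> 0 0 l m] by simp

lemma act_add: "\<Lambda> \<in> T \<Longrightarrow> M \<in> T \<Longrightarrow> act v l m (\<Lambda> + M) = act v l m \<Lambda> + act v l m M"
proof (intro ext)
  fix w1 w2 assume L: "\<Lambda> \<in> T" "M \<in> T"
  then have "\<Lambda> + M \<in> T" by (rule F.subspace_add[OF subspace_T])
  show "act v l m (\<Lambda> + M) w1 w2 = (act v l m \<Lambda> + act v l m M) w1 w2"
  proof (rule eventually_sequentially_const)
    show "\<forall>\<^sub>F K in sequentially. act v l m (\<Lambda> + M) w1 w2 = (act v l m \<Lambda> + act v l m M) w1 w2"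
      using act_eventually[OF L(1), of v l m w1 w2] act_eventually[OF L(2), of v l m w1 w2]
      act_eventually[OF \<open>\<Lambda> + M \<in> T\<close>, of v l m w1 w2]
      by eventually_elim (simp add: distrib_left sum.distrib)
  qed
qed

lemma act_scale: "\<Lambda> \<in> T \<Longrightarrow> act v l m (scale_form c \<Lambda>) = scale_form c (act v l m \<Lambda>)"
proof (intro ext)
  fix w1 w2 assume L: "\<Lambda> \<in> T"
  then have L': "scale_form c \<Lambda> \<in> T" by (rule F.subspace_scale[OF subspace_T])
  show "act v l m (scale_form c \<Lambda>) w1 w2 = scale_form c (act v l m \<Lambda>) w1 w2"
  proof (rule eventually_sequentially_const)
    show "\<forall>\<^sub>F K in sequentially. act v l m (scale_form c \<Lambda>) w1 w2 = scale_form c (act v l m \<Lambda>) w1 w2"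
      using act_eventually[OF L, of v l m w1 w2] act_eventually[OF L', of v l m w1 w2]
      by eventually_elim (simp add: scale_form_def distrib_left sum_distrib_left mult_ac)
  qed
qed

lemma act_mem_T:
  assumes "\<Lambda> \<in> T"
  shows "act v l m \<Lambda> \<in> T"
  unfolding mem_T_iff
proof (intro conjI allI)
  note ev = act_eventually[OF assms, of v l m]
  fix x x' y y' c
  show "act v l m \<Lambda> (x + x') y = act v l m \<Lambda> x y + act v l m \<Lambda> x' y"
  proof (rule eventually_sequentially_const)
    show "\<forall>\<^sub>F K in sequentially. act v l m \<Lambda> (x + x') y = act v l m \<Lambda> x y + act v l m \<Lambda> x' y"
      using ev[of "x + x'" y] ev[of x y] ev[of x' y]
      by eventually_elim (simp add: M1.Y_add T_add1 assms distrib_left sum.distrib)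
  qed
  show "act v l m \<Lambda> (s1 c x) y = c * act v l m \<Lambda> x y"
  proof (rule eventually_sequentially_const)
    show "\<forall>\<^sub>F K in sequentially. act v l m \<Lambda> (s1 c x) y = c * act v l m \<Lambda> x y"
      using ev[of "s1 c x" y] ev[of x y]
      by eventually_elim (simp add: M1.Y_scale T_scale1 assms distrib_left sum_distrib_left mult_ac)
  qed
  show "act v l m \<Lambda> x (y + y') = act v l m \<Lambda> x y + act v l m \<Lambda> x y'"
  proof (rule eventually_sequentially_const)
    show "\<forall>\<^sub>F K in sequentially. act v l m \<Lambda> x (y + y') = act v l m \<Lambda> x y + act v l m \<Lambda> x y'"
      using ev[of x "y + y'"] ev[of x y] ev[of x y']
      by eventually_elim (simp add: M2.Y_add T_add2 assms distrib_left sum.distrib)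
  qed
  show "act v l m \<Lambda> x (s2 c y) = c * act v l m \<Lambda> x y"
  proof (rule eventually_sequentially_const)
    show "\<forall>\<^sub>F K in sequentially. act v l m \<Lambda> x (s2 c y) = c * act v l m \<Lambda> x y"
      using ev[of x "s2 c y"] ev[of x y]
      by eventually_elim (simp add: M2.Y_scale T_scale2 assms distrib_left sum_distrib_left mult_ac)
  qed
qed

text \<open>Multiplication by x - z. At z it raises the mode and x acts through the Taylor
  coefficients; at 0 the two roles are exchanged.\<close>

lemma act_recursion:
  assumes L: "\<Lambda> \<in> T"
  shows "act v (l + 1) m \<Lambda> w1 w2 = act v l (m + 1) \<Lambda> w1 w2 - z * act v l m \<Lambda> w1 w2"
proof -
  define a where "a i = \<Lambda> w1 (Y2 v (m + int i) w2)" for i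
  define b where "b i = \<Lambda> (Y1 v (l + int i) w1) w2" for i
  have shift: "m + 1 + int i = m + int (Suc i)" "l + 1 + int i = l + int (Suc i)" for i by simp_all
  note ev = act_eventually[OF L, of v, unfolded eventually_sequentially]
  obtain K1 where K1: "\<And>K. K \<ge> K1 \<Longrightarrow> act v (l + 1) m \<Lambda> w1 w2 =
    (\<Sum>i<K. taylor (- z) (l + 1) i * a i) + (\<Sum>i<K. taylor z m i * b (Suc i))"
    using ev[of "l + 1" m w1 w2] unfolding a_def b_def shift by blast
  obtain K2 where K2: "\<And>K. K \<ge> K2 \<Longrightarrow> act v l (m + 1) \<Lambda> w1 w2 =
    (\<Sum>i<K. taylor (- z) l i * a (Suc i)) + (\<Sum>i<K. taylor z (m + 1) i * b i)"
    using ev[of l "m + 1" w1 w2] unfolding a_def b_def shift by blast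
  obtain K3 where K3: "\<And>K. K \<ge> K3 \<Longrightarrow> act v l m \<Lambda> w1 w2 =
    (\<Sum>i<K. taylor (- z) l i * a i) + (\<Sum>i<K. taylor z m i * b i)"
    using ev[of l m w1 w2] unfolding a_def b_def by blast
  obtain A where A: "\<And>i. i \<ge> A \<Longrightarrow> a i = 0"
    using M2.Y_truncation_nat[of w2 v m] T_zero2[OF L] unfolding a_def by (metis UNIV_I)
  obtain B where B: "\<And>i. i \<ge> B \<Longrightarrow> b i = 0"
    using M1.Y_truncation_nat[of w1 v l] T_zero1[OF L] unfolding b_def by (metis UNIV_I)
  define K where "K = K1 + K2 + K3 + A + B"
  have K: "K1 \<le> K" "K2 \<le> K" "K3 \<le> K" "A \<le> K" "B \<le> K" by (simp_all add: K_def)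
  \<comment> \<open>\<open>sum_taylor_add_one\<close> relates sums of lengths \<open>Suc K\<close>
    and \<open>K\<close>; the extra shifted terms vanish beyond the cutoffs.\<close>
  have "a (Suc K) = 0" "b (Suc K) = 0" "a K = 0" "b K = 0"
    using A[of K] B[of K] A[of "Suc K"] B[of "Suc K"] K by linarith+
  then have S: "(\<Sum>i<Suc K. taylor (- z) l i * a (Suc i)) = (\<Sum>i<K. taylor (- z) l i * a (Suc i))"
    "(\<Sum>i<Suc K. taylor z m i * b (Suc i)) = (\<Sum>i<K. taylor z m i * b (Suc i))"
    by simp_all
  have "Suc K \<ge> K1" "Suc K \<ge> K2" "Suc K \<ge> K3" "- z \<noteq> 0" using K z by simp_all
  note K1[OF this(1)] K2[OF this(2)] K3[OF this(3)] sum_taylor_add_one[OF this(4), of l a K] sum_taylor_add_one[OF z, of m b K]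
  then show ?thesis unfolding S by algebra
qed

end

lemma sum_fun_apply2: "(\<Sum>i\<in>A. f i) x y = (\<Sum>i\<in>A. f i x y :: complex)"
  by (induction A rule: infinite_finite_induct) simp_all

lemma Sum_any_fun_apply2:
  fixes f :: "nat \<Rightarrow> 'a \<Rightarrow> 'b \<Rightarrow> complex"
  assumes "\<And>i. i \<ge> K \<Longrightarrow> f i = 0"
  shows "Sum_any f x y = (\<Sum>i<K. f i x y)"
  using assms by (subst Sum_any_lessThan[of K]) (simp_all add: sum_fun_apply2)

section \<open>The map \<open>tau\<close> in terms of rational functions\<close>

context P_z
begin

text \<open>Upper negation shows that the coefficients of the first delta function in
  \<open>tau_rhs\<close> are Taylor coefficients at z.\<close>

lemma first_coefficient:
  "z powi (- (m + 1 + int i + r) - 1) * ibinom (m + 1 + int i + r) i * (-1) ^ i = taylor z (- r - m - 2) i"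
proof -
  have "ibinom (- r - m - 2) i = (-1) ^ i * ibinom (m + 1 + int i + r) i"
  proof -
    have "- (r + m + 2) = - r - m - 2" "r + m + 2 + int i - 1 = m + 1 + int i + r" by simp_all
    then show ?thesis using ibinom_uminus[of "r + m + 2" i] by (simp only:)
  qed
  moreover have "- (m + 1 + int i + r) - 1 = - r - m - 2 - int i" by simp
  ultimately show ?thesis unfolding taylor_def by (simp only: mult_ac)
qed

text \<open>With x the inverse of x1, the component of degree \<open>r\<close> of the opposite
  vector is paired with x^(-r-m-2) (x - z)^n. Any finite \<open>R\<close> containing the support is
  allowed, so that several vectors can share one index set.\<close>

lemma tau_act:
  assumes L: "\<Lambda> \<in> T" and R: "finite R" "\<And>r. r \<notin> R \<Longrightarrow> opposite_vector V v r = 0"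
  shows "tau_coeff v n m \<Lambda> =
    (\<Sum>r\<in>R. act (opposite_vector V v r) n (- r - m - 2) \<Lambda>)"
proof (intro ext)
  fix w1 w2
  define p where "p = opposite_vector V v"
  note R' = R(2)[folded p_def]
  define b where "b r i = taylor (- z) n i * \<Lambda> w1 (Y2 (p r) (- r - m - 2 + int i) w2)" for r i
  have b0: "b r i = 0" if "p r = 0" for r i
    using that by (simp add: b_def M2.Y_zero_left T_zero2[OF L])
  have "\<forall>\<^sub>F K in sequentially. \<forall>r\<in>R. \<forall>i\<ge>K. Y2 (p r) (- r - m - 2 + int i) w2 = 0"
    by (intro eventually_ball_finite R(1) ballI M2.Y_eventually_zero) simp
  then obtain K where "\<And>r i. r \<in> R \<Longrightarrow> i \<ge> K \<Longrightarrow> Y2 (p r) (- r - m - 2 + int i) w2 = 0"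
    unfolding eventually_sequentially by blast
  then have K: "\<And>r i. r \<in> R \<Longrightarrow> i \<ge> K \<Longrightarrow> b r i = 0"
    by (simp add: b_def T_zero2[OF L])
  have "tau_coeff v n m \<Lambda> w1 w2 = tau_rhs V Y1 Y2 z v n m \<Lambda> w1 w2"
    by (rule tau_delta_coeff[OF VOA z M1.VM M2.VM L])
  also have "\<dots> = Sum_any (\<lambda>r. Sum_any (\<lambda>i. taylor z (- r - m - 2) i * \<Lambda> (Y1 (p r) (n + int i) w1) w2)) +
      Sum_any (\<lambda>i. taylor (- z) n i * \<Lambda> w1 (opposite_op V Y2 v (m - int i) w2))"
  proof -
    have "(-1) powi n * ibinom n i * z powi (n - int i) * (-1) ^ i = taylor (- z) n i" for i
      unfolding taylor_uminus[OF z] by (simp only: mult_ac)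
    then show ?thesis unfolding tau_rhs_def Let_def first_coefficient p_def by simp
  qed
  also have "Sum_any (\<lambda>r. Sum_any (\<lambda>i. taylor z (- r - m - 2) i * \<Lambda> (Y1 (p r) (n + int i) w1) w2)) =
      (\<Sum>r\<in>R. Sum_any (\<lambda>i. taylor z (- r - m - 2) i * \<Lambda> (Y1 (p r) (n + int i) w1) w2))"
  proof (rule Sum_any.expand_superset[OF R(1)])
    have "Sum_any (\<lambda>i. taylor z (- r - m - 2) i * \<Lambda> (Y1 (p r) (n + int i) w1) w2) = 0" if "r \<notin> R" for r
      by (simp add: R'[OF that] M1.Y_zero_left T_zero1[OF L])
    then show "{r. Sum_any (\<lambda>i. taylor z (- r - m - 2) i * \<Lambda> (Y1 (p r) (n + int i) w1) w2) \<noteq> 0} \<subseteq> R" by blast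
  qed
  also have "Sum_any (\<lambda>i. taylor (- z) n i * \<Lambda> w1 (opposite_op V Y2 v (m - int i) w2)) = Sum_any (\<lambda>i. \<Sum>r\<in>R. b r i)"
  proof -
    have "opposite_op V Y2 v (m - int i) w2 = (\<Sum>r\<in>R. Y2 (p r) (- r - (m - int i) - 2) w2)" for i
      unfolding opposite_op_def p_def[symmetric]
    proof (rule Sum_any.expand_superset[OF R(1)])
      have "Y2 (p r) (- r - (m - int i) - 2) w2 = 0" if "r \<notin> R" for r
        by (simp add: R'[OF that] M2.Y_zero_left)
      then show "{r. Y2 (p r) (- r - (m - int i) - 2) w2 \<noteq> 0} \<subseteq> R" by blast
    qed
    moreover have "- r - (m - int i) - 2 = - r - m - 2 + int i" for i r by simp
    ultimately show ?thesis by (simp only: T_sum2[OF L] sum_distrib_left b_def)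
  qed
  also have "\<dots> = (\<Sum>i<K. \<Sum>r\<in>R. b r i)"
    by (rule Sum_any_lessThan) (simp add: K)
  also have "\<dots> = (\<Sum>r\<in>R. \<Sum>i<K. b r i)"
    by (rule sum.swap)
  also have "\<dots> = (\<Sum>r\<in>R. Sum_any (b r))"
    using K by (intro sum.cong refl Sum_any_lessThan[symmetric])
  finally show "tau_coeff v n m \<Lambda> w1 w2 =
      (\<Sum>r\<in>R. act (opposite_vector V v r) n (- r - m - 2) \<Lambda>) w1 w2"
    by (simp add: sum_fun_apply2 rational_action_def sum.distrib b_def p_def add.commute)
qed

lemma opposite_vector_finite: "finite {r. opposite_vector V v r \<noteq> 0}"
  by (rule finite_opposite_vector[OF VOA])

lemma tau_act_support: "\<Lambda> \<in> T \<Longrightarrow> tau_coeff v n m \<Lambda> =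
    (\<Sum>r\<in>{r. opposite_vector V v r \<noteq> 0}. act (opposite_vector V v r) n (- r - m - 2) \<Lambda>)"
  by (rule tau_act[OF _ opposite_vector_finite]) auto

lemma tau_mem_T: "\<Lambda> \<in> T \<Longrightarrow> tau_coeff v n m \<Lambda> \<in> T"
  by (simp add: tau_act_support F.subspace_sum subspace_T act_mem_T)

lemma tau_add_left:
  assumes "\<Lambda> \<in> T"
  shows "tau_coeff (u + v) n m \<Lambda> =
    tau_coeff u n m \<Lambda> + tau_coeff v n m \<Lambda>"
proof -
  define R where "R = {r. opposite_vector V u r \<noteq> 0} \<union> {r. opposite_vector V v r \<noteq> 0}"
  have R: "finite R" by (simp add: R_def opposite_vector_finite)
  show ?thesis
    by (subst (1 2 3) tau_act[OF assms R])
      (auto simp: R_def opposite_vector_add act_add_left assms sum.distrib)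
qed

lemma tau_scale_left:
  assumes "\<Lambda> \<in> T"
  shows "tau_coeff (sV c v) n m \<Lambda> = scale_form c (tau_coeff v n m \<Lambda>)"
  by (subst (1 2) tau_act[OF assms opposite_vector_finite[of v]])
    (auto simp: opposite_vector_scale act_scale_left assms F.scale_sum_right)

lemma tau_add:
  assumes "\<Lambda> \<in> T" "M \<in> T"
  shows "tau_coeff v n m (\<Lambda> + M) =
    tau_coeff v n m \<Lambda> + tau_coeff v n m M"
  using assms F.subspace_add[OF subspace_T assms]
  by (simp add: tau_act_support act_add sum.distrib)

lemma tau_scale:
  assumes "\<Lambda> \<in> T"
  shows "tau_coeff v n m (scale_form c \<Lambda>) = scale_form c (tau_coeff v n m \<Lambda>)"
  using assms F.subspace_scale[OF subspace_T assms, of c]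
  by (simp add: tau_act_support act_scale F.scale_sum_right)

lemma Y'_eq_tau: "Y' v n = tau_coeff v 0 n"
  by (simp add: Y_prime_def delta_coeff_def)

lemma tau_homogeneous:
  assumes L: "\<Lambda> \<in> T" and v: "v \<in> wt a" and J: "\<And>j. j \<ge> J \<Longrightarrow> (L 1 ^^ j) v = 0"
  shows "tau_coeff v n m \<Lambda> =
    (\<Sum>j<J. scale_form ((-1) powi a / fact j) (act ((L 1 ^^ j) v) n (2 * a - int j - m - 2) \<Lambda>))"
proof -
  define R where "R = (\<lambda>j. int j - 2 * a) ` {..<J}"
  have opp: "opposite_vector V v (int j - 2 * a) = sV ((-1) powi a / fact j) ((L 1 ^^ j) v)" for j
    by (simp add: opposite_vector_homogeneous[OF v])
  have R: "opposite_vector V v r = 0" if "r \<notin> R" for r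
  proof (cases "r + 2 * a \<ge> 0")
    case True
    then have r: "r = int (nat (r + 2 * a)) - 2 * a" by simp
    have "\<not> nat (r + 2 * a) < J"
    proof
      assume "nat (r + 2 * a) < J"
      then have "r \<in> R" unfolding R_def using r by blast
      then show False using that by simp
    qed
    then have "nat (r + 2 * a) \<ge> J" by simp
    then show ?thesis using J by (simp add: opposite_vector_homogeneous[OF v])
  qed (simp add: opposite_vector_homogeneous[OF v])
  have e: "- (int j - 2 * a) - m - 2 = 2 * a - int j - m - 2" for j by simp
  have "tau_coeff v n m \<Lambda> = (\<Sum>r\<in>R. act (opposite_vector V v r) n (- r - m - 2) \<Lambda>)"
    using R by (intro tau_act L) (simp add: R_def)
  also have "\<dots> = (\<Sum>j<J. act (opposite_vector V v (int j - 2 * a)) n (- (int j - 2 * a) - m - 2) \<Lambda>)"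
    unfolding R_def by (subst sum.reindex) (auto simp: inj_on_def)
  finally show ?thesis unfolding opp e act_scale_left[OF L] .
qed

lemma tau_recursion:
  assumes "\<Lambda> \<in> T"
  shows "tau_coeff v (n + 1) m \<Lambda> w1 w2 =
    tau_coeff v n (m - 1) \<Lambda> w1 w2 - z * tau_coeff v n m \<Lambda> w1 w2"
  unfolding tau_delta_coeff[OF VOA z M1.VM M2.VM assms]
  by (rule tau_rhs_rec[OF VOA z M1.VM M2.VM assms])

text \<open>
  The compatibility condition says that \<open>v \<otimes> f\<close> annihilates \<open>\<Lambda>\<close> as soon as the
  rational function \<open>f\<close> vanishes to sufficiently high order at infinity.
\<close>

definition bounded_at_infinity :: "'v \<Rightarrow> ('a \<Rightarrow> 'b \<Rightarrow> complex) \<Rightarrow> bool" where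
  "bounded_at_infinity v \<Lambda> \<longleftrightarrow> (\<exists>N. \<forall>l m. l + m \<le> N \<longrightarrow> act v l m \<Lambda> = 0)"

text \<open>\<open>m - n\<close> is the order of \<open>delta_coeff z n m\<close> at t = 0, that is,
  at infinity in the coordinate x inverse to t.\<close>

definition tau_bounded :: "'v \<Rightarrow> ('a \<Rightarrow> 'b \<Rightarrow> complex) \<Rightarrow> bool" where
  "tau_bounded v \<Lambda> \<longleftrightarrow> (\<exists>N. \<forall>n m. m - n \<ge> N \<longrightarrow> tau_coeff v n m \<Lambda> = 0)"

lemma tau_expansion:
  assumes L: "\<Lambda> \<in> T" and N: "\<And>n m. m - n \<ge> N \<Longrightarrow> tau_coeff v n m \<Lambda> = 0"
    and K: "m - n + int K \<ge> N"
  shows "tau_coeff v n m \<Lambda> w1 w2 =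
    (\<Sum>i<K. (-1) ^ i * ibinom n i * z ^ i * Y' v (m - n + int i) \<Lambda> w1 w2)"
proof -
  \<comment> \<open>Reversing the sign of \<open>m\<close> passes from powers of t to powers of x
    and brings \<open>tau_recursion\<close> into the required form.\<close>
  define D where "D n m = tau_coeff v n (- m) \<Lambda> w1 w2" for n m
  have "D n (- m) = (\<Sum>i<K. (-1) ^ i * ibinom n i * z ^ i * D 0 (- m + n - int i))"
  proof (rule expansion_recursion_formula)
    show "D (l + 1) m = D l (m + 1) - z * D l m" for l m
      using tau_recursion[OF L, of v l "- m"] by (simp add: D_def)
    show "D l m = 0" if "l + m \<le> - N" for l m
      using N[of "- m" l] that by (simp add: D_def)
    show "n + - m - int K \<le> - N" using K by simp
  qed
  moreover have "- (- m + n - int i) = m - n + int i" for i by simp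
  ultimately show ?thesis by (simp only: D_def Y'_eq_tau minus_minus)
qed

text \<open>Once everything of high order annihilates \<Lambda>, the second condition is the
  expansion at infinity forced by the recursion. Conversely, the right side of that condition
  vanishes termwise for large \<open>m - n\<close>.\<close>

lemma P_compatible_iff_tau_bounded:
  assumes L: "\<Lambda> \<in> T"
  shows "P_compatible V Y1 Y2 z \<Lambda> \<longleftrightarrow> (\<forall>v. tau_bounded v \<Lambda>)"
proof
  assume P: "P_compatible V Y1 Y2 z \<Lambda>"
  show "\<forall>v. tau_bounded v \<Lambda>"
  proof
    fix v
    obtain N where N: "\<And>n. n \<ge> N \<Longrightarrow> Y' v n \<Lambda> = 0"
      using P unfolding P_compatible_def by blast
    have "tau_coeff v n m \<Lambda> = 0" if "m - n \<ge> N" for n m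
    proof -
      have "tau_coeff v n m \<Lambda> =
        Sum_any (\<lambda>i::nat. scale_form (ibinom n i * (- z) ^ i) (Y' v (m - n + int i) \<Lambda>))"
        using P unfolding P_compatible_def by blast
      also have "\<dots> = 0"
        using N that by (subst Sum_any_lessThan[of 0]) simp_all
      finally show ?thesis .
    qed
    then show "tau_bounded v \<Lambda>" unfolding tau_bounded_def by blast
  qed
next
  assume B: "\<forall>v. tau_bounded v \<Lambda>"
  show "P_compatible V Y1 Y2 z \<Lambda>"
    unfolding P_compatible_def
  proof (intro conjI allI)
    fix v
    obtain N where N: "\<And>n m. m - n \<ge> N \<Longrightarrow> tau_coeff v n m \<Lambda> = 0"
      using B unfolding tau_bounded_def by blast
    have "Y' v n \<Lambda> = 0" if "n \<ge> N" for n
      unfolding Y'_eq_tau using N[of n 0] that by simp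
    then show "\<exists>N. \<forall>n\<ge>N. Y' v n \<Lambda> = 0" by blast
  next
    fix v n m
    obtain N where N: "\<And>n m. m - n \<ge> N \<Longrightarrow> tau_coeff v n m \<Lambda> = 0"
      using B unfolding tau_bounded_def by blast
    define K where "K = nat (N - (m - n))"
    have K: "m - n + int K \<ge> N" by (simp add: K_def)
    have 0: "scale_form (ibinom n i * (- z) ^ i) (Y' v (m - n + int i) \<Lambda>) = 0" if "i \<ge> K" for i
      unfolding Y'_eq_tau using N[of "m - n + int i" 0] that K by simp
    have S: "Sum_any (\<lambda>i::nat. scale_form (ibinom n i * (- z) ^ i) (Y' v (m - n + int i) \<Lambda>)) =
        (\<Sum>i<K. scale_form (ibinom n i * (- z) ^ i) (Y' v (m - n + int i) \<Lambda>))"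
      by (rule Sum_any_lessThan) (rule 0)
    show "tau_coeff v n m \<Lambda> =
        Sum_any (\<lambda>i::nat. scale_form (ibinom n i * (- z) ^ i) (Y' v (m - n + int i) \<Lambda>))"
      unfolding S
    proof (intro ext)
      fix w1 w2
      show "tau_coeff v n m \<Lambda> w1 w2 =
        (\<Sum>i<K. scale_form (ibinom n i * (- z) ^ i) (Y' v (m - n + int i) \<Lambda>)) w1 w2"
        unfolding sum_fun_apply2
        by (subst tau_expansion[OF L _ K]) (fact N, intro sum.cong, simp_all add: scale_form_def power_minus[of z])
    qed
  qed
qed

lemma tau_bounded_homogeneous:
  assumes L: "\<Lambda> \<in> T" and v: "v \<in> wt a" and B: "\<And>j. bounded_at_infinity ((L 1 ^^ j) v) \<Lambda>"
  shows "tau_bounded v \<Lambda>"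
proof -
  obtain J where J: "\<And>j. j \<ge> J \<Longrightarrow> (L 1 ^^ j) v = 0" using L1_nilpotent[OF v] by blast
  obtain M where M: "\<And>j l m. l + m \<le> M j \<Longrightarrow> act ((L 1 ^^ j) v) l m \<Lambda> = 0"
    using B unfolding bounded_at_infinity_def by metis
  define M0 where "M0 = Min (insert 0 (M ` {..<J}))"
  have M0: "M0 \<le> M j" if "j < J" for j using that by (auto simp: M0_def)
  \<comment> \<open>The exponents in \<open>tau_homogeneous\<close> add up to n + 2a - j - m - 2;
    the part - j - 2 only helps.\<close>
  have "tau_coeff v n m \<Lambda> = 0" if "m - n \<ge> 2 * a - M0" for n m
  proof -
    have "act ((L 1 ^^ j) v) n (2 * a - int j - m - 2) \<Lambda> = 0" if "j < J" for j
      using M0[OF that] \<open>m - n \<ge> _\<close> by (intro M) simp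
    then show ?thesis by (simp add: tau_homogeneous[OF L v J])
  qed
  then show ?thesis unfolding tau_bounded_def by blast
qed

text \<open>
  In \<open>tau_homogeneous\<close> the term \<open>j = 0\<close> involves \<open>v\<close> itself, the others only \<open>L(1)\<^sup>jv\<close>; so the relation
  can be inverted by induction on the nilpotency degree of \<open>L(1)\<close> on \<open>v\<close>.
\<close>

lemma bounded_at_infinity_homogeneous:
  assumes L: "\<Lambda> \<in> T" and B: "\<And>v. tau_bounded v \<Lambda>"
  shows "v \<in> wt a \<Longrightarrow> (L 1 ^^ J) v = 0 \<Longrightarrow> bounded_at_infinity v \<Lambda>"
proof (induction J arbitrary: v a)
  case 0
  then show ?case by (simp add: bounded_at_infinity_def act_zero_left[OF L])
next
  case (Suc J)
  have J: "(L 1 ^^ j) v = 0" if "j \<ge> Suc J" for j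
  proof -
    have "j = (j - Suc J) + Suc J" using that by simp
    then have "(L 1 ^^ j) v = (L 1 ^^ (j - Suc J)) ((L 1 ^^ Suc J) v)"
      by (metis funpow_add comp_apply)
    then show ?thesis using Suc.prems(2) by (simp add: L1_pow_linear del: funpow.simps)
  qed
  have "bounded_at_infinity ((L 1 ^^ Suc j) v) \<Lambda>" for j
  proof (rule Suc.IH)
    show "(L 1 ^^ Suc j) v \<in> wt (a - int (Suc j))" by (rule L1_pow_mem_wt[OF Suc.prems(1)])
    have "(L 1 ^^ J) ((L 1 ^^ Suc j) v) = (L 1 ^^ (J + Suc j)) v" by (simp only: funpow_add comp_apply)
    then show "(L 1 ^^ J) ((L 1 ^^ Suc j) v) = 0" using J[of "J + Suc j"] by simp
  qed
  then obtain M where M: "\<And>j l m. l + m \<le> M j \<Longrightarrow> act ((L 1 ^^ Suc j) v) l m \<Lambda> = 0"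
    unfolding bounded_at_infinity_def by metis
  define M0 where "M0 = Min (insert 0 (M ` {..<J}))"
  have M0: "M0 \<le> M j" if "j < J" for j using that by (auto simp: M0_def)
  obtain N where N: "\<And>n m. m - n \<ge> N \<Longrightarrow> tau_coeff v n m \<Lambda> = 0"
    using B unfolding tau_bounded_def by blast
  have "act v l k \<Lambda> = 0" if lk: "l + k \<le> min M0 (2 * a - 2 - N)" for l k
  proof -
    \<comment> \<open>Chosen so that the summand \<open>j = 0\<close> of
      \<open>tau_homogeneous\<close> is exactly \<open>act v l k \<Lambda>\<close>.\<close>
    define m where "m = 2 * a - 2 - k"
    have "0 = tau_coeff v l m \<Lambda>"
      using lk by (intro N[symmetric]) (simp add: m_def)
    also have "\<dots> = (\<Sum>j<Suc J. scale_form ((-1) powi a / fact j) (act ((L 1 ^^ j) v) l (k - int j) \<Lambda>))"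
    proof -
      have "2 * a - int j - m - 2 = k - int j" for j by (simp add: m_def)
      moreover have "tau_coeff v l m \<Lambda> =
        (\<Sum>j<Suc J. scale_form ((-1) powi a / fact j) (act ((L 1 ^^ j) v) l (2 * a - int j - m - 2) \<Lambda>))"
        by (rule tau_homogeneous[OF L Suc.prems(1) J])
      ultimately show ?thesis by (simp only:)
    qed
    also have "\<dots> = scale_form ((-1) powi a) (act v l k \<Lambda>) +
        (\<Sum>j<J. scale_form ((-1) powi a / fact (Suc j)) (act ((L 1 ^^ Suc j) v) l (k - int (Suc j)) \<Lambda>))"
      by (subst sum.lessThan_Suc_shift) simp
    also have "(\<Sum>j<J. scale_form ((-1) powi a / fact (Suc j)) (act ((L 1 ^^ Suc j) v) l (k - int (Suc j)) \<Lambda>)) = 0"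
    proof (rule sum.neutral, rule ballI)
      fix j assume "j \<in> {..<J}"
      then have "act ((L 1 ^^ Suc j) v) l (k - int (Suc j)) \<Lambda> = 0"
        using M0[of j] lk by (intro M) simp
      then show "scale_form ((-1) powi a / fact (Suc j)) (act ((L 1 ^^ Suc j) v) l (k - int (Suc j)) \<Lambda>) = 0"
        by (simp del: funpow.simps)
    qed
    finally have "scale_form ((-1) powi a) (act v l k \<Lambda>) = 0" by (simp only: add_0_right)
    then show ?thesis by (simp only: F.scale_eq_0_iff) simp
  qed
  then show ?case unfolding bounded_at_infinity_def by blast
qed

lemma bounded_at_infinity_all:
  assumes L: "\<Lambda> \<in> T" and B: "\<And>a v. v \<in> wt a \<Longrightarrow> bounded_at_infinity v \<Lambda>"
  shows "bounded_at_infinity v \<Lambda>"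
proof -
  have "v \<in> V.span (\<Union>n. wt n)" by (simp add: span_wt)
  then show ?thesis
  proof (induction rule: V.span_induct)
    case base
    show ?case
      unfolding V.subspace_def mem_Collect_eq
    proof (intro conjI allI impI ballI)
      show "bounded_at_infinity 0 \<Lambda>" by (simp add: bounded_at_infinity_def act_zero_left[OF L])
      fix u v assume "u \<in> {v. bounded_at_infinity v \<Lambda>}" "v \<in> {v. bounded_at_infinity v \<Lambda>}"
      then obtain N M where "\<And>l m. l + m \<le> N \<Longrightarrow> act u l m \<Lambda> = 0" "\<And>l m. l + m \<le> M \<Longrightarrow> act v l m \<Lambda> = 0"
        unfolding bounded_at_infinity_def by blast
      then have "\<forall>l m. l + m \<le> min N M \<longrightarrow> act (u + v) l m \<Lambda> = 0"
        by (simp add: act_add_left[OF L])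
      then show "bounded_at_infinity (u + v) \<Lambda>" unfolding bounded_at_infinity_def by blast
    next
      fix c v assume "v \<in> {v. bounded_at_infinity v \<Lambda>}"
      then show "bounded_at_infinity (sV c v) \<Lambda>"
        unfolding bounded_at_infinity_def by (force simp: act_scale_left[OF L])
    qed
  next
    case (step v)
    then show ?case using B by blast
  qed
qed

lemma tau_bounded_all:
  assumes L: "\<Lambda> \<in> T" and B: "\<And>a v. v \<in> wt a \<Longrightarrow> tau_bounded v \<Lambda>"
  shows "tau_bounded v \<Lambda>"
proof -
  have "v \<in> V.span (\<Union>n. wt n)" by (simp add: span_wt)
  then show ?thesis
  proof (induction rule: V.span_induct)
    case base
    show ?case
      unfolding V.subspace_def mem_Collect_eq
    proof (intro conjI allI impI ballI)
      have "tau_coeff 0 n m \<Lambda> = 0" for n m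
        using tau_add_left[OF L, of 0 0] by simp
      then show "tau_bounded 0 \<Lambda>" by (simp add: tau_bounded_def)
      fix u v assume "u \<in> {v. tau_bounded v \<Lambda>}" "v \<in> {v. tau_bounded v \<Lambda>}"
      then obtain N M where "\<And>n m. m - n \<ge> N \<Longrightarrow> tau_coeff u n m \<Lambda> = 0"
        "\<And>n m. m - n \<ge> M \<Longrightarrow> tau_coeff v n m \<Lambda> = 0"
        unfolding tau_bounded_def by blast
      then have "\<forall>n m. m - n \<ge> max N M \<longrightarrow> tau_coeff (u + v) n m \<Lambda> = 0"
        by (simp add: tau_add_left[OF L])
      then show "tau_bounded (u + v) \<Lambda>" unfolding tau_bounded_def by blast
    next
      fix c v assume "v \<in> {v. tau_bounded v \<Lambda>}"
      then show "tau_bounded (sV c v) \<Lambda>"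
        unfolding tau_bounded_def by (force simp: tau_scale_left[OF L])
    qed
  next
    case (step v)
    then show ?case using B by blast
  qed
qed

lemma P_compatible_iff:
  assumes L: "\<Lambda> \<in> T"
  shows "P_compatible V Y1 Y2 z \<Lambda> \<longleftrightarrow> (\<forall>v. bounded_at_infinity v \<Lambda>)"
proof
  assume "P_compatible V Y1 Y2 z \<Lambda>"
  then have B: "tau_bounded v \<Lambda>" for v by (simp add: P_compatible_iff_tau_bounded[OF L])
  have "bounded_at_infinity v \<Lambda>" if "v \<in> wt a" for v a
    using bounded_at_infinity_homogeneous[OF L B that] L1_nilpotent[OF that] by blast
  then show "\<forall>v. bounded_at_infinity v \<Lambda>" using bounded_at_infinity_all[OF L] by blast
next
  assume "\<forall>v. bounded_at_infinity v \<Lambda>"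
  then have "tau_bounded v \<Lambda>" if "v \<in> wt a" for v a
    using tau_bounded_homogeneous[OF L that] by blast
  then show "P_compatible V Y1 Y2 z \<Lambda>"
    using tau_bounded_all[OF L] P_compatible_iff_tau_bounded[OF L] by blast
qed

end

subsection \<open>Commutators and the Jacobi identity\<close>

text \<open>Only the finitely many \<open>k < A\<close> need a cutoff of their own, so one cutoff
  serves all \<open>k\<close>.\<close>

lemma eventually_uniform_bound:
  assumes "\<And>k. \<forall>\<^sub>F K in sequentially. \<forall>i\<ge>K. P k i" and "\<And>k i. k \<ge> (A::nat) \<Longrightarrow> P k i"
  shows "\<forall>\<^sub>F K::nat in sequentially. \<forall>k. \<forall>i\<ge>K. P k i"
proof -
  have "\<forall>\<^sub>F K in sequentially. \<forall>k\<in>{..<A}. \<forall>i\<ge>K. P k i"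
    by (intro eventually_ball_finite finite_lessThan ballI assms(1))
  then show ?thesis
  proof eventually_elim
    case (elim K)
    then show ?case using assms(2) by (metis lessThan_iff not_le)
  qed
qed

text \<open>Resums the terms with both vectors on the first factor. \<open>F k p\<close> stands for
  a mode of the k-th product of \<open>u\<close> and \<open>v\<close>; for fixed \<open>k\<close>
  and \<open>p\<close> its coefficients combine by \<open>ibinom_translate\<close> to those of the
  function \<open>ibinom m k\<close> times x^(m+n-k).\<close>

lemma sum_taylor_iterate:
  assumes z: "z \<noteq> 0" and F: "\<And>k p. k \<ge> A \<or> p \<ge> B \<Longrightarrow> F k p = 0" and M: "A + B \<le> M"
  shows "(\<Sum>a<M. \<Sum>i<M. taylor z n a * taylor z m i * (\<Sum>k\<le>i. ibinom (int i) k * F k (a + (i - k)))) =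
    (\<Sum>k<A. ibinom m k * (\<Sum>p<B. taylor z (m + n - int k) p * F k p))"
proof -
  define H where "H k a b = taylor z n a * taylor z m (k + b) * ibinom (int (k + b)) k * F k (a + b)" for k a b
  have "(\<Sum>a<M. \<Sum>i<M. taylor z n a * taylor z m i * (\<Sum>k\<le>i. ibinom (int i) k * F k (a + (i - k)))) =
      (\<Sum>a<M. \<Sum>i<M. \<Sum>k\<le>i. H k a (i - k))"
    by (intro sum.cong refl) (simp add: H_def sum_distrib_left mult.assoc del: of_int_of_nat_eq)
  also have "\<dots> = (\<Sum>a<M. \<Sum>k<A. \<Sum>b<B. H k a b)"
    using M by (intro sum.cong refl sum_convolution) (auto simp: H_def F)
  also have "\<dots> = (\<Sum>a<B. \<Sum>k<A. \<Sum>b<B. H k a b)"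
    using M by (intro sum_lessThan_extend) (auto simp: H_def F)
  also have "\<dots> = (\<Sum>k<A. \<Sum>a<B. \<Sum>b<B. H k a b)"
    by (rule sum.swap)
  also have "\<dots> = (\<Sum>k<A. \<Sum>p<B. \<Sum>a\<le>p. H k a (p - a))"
  proof (rule sum.cong[OF refl])
    fix k
    have "(\<Sum>a<B. \<Sum>b<B. H k a b) = (\<Sum>p<B + B. \<Sum>a\<le>p. H k a (p - a))"
      by (rule sum_convolution[symmetric]) (auto simp: H_def F)
    also have "\<dots> = (\<Sum>p<B. \<Sum>a\<le>p. H k a (p - a))"
      by (rule sum_lessThan_extend) (auto simp: H_def F)
    finally show "(\<Sum>a<B. \<Sum>b<B. H k a b) = \<dots>" .
  qed
  also have "\<dots> = (\<Sum>k<A. ibinom m k * (\<Sum>p<B. taylor z (m + n - int k) p * F k p))"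
  proof -
    have "ibinom m k * (taylor z (m + n - int k) p * F k p) = (\<Sum>a\<le>p. H k a (p - a))" for k p
    proof -
      have e: "z powi (n - int a) * z powi (m - int (k + (p - a))) = z powi (m + n - int k - int p)" if "a \<le> p" for a
      proof -
        have "n - int a + (m - int (k + (p - a))) = m + n - int k - int p" using that by simp
        then show ?thesis by (simp only: power_int_add[OF disjI1[OF z], symmetric])
      qed
      have "ibinom m k * (taylor z (m + n - int k) p * F k p) =
        (ibinom m k * ibinom (m + n - int k) p) * (z powi (m + n - int k - int p) * F k p)"
        by (simp only: taylor_def mult.assoc)
      also have "\<dots> = (\<Sum>a\<le>p. ibinom n a * ibinom m (k + (p - a)) * ibinom (int (k + (p - a))) k *
        (z powi (m + n - int k - int p) * F k p))"
        unfolding ibinom_translate sum_distrib_right ..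
      also have "\<dots> = (\<Sum>a\<le>p. H k a (p - a))"
      proof (rule sum.cong[OF refl])
        fix a assume "a \<in> {..p}"
        then have a: "a \<le> p" by simp
        show "ibinom n a * ibinom m (k + (p - a)) * ibinom (int (k + (p - a))) k *
          (z powi (m + n - int k - int p) * F k p) = H k a (p - a)"
          unfolding H_def taylor_def e[OF a, symmetric] using a by (simp del: of_int_of_nat_eq of_int_add of_int_diff of_nat_add)
      qed
      finally show ?thesis .
    qed
    then show ?thesis by (simp only: sum_distrib_left)
  qed
  finally show ?thesis .
qed

text \<open>Pairing with \<open>f\<close> gives a numerical identity with explicit ranges. The last
  hypothesis concerns the scaled term because it may vanish through the binomial coefficient as well
  as through truncation.\<close>

lemma (in vertex_map) jacobi_functional:
  fixes f :: "'w \<Rightarrow> complex"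
  assumes w: "w \<in> W" and f: "\<And>x y. f (x + y) = f x + f y" "\<And>c x. f (s c x) = c * f x"
    and K: "\<And>i. i \<ge> K \<Longrightarrow> Y v (n + int i) w = 0" "\<And>i. i \<ge> K' \<Longrightarrow> Y u (m + int i) w = 0"
      "\<And>i. i \<ge> K'' \<Longrightarrow> s (ibinom m i) (Y (opV V u (l + int i) v) (m + n - int i) w) = 0"
  shows "(\<Sum>i<K. (-1) ^ i * ibinom l i * f (Y u (m + l - int i) (Y v (n + int i) w)))
     - (-1) powi l * (\<Sum>i<K'. (-1) ^ i * ibinom l i * f (Y v (n + l - int i) (Y u (m + int i) w)))
     = (\<Sum>i<K''. ibinom m i * f (Y (opV V u (l + int i) v) (m + n - int i) w))"
proof -
  have f0: "f 0 = 0" using f(1)[of 0 0] by simp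
  have f_diff: "f (x - y) = f x - f y" for x y using f(1)[of "x - y" y] by simp
  have f_sum: "f (\<Sum>i\<in>A. g i) = (\<Sum>i\<in>A. f (g i))" for g :: "nat \<Rightarrow> 'w" and A
    by (induction A rule: infinite_finite_induct) (simp_all add: f0 f)
  have "(\<Sum>i<K. s ((-1) ^ i * ibinom l i) (Y u (m + l - int i) (Y v (n + int i) w)))
     - (\<Sum>i<K'. s ((-1) powi l * (-1) ^ i * ibinom l i) (Y v (n + l - int i) (Y u (m + int i) w)))
     = (\<Sum>i<K''. s (ibinom m i) (Y (opV V u (l + int i) v) (m + n - int i) w))"
  proof -
    have "Sum_any (\<lambda>i::nat. s ((-1) ^ i * ibinom l i) (Y u (m + l - int i) (Y v (n + int i) w))) =
      (\<Sum>i<K. s ((-1) ^ i * ibinom l i) (Y u (m + l - int i) (Y v (n + int i) w)))"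
      by (rule Sum_any_lessThan) (simp add: K(1) Y_zero)
    moreover have "Sum_any (\<lambda>i::nat. s ((-1) powi l * (-1) ^ i * ibinom l i) (Y v (n + l - int i) (Y u (m + int i) w))) =
      (\<Sum>i<K'. s ((-1) powi l * (-1) ^ i * ibinom l i) (Y v (n + l - int i) (Y u (m + int i) w)))"
      by (rule Sum_any_lessThan) (simp add: K(2) Y_zero)
    moreover have "Sum_any (\<lambda>i::nat. s (ibinom m i) (Y (opV V u (l + int i) v) (m + n - int i) w)) =
      (\<Sum>i<K''. s (ibinom m i) (Y (opV V u (l + int i) v) (m + n - int i) w))"
      by (rule Sum_any_lessThan) (rule K(3))
    ultimately show ?thesis using jacobi[OF w, of l u m v n] by (simp only:)
  qed
  from arg_cong[OF this, of f] show ?thesis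
    by (simp add: f_diff f_sum f(2) sum_distrib_left mult.assoc)
qed

context P_z
begin

lemma act_finite:
  assumes L: "\<Lambda> \<in> T" and "\<And>i. i \<ge> K \<Longrightarrow> Y2 v (m + int i) y = 0" and "\<And>i. i \<ge> K' \<Longrightarrow> Y1 v (l + int i) x = 0"
  shows "act v l m \<Lambda> x y =
    (\<Sum>i<K. taylor (- z) l i * \<Lambda> x (Y2 v (m + int i) y)) + (\<Sum>i<K'. taylor z m i * \<Lambda> (Y1 v (l + int i) x) y)"
  unfolding rational_action_def
  by (intro arg_cong2[where f = "(+)"] Sum_any_lessThan) (simp_all add: assms T_zero1 T_zero2)

lemma act_0_finite:
  assumes L: "\<Lambda> \<in> T" and "\<And>i. i \<ge> K' \<Longrightarrow> Y1 v (int i) x = 0"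
  shows "act v 0 m \<Lambda> x y =
    \<Lambda> x (Y2 v m y) + (\<Sum>i<K'. taylor z m i * \<Lambda> (Y1 v (int i) x) y)"
proof -
  have "Sum_any (\<lambda>i. taylor (- z) 0 i * \<Lambda> x (Y2 v (m + int i) y)) =
    (\<Sum>i<1. taylor (- z) 0 i * \<Lambda> x (Y2 v (m + int i) y))"
    by (rule Sum_any_lessThan) (simp add: taylor_0)
  moreover have "Sum_any (\<lambda>i. taylor z m i * \<Lambda> (Y1 v (0 + int i) x) y) =
    (\<Sum>i<K'. taylor z m i * \<Lambda> (Y1 v (0 + int i) x) y)"
    by (rule Sum_any_lessThan) (simp add: assms T_zero1)
  ultimately show ?thesis
    unfolding rational_action_def by (simp add: taylor_0)
qed

lemma op_eventually_zero: "\<forall>\<^sub>F K in sequentially. \<forall>i\<ge>K. opV V u (l + int i) v = 0"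
  by (rule V.Y_eventually_zero) simp

text \<open>
  \<open>[u \<otimes> f, v \<otimes> g] = \<Sum>\<^sub>k u\<^sub>kv \<otimes> (f\<^bsup>(k)\<^esup>/k!)g\<close> for \<open>f = x\<^sup>m\<close>, \<open>g = x\<^sup>n(x - z)\<^sup>l\<close>; the order is
  reversed by dualization.
\<close>

lemma act_commutator:
  assumes L: "\<Lambda> \<in> T" and A: "\<And>k. k \<ge> A \<Longrightarrow> opV V u (int k) v = 0"
  shows "act v l n (act u 0 m \<Lambda>) w1 w2 - act u 0 m (act v l n \<Lambda>) w1 w2 =
    (\<Sum>k<A. ibinom m k * act (opV V u (int k) v) l (m + n - int k) \<Lambda> w1 w2)"
proof -
  define p where "p k = opV V u (int k) v" for k
  have A': "p k = 0" if "k \<ge> A" for k using A that by (simp add: p_def)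
  obtain B where B: "\<And>k i. i \<ge> B \<Longrightarrow> Y1 (p k) (l + int i) w1 = 0"
      "\<And>k i. i \<ge> B \<Longrightarrow> Y2 (p k) (m + n - int k + int i) w2 = 0"
  proof -
    have "\<forall>\<^sub>F B in sequentially. \<forall>k. \<forall>i\<ge>B. Y1 (p k) (l + int i) w1 = 0"
      by (rule eventually_uniform_bound[of _ A]) (simp_all add: A' M1.Y_zero_left M1.Y_eventually_zero)
    moreover have "\<forall>\<^sub>F B in sequentially. \<forall>k. \<forall>i\<ge>B. Y2 (p k) (m + n - int k + int i) w2 = 0"
      by (rule eventually_uniform_bound[of _ A]) (simp_all add: A' M2.Y_zero_left M2.Y_eventually_zero)
    ultimately have "\<forall>\<^sub>F B in sequentially. (\<forall>k. \<forall>i\<ge>B. Y1 (p k) (l + int i) w1 = 0) \<and>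
        (\<forall>k. \<forall>i\<ge>B. Y2 (p k) (m + n - int k + int i) w2 = 0)" by (rule eventually_conj)
    from eventually_happens'[OF sequentially_bot this] show ?thesis
      by (elim exE conjE) (rule that; blast)
  qed
  obtain C where C: "\<And>i. i \<ge> C \<Longrightarrow> Y1 u (int i) w1 = 0" "\<And>i. i \<ge> C \<Longrightarrow> Y1 v (l + int i) w1 = 0"
  proof -
    have "\<forall>\<^sub>F C in sequentially. \<forall>i\<ge>C. Y1 u (int i) w1 = 0"
      using M1.Y_eventually_zero[of w1 u 0] by simp
    moreover have "\<forall>\<^sub>F C in sequentially. \<forall>i\<ge>C. Y1 v (l + int i) w1 = 0"
      by (rule M1.Y_eventually_zero) simp
    ultimately have "\<forall>\<^sub>F C in sequentially. (\<forall>i\<ge>C. Y1 u (int i) w1 = 0) \<and> (\<forall>i\<ge>C. Y1 v (l + int i) w1 = 0)"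
      by (rule eventually_conj)
    from eventually_happens'[OF sequentially_bot this] show ?thesis
      by (elim exE conjE) (rule that; blast)
  qed
  obtain K where K: "K \<ge> A + B" "K \<ge> C"
      "\<And>i. i \<ge> K \<Longrightarrow> Y2 v (n + int i) w2 = 0"
      "\<And>i. i \<ge> K \<Longrightarrow> Y2 v (n + int i) (Y2 u m w2) = 0"
      "\<And>i j. j \<ge> K \<Longrightarrow> Y1 u (int j) (Y1 v (l + int i) w1) = 0"
      "\<And>i j. i \<ge> K \<Longrightarrow> Y1 v (l + int i) (Y1 u (int j) w1) = 0"
  proof -
    have 1: "\<forall>\<^sub>F K in sequentially. \<forall>i. \<forall>j\<ge>K. Y1 u (int j) (Y1 v (l + int i) w1) = 0"
      using M1.Y_eventually_zero[of _ u 0] by (intro eventually_uniform_bound[of _ C]) (simp_all add: C M1.Y_zero)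
    have 2: "\<forall>\<^sub>F K in sequentially. \<forall>j. \<forall>i\<ge>K. Y1 v (l + int i) (Y1 u (int j) w1) = 0"
      by (rule eventually_uniform_bound[of _ C]) (simp_all add: C M1.Y_zero M1.Y_eventually_zero)
    have "\<forall>\<^sub>F K in sequentially. K \<ge> A + B \<and> K \<ge> C \<and> (\<forall>i\<ge>K. Y2 v (n + int i) w2 = 0) \<and>
      (\<forall>i\<ge>K. Y2 v (n + int i) (Y2 u m w2) = 0) \<and> (\<forall>i. \<forall>j\<ge>K. Y1 u (int j) (Y1 v (l + int i) w1) = 0) \<and>
      (\<forall>j. \<forall>i\<ge>K. Y1 v (l + int i) (Y1 u (int j) w1) = 0)"
      using M2.Y_eventually_zero[of w2 v n] M2.Y_eventually_zero[of "Y2 u m w2" v n]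
      by (intro eventually_conj eventually_ge_at_top 1 2) simp_all
    from eventually_happens'[OF sequentially_bot this] show ?thesis
      by (elim exE conjE) (rule that; blast)
  qed
  have C': "\<And>i. i \<ge> K \<Longrightarrow> Y1 u (int i) w1 = 0" "\<And>i. i \<ge> K \<Longrightarrow> Y1 v (l + int i) w1 = 0"
    using C K(2) by simp_all
  \<comment> \<open>\<open>P1\<close> and \<open>Q1\<close> have both vectors on the second factor,
    \<open>P4\<close> and \<open>Q4\<close> both on the first. The mixed sums \<open>P2\<close> and
    \<open>P3\<close> occur in both orders, since operators on different factors commute, and drop
    out.\<close>
  define P1 where "P1 = (\<Sum>i<K. taylor (- z) l i * \<Lambda> w1 (Y2 u m (Y2 v (n + int i) w2)))"
  define Q1 where "Q1 = (\<Sum>i<K. taylor (- z) l i * \<Lambda> w1 (Y2 v (n + int i) (Y2 u m w2)))"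
  define P2 where "P2 = (\<Sum>i<K. \<Sum>j<K. taylor (- z) l i * taylor z m j * \<Lambda> (Y1 u (int j) w1) (Y2 v (n + int i) w2))"
  define P3 where "P3 = (\<Sum>i<K. taylor z n i * \<Lambda> (Y1 v (l + int i) w1) (Y2 u m w2))"
  define P4 where "P4 = (\<Sum>i<K. \<Sum>j<K. taylor z n i * taylor z m j * \<Lambda> (Y1 u (int j) (Y1 v (l + int i) w1)) w2)"
  define Q4 where "Q4 = (\<Sum>i<K. \<Sum>j<K. taylor z n i * taylor z m j * \<Lambda> (Y1 v (l + int i) (Y1 u (int j) w1)) w2)"
  have h: "act u 0 m \<Lambda> w1 y = \<Lambda> w1 (Y2 u m y) + (\<Sum>j<K. taylor z m j * \<Lambda> (Y1 u (int j) w1) y)"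
      "act u 0 m \<Lambda> (Y1 v (l + int i) w1) y = \<Lambda> (Y1 v (l + int i) w1) (Y2 u m y) +
      (\<Sum>j<K. taylor z m j * \<Lambda> (Y1 u (int j) (Y1 v (l + int i) w1)) y)" for y i
    using C'(1) K(5) by (intro act_0_finite L; blast)+
  have "act v l n (act u 0 m \<Lambda>) w1 w2 =
    (\<Sum>i<K. taylor (- z) l i * act u 0 m \<Lambda> w1 (Y2 v (n + int i) w2)) +
    (\<Sum>i<K. taylor z n i * act u 0 m \<Lambda> (Y1 v (l + int i) w1) w2)"
    using K(3) C'(2) by (intro act_finite act_mem_T L)
  also have "\<dots> = P1 + P2 + (P3 + P4)"
    unfolding h P1_def P2_def P3_def P4_def
    by (simp add: distrib_left sum.distrib sum_distrib_left mult.assoc)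
  finally have E1: "act v l n (act u 0 m \<Lambda>) w1 w2 = P1 + P2 + (P3 + P4)" .
  have "act u 0 m (act v l n \<Lambda>) w1 w2 = act v l n \<Lambda> w1 (Y2 u m w2) +
     (\<Sum>j<K. taylor z m j * act v l n \<Lambda> (Y1 u (int j) w1) w2)"
    using C'(1) by (intro act_0_finite act_mem_T L)
  also have "act v l n \<Lambda> w1 (Y2 u m w2) = Q1 + P3"
    using K(4) C'(2) unfolding Q1_def P3_def by (intro act_finite L)
  also have "(\<Sum>j<K. taylor z m j * act v l n \<Lambda> (Y1 u (int j) w1) w2) = P2 + Q4"
  proof -
    have "act v l n \<Lambda> (Y1 u (int j) w1) w2 =
      (\<Sum>i<K. taylor (- z) l i * \<Lambda> (Y1 u (int j) w1) (Y2 v (n + int i) w2)) +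
      (\<Sum>i<K. taylor z n i * \<Lambda> (Y1 v (l + int i) (Y1 u (int j) w1)) w2)" for j
      using K(3) K(6) by (intro act_finite L)
    moreover have "P2 = (\<Sum>j<K. \<Sum>i<K. taylor (- z) l i * taylor z m j * \<Lambda> (Y1 u (int j) w1) (Y2 v (n + int i) w2))"
      unfolding P2_def by (rule sum.swap)
    moreover have "Q4 = (\<Sum>j<K. \<Sum>i<K. taylor z n i * taylor z m j * \<Lambda> (Y1 v (l + int i) (Y1 u (int j) w1)) w2)"
      unfolding Q4_def by (rule sum.swap)
    ultimately show ?thesis
      by (simp add: distrib_left sum.distrib sum_distrib_left mult_ac)
  qed
  finally have E2: "act u 0 m (act v l n \<Lambda>) w1 w2 = Q1 + P3 + (P2 + Q4)" .
  have R1: "P1 - Q1 = (\<Sum>k<A. ibinom m k * (\<Sum>i<B. taylor (- z) l i * \<Lambda> w1 (Y2 (p k) (m + n - int k + int i) w2)))"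
  proof -
    have c: "\<Lambda> w1 (Y2 u m (Y2 v (n + int i) w2)) - \<Lambda> w1 (Y2 v (n + int i) (Y2 u m w2)) =
      (\<Sum>k<A. ibinom m k * \<Lambda> w1 (Y2 (p k) (m + n - int k + int i) w2))" for i
    proof -
      obtain J1 where J1: "\<And>j. j \<ge> J1 \<Longrightarrow> Y2 v (n + int i + int j) w2 = 0"
        using M2.Y_truncation_nat[of w2 v "n + int i"] by auto
      obtain J2 where J2: "\<And>j. j \<ge> J2 \<Longrightarrow> Y2 u (m + int j) w2 = 0"
        using M2.Y_truncation_nat[of w2 u m] by auto
      \<comment> \<open>\<open>Suc\<close> keeps \<open>j = 0\<close>, the only index with
        \<open>ibinom 0 j\<close> nonzero, inside the range.\<close>
      have J1': "Y2 v (n + int i + int j) w2 = 0" if "j \<ge> Suc J1" for j using J1 that by simp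
      have J2': "Y2 u (m + int j) w2 = 0" if "j \<ge> Suc J2" for j using J2 that by simp
      have 0: "(-1) ^ j * ibinom 0 j * x = (if j = 0 then x else 0)" for j x by (simp add: gbinomial_0_left)
      have e: "m + (n + int i) - int k = m + n - int k + int i" for k by simp
      \<comment> \<open>The mode \<open>m\<close> of \<open>u\<close> may be negative here, so the
        Jacobi identity with \<open>l = 0\<close> replaces \<open>commutator\<close>.\<close>
      have "(\<Sum>j<Suc J1. (-1) ^ j * ibinom 0 j * \<Lambda> w1 (Y2 u (m + 0 - int j) (Y2 v (n + int i + int j) w2)))
         - (-1) powi 0 * (\<Sum>j<Suc J2. (-1) ^ j * ibinom 0 j * \<Lambda> w1 (Y2 v (n + int i + 0 - int j) (Y2 u (m + int j) w2)))
        = (\<Sum>k<A. ibinom m k * \<Lambda> w1 (Y2 (opV V u (0 + int k) v) (m + (n + int i) - int k) w2))"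
        using J1' J2'
        by (intro M2.jacobi_functional) (simp_all add: T_add2 T_scale2 L A M2.Y_zero_left)
      then show ?thesis unfolding 0 e by (simp add: p_def del: sum.lessThan_Suc)
    qed
    have "P1 - Q1 = (\<Sum>i<K. taylor (- z) l i * (\<Sum>k<A. ibinom m k * \<Lambda> w1 (Y2 (p k) (m + n - int k + int i) w2)))"
      unfolding P1_def Q1_def sum_subtractf[symmetric] right_diff_distrib[symmetric] c ..
    also have "\<dots> = (\<Sum>i<B. taylor (- z) l i * (\<Sum>k<A. ibinom m k * \<Lambda> w1 (Y2 (p k) (m + n - int k + int i) w2)))"
      using K(1) B(2) by (intro sum_lessThan_extend) (simp_all add: T_zero2[OF L])
    finally show ?thesis
      by (simp add: sum_distrib_left mult.left_commute) (rule sum.swap)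
  qed
  have R2: "P4 - Q4 = (\<Sum>k<A. ibinom m k * (\<Sum>i<B. taylor z (m + n - int k) i * \<Lambda> (Y1 (p k) (l + int i) w1) w2))"
  proof -
    define F where "F k i = \<Lambda> (Y1 (p k) (l + int i) w1) w2" for k i
    have c: "\<Lambda> (Y1 u (int j) (Y1 v (l + int i) w1)) w2 - \<Lambda> (Y1 v (l + int i) (Y1 u (int j) w1)) w2 =
      (\<Sum>k\<le>j. ibinom (int j) k * F k (i + (j - k)))" for i j
    proof -
      have e: "int j + (l + int i) - int k = l + int (i + (j - k))" if "k \<le> j" for k using that by simp
      have d: "\<Lambda> (x - y) w2 = \<Lambda> x w2 - \<Lambda> y w2" for x y
        using T_add1[OF L, of "x - y" y] by simp
      have "\<Lambda> (Y1 u (int j) (Y1 v (l + int i) w1)) w2 - \<Lambda> (Y1 v (l + int i) (Y1 u (int j) w1)) w2 =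
        \<Lambda> (\<Sum>k\<le>j. s1 (of_nat (j choose k)) (Y1 (p k) (int j + (l + int i) - int k) w1)) w2"
        using M1.commutator[of w1 u j v "l + int i"] unfolding d[symmetric] by (simp add: p_def)
      also have "\<dots> = (\<Sum>k\<le>j. ibinom (int j) k * F k (i + (j - k)))"
        unfolding T_sum1[OF L] T_scale1[OF L] F_def
        by (intro sum.cong refl) (simp only: e atMost_iff of_int_of_nat_eq binomial_gbinomial)
      finally show ?thesis .
    qed
    have "P4 - Q4 = (\<Sum>i<K. \<Sum>j<K. taylor z n i * taylor z m j * (\<Sum>k\<le>j. ibinom (int j) k * F k (i + (j - k))))"
      unfolding P4_def Q4_def sum_subtractf[symmetric] right_diff_distrib[symmetric] c ..
    also have "\<dots> = (\<Sum>k<A. ibinom m k * (\<Sum>i<B. taylor z (m + n - int k) i * F k i))"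
      using A' B(1) by (intro sum_taylor_iterate z K(1)) (auto simp: F_def M1.Y_zero_left T_zero1[OF L])
    finally show ?thesis unfolding F_def .
  qed
  have "act (p k) l (m + n - int k) \<Lambda> w1 w2 =
      (\<Sum>i<B. taylor (- z) l i * \<Lambda> w1 (Y2 (p k) (m + n - int k + int i) w2)) +
      (\<Sum>i<B. taylor z (m + n - int k) i * \<Lambda> (Y1 (p k) (l + int i) w1) w2)" for k
    using B by (intro act_finite L)
  then have "(\<Sum>k<A. ibinom m k * act (p k) l (m + n - int k) \<Lambda> w1 w2) = (P1 - Q1) + (P4 - Q4)"
    unfolding R1 R2 by (simp add: distrib_left sum.distrib)
  then show ?thesis unfolding E1 E2 p_def by simp
qed

text \<open>The commutator reduces the claim to the action of \<open>v\<close> and of the finitely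
  many nonzero products of \<open>u\<close> and \<open>v\<close> on \<Lambda> itself; hence
  boundedness is assumed for all vectors.\<close>

lemma act_bounded_at_infinity:
  assumes L: "\<Lambda> \<in> T" and B: "\<And>v. bounded_at_infinity v \<Lambda>"
  shows "bounded_at_infinity v (act u 0 m \<Lambda>)"
proof -
  obtain A where A: "\<And>k::nat. k \<ge> A \<Longrightarrow> opV V u (int k) v = 0"
    using V.Y_truncation_nat[of v u 0] by auto
  have "\<forall>k. \<exists>N. \<forall>l n. l + n \<le> N \<longrightarrow> act (opV V u (int k) v) l n \<Lambda> = 0"
    using B unfolding bounded_at_infinity_def by blast
  from choice[OF this] obtain N where N: "\<And>k l n. l + n \<le> N k \<Longrightarrow> act (opV V u (int k) v) l n \<Lambda> = 0"
    by blast
  obtain N' where N': "\<And>l n. l + n \<le> N' \<Longrightarrow> act v l n \<Lambda> = 0"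
    using B unfolding bounded_at_infinity_def by blast
  define N0 where "N0 = Min (insert N' ((\<lambda>k. N k - m) ` {..<A}))"
  have N0: "N0 \<le> N'" "k < A \<Longrightarrow> N0 \<le> N k - m" for k by (auto simp: N0_def)
  have "act v l n (act u 0 m \<Lambda>) = 0" if ln: "l + n \<le> N0" for l n
  proof (intro ext)
    fix w1 w2
    have "act v l n \<Lambda> = 0" using N0(1) ln by (intro N') simp
    moreover have "act u 0 m 0 = 0" by (simp add: rational_action_def fun_eq_iff)
    moreover have "act (opV V u (int k) v) l (m + n - int k) \<Lambda> = 0" if "k < A" for k
      using N0(2)[OF that] ln by (intro N) simp
    ultimately show "act v l n (act u 0 m \<Lambda>) w1 w2 = 0 w1 w2"
      using act_commutator[OF L A, of A l n m w1 w2] by simp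
  qed
  then show ?thesis unfolding bounded_at_infinity_def by blast
qed


text \<open>
  The four summands have \<open>u\<close> and \<open>v\<close> both near \<open>0\<close>, \<open>u\<close> near \<open>z\<close> and \<open>v\<close> near \<open>0\<close>, \<open>u\<close> near \<open>0\<close> and
  \<open>v\<close> near \<open>z\<close>, and both near \<open>z\<close>.  Compatibility of \<open>\<Lambda>\<close> enters through
  \<open>expansion_recursion_translate\<close>, which re-expands \<open>(x\<^sub>1 - x\<^sub>2)\<^sup>l\<close> when \<open>v\<close> moves to \<open>z\<close>.
\<close>

lemma act_act_expansion:
  assumes L: "\<Lambda> \<in> T" and N: "\<And>l m. l + m \<le> N \<Longrightarrow> act u l m \<Lambda> = 0" "l + m - int M \<le> N"
    and M': "2 * M' \<le> M" "\<And>j. j \<ge> M' \<Longrightarrow> Y1 v (int j) w1 = 0"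
    and M: "\<And>j. j \<ge> M \<Longrightarrow> Y1 u (int j) w1 = 0"
      "\<And>p. p \<ge> M \<Longrightarrow> Y2 u (m + int p) w2 = 0"
      "\<And>j q i. q \<le> j \<Longrightarrow> i \<ge> M \<Longrightarrow> Y1 u (l - int q + int i) (Y1 v (int j) w1) = 0"
  shows "(\<Sum>i<M. (-1) ^ i * ibinom l i * act v 0 (n + int i) (act u 0 (m + l - int i) \<Lambda>) w1 w2) =
    (\<Sum>i<M. (-1) ^ i * ibinom l i * \<Lambda> w1 (Y2 u (m + l - int i) (Y2 v (n + int i) w2))) +
    (\<Sum>i<M. \<Sum>j<M. (-1) ^ i * ibinom l i * taylor z (m + l - int i) j * \<Lambda> (Y1 u (int j) w1) (Y2 v (n + int i) w2)) +
    (-1) powi l * (\<Sum>i<M. \<Sum>j<M. (-1) ^ i * ibinom l i * taylor z (n + l - int i) j * \<Lambda> (Y1 v (int j) w1) (Y2 u (m + int i) w2)) +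
    (\<Sum>a<M. \<Sum>i<M. taylor z n a * taylor z m i *
      (\<Sum>q<M. (-1) ^ q * ibinom l q * \<Lambda> (Y1 u (int i + l - int q) (Y1 v (int a + int q) w1)) w2))"
    (is "_ = ?A + ?X + ?s * ?C + ?W")
proof -
  \<comment> \<open>Here \<open>v\<close> acts on the first factor by its mode \<open>j\<close>. The
    remaining action of \<open>u\<close> depends on x^m (x - z)^l through the recursion, so
    \<open>expansion_recursion_translate\<close> applies to \<open>D j\<close>.\<close>
  define D where "D j l m = act u l m \<Lambda> (Y1 v (int j) w1) w2" for j l m
  have M1: "Y1 v (int j) w1 = 0" if "j \<ge> M" for j using M' that by simp
  have h1: "act v 0 k (act u 0 k' \<Lambda>) w1 y = act u 0 k' \<Lambda> w1 (Y2 v k y) +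
      (\<Sum>j<M. taylor z k j * act u 0 k' \<Lambda> (Y1 v (int j) w1) y)" for k k' y
    using M1 by (intro act_0_finite act_mem_T L)
  have h2: "act u 0 k \<Lambda> w1 y = \<Lambda> w1 (Y2 u k y) +
      (\<Sum>j<M. taylor z k j * \<Lambda> (Y1 u (int j) w1) y)" for k y
    using M(1) by (intro act_0_finite L)
  have "(\<Sum>i<M. (-1) ^ i * ibinom l i * act v 0 (n + int i) (act u 0 (m + l - int i) \<Lambda>) w1 w2) =
    (\<Sum>i<M. (-1) ^ i * ibinom l i * act u 0 (m + l - int i) \<Lambda> w1 (Y2 v (n + int i) w2)) +
    (\<Sum>i<M. \<Sum>j<M. (-1) ^ i * ibinom l i * (taylor z (n + int i) j * D j 0 (m + l - int i)))"
    unfolding D_def h1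
    by (simp only: distrib_left sum.distrib sum_distrib_left)
  moreover have "(\<Sum>i<M. (-1) ^ i * ibinom l i * act u 0 (m + l - int i) \<Lambda> w1 (Y2 v (n + int i) w2)) = ?A + ?X"
    unfolding h2 by (simp only: distrib_left sum.distrib sum_distrib_left mult.assoc)
  moreover have "(\<Sum>i<M. \<Sum>j<M. (-1) ^ i * ibinom l i * (taylor z (n + int i) j * D j 0 (m + l - int i))) =
    (\<Sum>j<M. \<Sum>q\<le>j. taylor z n (j - q) * ((-1) ^ q * ibinom l q * D j (l - int q) m))"
  proof -
    have "(\<Sum>i<M. (-1) ^ i * ibinom l i * (taylor z (n + int i) j * D j 0 (m + l - int i))) =
      (\<Sum>q\<le>j. taylor z n (j - q) * ((-1) ^ q * ibinom l q * D j (l - int q) m))" for j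
    proof -
      have e: "z powi (n - int (j - q)) = z powi (n - int j + int q)" if "q \<le> j" for q
      proof -
        have "n - int (j - q) = n - int j + int q" using that by simp
        then show ?thesis by (simp only:)
      qed
      have "(\<Sum>i<M. (-1) ^ i * ibinom l i * (ibinom (n + int i) j * z powi (n + int i - int j) * D j 0 (m + l - int i))) =
        (\<Sum>q\<le>j. ibinom n (j - q) * z powi (n - int j + int q) * ((-1) ^ q * ibinom l q * D j (l - int q) m))"
      proof (rule expansion_recursion_translate[OF z])
        show "D j (l + 1) m = D j l (m + 1) - z * D j l m" for l m
          unfolding D_def by (rule act_recursion[OF L])
        show "D j l m = 0" if "l + m \<le> N" for l m
          unfolding D_def using N(1)[OF that] by simp
        show "l + m - int M \<le> N" by (rule N(2))
      qed
      moreover have "(\<Sum>q\<le>j. taylor z n (j - q) * ((-1) ^ q * ibinom l q * D j (l - int q) m)) =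
        (\<Sum>q\<le>j. ibinom n (j - q) * z powi (n - int j + int q) * ((-1) ^ q * ibinom l q * D j (l - int q) m))"
        by (intro sum.cong refl) (simp only: taylor_def e atMost_iff)
      ultimately show ?thesis unfolding taylor_def by (simp only:)
    qed
    then show ?thesis by (subst sum.swap) (simp only:)
  qed
  moreover have "(\<Sum>j<M. \<Sum>q\<le>j. taylor z n (j - q) * ((-1) ^ q * ibinom l q * D j (l - int q) m)) =
    (\<Sum>j<M. \<Sum>q\<le>j. taylor z n (j - q) * ((-1) ^ q * ibinom l q *
       (\<Sum>p<M. taylor (- z) (l - int q) p * \<Lambda> (Y1 v (int j) w1) (Y2 u (m + int p) w2)))) +
    (\<Sum>j<M. \<Sum>q\<le>j. taylor z n (j - q) * ((-1) ^ q * ibinom l q *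
       (\<Sum>i<M. taylor z m i * \<Lambda> (Y1 u (l - int q + int i) (Y1 v (int j) w1)) w2)))"
  proof -
    have d: "D j (l - int q) m = (\<Sum>p<M. taylor (- z) (l - int q) p * \<Lambda> (Y1 v (int j) w1) (Y2 u (m + int p) w2)) +
      (\<Sum>i<M. taylor z m i * \<Lambda> (Y1 u (l - int q + int i) (Y1 v (int j) w1)) w2)" if "q \<le> j" for j q
      unfolding D_def using M(2) M(3)[OF that] by (intro act_finite L)
    show ?thesis
      unfolding sum.distrib[symmetric] by (intro sum.cong refl) (simp only: d atMost_iff distrib_left)
  qed
  moreover have "(\<Sum>j<M. \<Sum>q\<le>j. taylor z n (j - q) * ((-1) ^ q * ibinom l q *
       (\<Sum>p<M. taylor (- z) (l - int q) p * \<Lambda> (Y1 v (int j) w1) (Y2 u (m + int p) w2)))) = ?s * ?C"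
  proof -
    \<comment> \<open>Two expansions of x2^n (x1 - x2)^l with x1 near 0 and x2 near z; the sign
      (-1)^l comes from reversing x1 - x2.\<close>
    have c: "(\<Sum>q\<le>j. taylor z n (j - q) * ((-1) ^ q * ibinom l q * taylor (- z) (l - int q) p)) =
      (-1) powi l * ((-1) ^ p * ibinom l p * taylor z (n + l - int p) j)" for j p
    proof -
      have "taylor z n (j - q) * ((-1) ^ q * ibinom l q * taylor (- z) (l - int q) p) =
        (-1) powi l * (-1) ^ p * z powi (n + l - int p - int j) *
        (ibinom n (j - q) * ibinom l q * ibinom (l - int q) p)" if "q \<le> j" for q
      proof -
        have "n - int (j - q) + (l - int q - int p) = n + l - int p - int j" using that by simp
        then have z': "z powi (n + l - int p - int j) = z powi (n - int (j - q)) * z powi (l - int q - int p)"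
          by (simp only: power_int_add[OF disjI1[OF z], symmetric])
        have "(-1 :: complex) powi l = (-1) powi (int q + (l - int q))" by simp
        also have "\<dots> = (-1) ^ q * (-1) powi (l - int q)"
          by (subst power_int_add) (simp_all add: power_int_of_nat)
        finally have s: "(-1 :: complex) powi l = (-1) ^ q * (-1) powi (l - int q)" .
        show ?thesis unfolding taylor_uminus[OF z] unfolding taylor_def z' s by (simp only: mult_ac)
      qed
      then have "(\<Sum>q\<le>j. taylor z n (j - q) * ((-1) ^ q * ibinom l q * taylor (- z) (l - int q) p)) =
        (\<Sum>q\<le>j. (-1) powi l * (-1) ^ p * z powi (n + l - int p - int j) *
        (ibinom n (j - q) * ibinom l q * ibinom (l - int q) p))"
        by (intro sum.cong) auto
      then show ?thesis
        unfolding sum_distrib_left[symmetric] ibinom_cross taylor_def by (simp only: mult_ac)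
    qed
    have "(\<Sum>j<M. \<Sum>q\<le>j. taylor z n (j - q) * ((-1) ^ q * ibinom l q *
       (\<Sum>p<M. taylor (- z) (l - int q) p * \<Lambda> (Y1 v (int j) w1) (Y2 u (m + int p) w2)))) =
      (\<Sum>j<M. \<Sum>p<M. (\<Sum>q\<le>j. taylor z n (j - q) * ((-1) ^ q * ibinom l q * taylor (- z) (l - int q) p)) *
         \<Lambda> (Y1 v (int j) w1) (Y2 u (m + int p) w2))"
      unfolding sum_distrib_left sum_distrib_right
      by (subst (2) sum.swap) (simp only: mult.assoc)
    also have "\<dots> = (\<Sum>p<M. \<Sum>j<M. (-1) powi l * ((-1) ^ p * ibinom l p * taylor z (n + l - int p) j) *
         \<Lambda> (Y1 v (int j) w1) (Y2 u (m + int p) w2))"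
      unfolding c by (rule sum.swap)
    finally show ?thesis by (simp only: sum_distrib_left mult.assoc)
  qed
  moreover have "(\<Sum>j<M. \<Sum>q\<le>j. taylor z n (j - q) * ((-1) ^ q * ibinom l q *
       (\<Sum>i<M. taylor z m i * \<Lambda> (Y1 u (l - int q + int i) (Y1 v (int j) w1)) w2))) = ?W"
  proof -
    define h where "h q a = taylor z n a * ((-1) ^ q * ibinom l q *
       (\<Sum>i<M. taylor z m i * \<Lambda> (Y1 u (int i + l - int q) (Y1 v (int a + int q) w1)) w2))" for q a
    have h0: "h q a = 0" if "q \<ge> M' \<or> a \<ge> M'" for q a
      using M'(2)[of "a + q"] that by (auto simp: h_def M1.Y_zero T_zero1[OF L])
    have "(\<Sum>j<M. \<Sum>q\<le>j. taylor z n (j - q) * ((-1) ^ q * ibinom l q *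
       (\<Sum>i<M. taylor z m i * \<Lambda> (Y1 u (l - int q + int i) (Y1 v (int j) w1)) w2))) =
      (\<Sum>j<M. \<Sum>q\<le>j. h q (j - q))"
    proof (intro sum.cong refl)
      fix j q :: nat assume "q \<in> {..j}"
      then have "int (j - q) + int q = int j" "l - int q + int i = int i + l - int q" for i :: nat by auto
      then show "taylor z n (j - q) * ((-1) ^ q * ibinom l q *
        (\<Sum>i<M. taylor z m i * \<Lambda> (Y1 u (l - int q + int i) (Y1 v (int j) w1)) w2)) = h q (j - q)"
        unfolding h_def by (simp only:)
    qed
    \<comment> \<open>\<open>2 * M' \<le> M\<close> leaves room for the triangle
      \<open>j < M\<close> to contain the support; the ranges are enlarged to \<open>M\<close>
      afterwards.\<close>
    also have "\<dots> = (\<Sum>q<M'. \<Sum>a<M'. h q a)"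
      by (rule sum_convolution) (use M'(1) h0 in auto)
    also have "\<dots> = (\<Sum>q<M. \<Sum>a<M. h q a)"
    proof -
      have "(\<Sum>q<M. \<Sum>a<M. h q a) = (\<Sum>q<M. \<Sum>a<M'. h q a)"
        using M'(1) h0 by (intro sum.cong refl sum_lessThan_extend) auto
      also have "\<dots> = (\<Sum>q<M'. \<Sum>a<M'. h q a)"
        using M'(1) h0 by (intro sum_lessThan_extend) auto
      finally show ?thesis by simp
    qed
    also have "\<dots> = (\<Sum>a<M. \<Sum>q<M. h q a)" by (rule sum.swap)
    also have "\<dots> = ?W"
      unfolding h_def sum_distrib_left
      by (subst (2) sum.swap) (intro sum.cong refl, simp only: mult_ac)
    finally show ?thesis .
  qed
  ultimately show ?thesis by simp
qed


text \<open>
  After exchanging \<open>u\<close> and \<open>v\<close> the mixed summands of \<open>act_act_expansion\<close> cancel; the remaining ones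
  combine by the Jacobi identities for \<open>W\<^sub>2\<close> and \<open>W\<^sub>1\<close>.
\<close>

lemma opposite_jacobi:
  assumes L: "\<Lambda> \<in> T" and Bu: "bounded_at_infinity u \<Lambda>" and Bv: "bounded_at_infinity v \<Lambda>"
  shows "\<forall>\<^sub>F K in sequentially.
    (\<Sum>i<K. (-1) ^ i * ibinom l i * act v 0 (n + int i) (act u 0 (m + l - int i) \<Lambda>) w1 w2) -
    (-1) powi l * (\<Sum>i<K. (-1) ^ i * ibinom l i * act u 0 (m + int i) (act v 0 (n + l - int i) \<Lambda>) w1 w2) =
    (\<Sum>i<K. ibinom m i * act (opV V u (l + int i) v) 0 (m + n - int i) \<Lambda> w1 w2)"
proof -
  define p where "p k = opV V u (l + int k) v" for k
  obtain A where A: "\<And>k. k \<ge> A \<Longrightarrow> p k = 0"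
    using V.Y_truncation_nat[of v u l] by (auto simp: p_def)
  have "\<forall>\<^sub>F B in sequentially. \<forall>k. \<forall>i\<ge>B. Y1 (p k) (0 + int i) w1 = 0"
    by (rule eventually_uniform_bound[of _ A]) (simp_all add: A M1.Y_zero_left M1.Y_eventually_zero del: add_0)
  from eventually_happens'[OF sequentially_bot this]
  obtain B where B: "\<And>k i. i \<ge> B \<Longrightarrow> Y1 (p k) (int i) w1 = 0" by auto
  obtain Nu where Nu: "\<And>l m. l + m \<le> Nu \<Longrightarrow> act u l m \<Lambda> = 0"
    using Bu unfolding bounded_at_infinity_def by blast
  obtain Nv where Nv: "\<And>l m. l + m \<le> Nv \<Longrightarrow> act v l m \<Lambda> = 0"
    using Bv unfolding bounded_at_infinity_def by blast
  obtain C1 where C1: "\<And>i. i \<ge> C1 \<Longrightarrow> Y1 u (int i) w1 = 0"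
    using M1.Y_truncation_nat[of w1 u 0] by auto
  obtain C2 where C2: "\<And>i. i \<ge> C2 \<Longrightarrow> Y1 v (int i) w1 = 0"
    using M1.Y_truncation_nat[of w1 v 0] by auto
  \<comment> \<open>For \<open>j \<ge> C\<close> the inner vector is zero, and every smaller
    \<open>j\<close> allows finitely many \<open>q\<close>; so one cutoff serves all
    \<open>j\<close> and \<open>q\<close>.\<close>
  have double: "\<forall>\<^sub>F K in sequentially. \<forall>j. \<forall>i\<ge>K. \<forall>q\<in>{..j}. Y1 x (l - int q + int i) (Y1 y (int j) w1) = 0"
    if C: "\<And>j. j \<ge> C \<Longrightarrow> Y1 y (int j) w1 = 0" for x y C
  proof (rule eventually_uniform_bound[of _ C])
    fix j
    have "\<forall>\<^sub>F K in sequentially. \<forall>q\<in>{..j}. \<forall>i\<ge>K. Y1 x (l - int q + int i) (Y1 y (int j) w1) = 0"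
      by (intro eventually_ball_finite finite_atMost ballI M1.Y_eventually_zero UNIV_I)
    then show "\<forall>\<^sub>F K in sequentially. \<forall>i\<ge>K. \<forall>q\<in>{..j}. Y1 x (l - int q + int i) (Y1 y (int j) w1) = 0"
      by eventually_elim blast
  qed (simp add: C M1.Y_zero)
  have d1: "\<forall>\<^sub>F K in sequentially. \<forall>j. \<forall>i\<ge>K. \<forall>q\<in>{..j}. Y1 v (l - int q + int i) (Y1 u (int j) w1) = 0"
    by (rule double) (rule C1)
  have d2: "\<forall>\<^sub>F K in sequentially. \<forall>j. \<forall>i\<ge>K. \<forall>q\<in>{..j}. Y1 u (l - int q + int i) (Y1 v (int j) w1) = 0"
    by (rule double) (rule C2)
  have bound: "\<forall>\<^sub>F K in sequentially. k - int K \<le> N" for k N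
  proof -
    have "\<forall>\<^sub>F K in sequentially. K \<ge> nat (k - N)" by (rule eventually_ge_at_top)
    then show ?thesis by eventually_elim simp
  qed
  show ?thesis
    using eventually_ge_at_top[of "A + B"] eventually_ge_at_top[of "2 * C1"] eventually_ge_at_top[of "2 * C2"]
      bound[of "l + m" Nu] bound[of "l + n" Nv]
      M2.Y_eventually_zero[OF UNIV_I, of u m w2] M2.Y_eventually_zero[OF UNIV_I, of v n w2]
      d1 d2
  proof eventually_elim
    case (elim K)
    note AB = \<open>A + B \<le> K\<close> and zu = \<open>\<forall>i\<ge>K. Y2 u (m + int i) w2 = 0\<close> and zv = \<open>\<forall>i\<ge>K. Y2 v (n + int i) w2 = 0\<close>
    have C1': "Y1 u (int i) w1 = 0" if "i \<ge> K" for i using C1 elim(2) that by simp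
    have C2': "Y1 v (int i) w1 = 0" if "i \<ge> K" for i using C2 elim(3) that by simp
    define s where "s = (-1 :: complex) powi l"
    have s: "s * s = 1" by (simp add: s_def flip: power_int_add mult_2)
    define A1 where "A1 = (\<Sum>i<K. (-1) ^ i * ibinom l i * \<Lambda> w1 (Y2 u (m + l - int i) (Y2 v (n + int i) w2)))"
    define A2 where "A2 = (\<Sum>i<K. (-1) ^ i * ibinom l i * \<Lambda> w1 (Y2 v (n + l - int i) (Y2 u (m + int i) w2)))"
    define X1 where "X1 = (\<Sum>i<K. \<Sum>j<K. (-1) ^ i * ibinom l i * taylor z (m + l - int i) j * \<Lambda> (Y1 u (int j) w1) (Y2 v (n + int i) w2))"
    define X2 where "X2 = (\<Sum>i<K. \<Sum>j<K. (-1) ^ i * ibinom l i * taylor z (n + l - int i) j * \<Lambda> (Y1 v (int j) w1) (Y2 u (m + int i) w2))"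
    define U1 where "U1 a i = (\<Sum>q<K. (-1) ^ q * ibinom l q * \<Lambda> (Y1 u (int i + l - int q) (Y1 v (int a + int q) w1)) w2)" for a i
    define U2 where "U2 a i = (\<Sum>q<K. (-1) ^ q * ibinom l q * \<Lambda> (Y1 v (int i + l - int q) (Y1 u (int a + int q) w1)) w2)" for a i
    have S1: "(\<Sum>i<K. (-1) ^ i * ibinom l i * act v 0 (n + int i) (act u 0 (m + l - int i) \<Lambda>) w1 w2) =
      A1 + X1 + s * X2 + (\<Sum>a<K. \<Sum>i<K. taylor z n a * taylor z m i * U1 a i)"
      unfolding A1_def X1_def X2_def U1_def s_def
      using elim(3,4,9) zu C1' C2 by (intro act_act_expansion[OF L Nu, where M' = C2]) auto
    \<comment> \<open>Exchanging \<open>u\<close> and \<open>v\<close> exchanges \<open>X1\<close>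
      and \<open>X2\<close>; in \<open>S1\<close> minus \<open>s\<close> times \<open>S2\<close>
      they cancel because \<open>s * s = 1\<close>.\<close>
    have S2: "(\<Sum>i<K. (-1) ^ i * ibinom l i * act u 0 (m + int i) (act v 0 (n + l - int i) \<Lambda>) w1 w2) =
      A2 + X2 + s * X1 + (\<Sum>a<K. \<Sum>i<K. taylor z m a * taylor z n i * U2 a i)"
      unfolding A2_def X1_def X2_def U2_def s_def
      using elim(2,5,8) zv C2' C1 by (intro act_act_expansion[OF L Nv, where M' = C1]) auto
    have U2: "(\<Sum>a<K. \<Sum>i<K. taylor z m a * taylor z n i * U2 a i) = (\<Sum>a<K. \<Sum>i<K. taylor z n a * taylor z m i * U2 i a)"
      by (subst sum.swap) (simp only: mult.commute mult.left_commute)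
    have AA: "A1 - s * A2 = (\<Sum>k<A. ibinom m k * \<Lambda> w1 (Y2 (p k) (m + n - int k) w2))"
      unfolding A1_def A2_def s_def p_def
      using zu zv A by (intro M2.jacobi_functional) (simp_all add: T_add2 T_scale2 L M2.Y_zero_left flip: p_def)
    define F where "F k i = \<Lambda> (Y1 (p k) (int i) w1) w2" for k i
    \<comment> \<open>The mode of \<open>u\<close> is the natural number \<open>i\<close>, so the
      iterate side of the Jacobi identity stops at \<open>i\<close>, as
      \<open>sum_taylor_iterate\<close> requires.\<close>
    have UU: "U1 a i - s * U2 i a = (\<Sum>k\<le>i. ibinom (int i) k * F k (a + (i - k)))" for a i
    proof -
      have "U1 a i - s * U2 i a = (\<Sum>k<Suc i. ibinom (int i) k * \<Lambda> (Y1 (p k) (int i + int a - int k) w1) w2)"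
        unfolding U1_def U2_def s_def p_def
      proof (rule M1.jacobi_functional)
        show "Y1 v (int a + int q) w1 = 0" if "q \<ge> K" for q using C2'[of "a + q"] that by simp
        show "Y1 u (int i + int q) w1 = 0" if "q \<ge> K" for q using C1'[of "i + q"] that by simp
        show "s1 (ibinom (int i) k) (Y1 (opV V u (l + int k) v) (int i + int a - int k) w1) = 0" if "k \<ge> Suc i" for k
          using ibinom_of_nat_eq_0[of i k] that by (simp del: of_int_of_nat_eq)
      qed (simp_all add: T_add1 T_scale1 L)
      also have "\<dots> = (\<Sum>k\<le>i. ibinom (int i) k * F k (a + (i - k)))"
        unfolding lessThan_Suc_atMost
      proof (intro sum.cong refl)
        fix k assume "k \<in> {..i}"
        then have "int i + int a - int k = int (a + (i - k))" by auto
        then show "ibinom (int i) k * \<Lambda> (Y1 (p k) (int i + int a - int k) w1) w2 = ibinom (int i) k * F k (a + (i - k))"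
          unfolding F_def by (simp only:)
      qed
      finally show ?thesis .
    qed
    have WW: "(\<Sum>a<K. \<Sum>i<K. taylor z n a * taylor z m i * U1 a i) - s * (\<Sum>a<K. \<Sum>i<K. taylor z n a * taylor z m i * U2 i a) =
      (\<Sum>k<A. ibinom m k * (\<Sum>i<B. taylor z (m + n - int k) i * F k i))"
    proof -
      have "(\<Sum>a<K. \<Sum>i<K. taylor z n a * taylor z m i * U1 a i) - s * (\<Sum>a<K. \<Sum>i<K. taylor z n a * taylor z m i * U2 i a) =
        (\<Sum>a<K. \<Sum>i<K. taylor z n a * taylor z m i * (U1 a i - s * U2 i a))"
        by (simp add: sum_distrib_left sum_subtractf right_diff_distrib mult_ac)
      also have "\<dots> = (\<Sum>k<A. ibinom m k * (\<Sum>i<B. taylor z (m + n - int k) i * F k i))"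
        unfolding UU using A B
        by (intro sum_taylor_iterate z AB) (auto simp: F_def M1.Y_zero_left T_zero1[OF L])
      finally show ?thesis .
    qed
    have R: "act (p k) 0 (m + n - int k) \<Lambda> w1 w2 =
      \<Lambda> w1 (Y2 (p k) (m + n - int k) w2) + (\<Sum>i<B. taylor z (m + n - int k) i * F k i)" for k
      unfolding F_def using B by (intro act_0_finite L)
    have "(\<Sum>k<K. ibinom m k * act (p k) 0 (m + n - int k) \<Lambda> w1 w2) =
      (\<Sum>k<A. ibinom m k * act (p k) 0 (m + n - int k) \<Lambda> w1 w2)"
      using AB A by (intro sum_lessThan_extend) (simp_all add: act_zero_left L)
    also have "\<dots> = (A1 - s * A2) + ((\<Sum>a<K. \<Sum>i<K. taylor z n a * taylor z m i * U1 a i) -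
        s * (\<Sum>a<K. \<Sum>i<K. taylor z n a * taylor z m i * U2 i a))"
      unfolding AA WW R by (simp only: distrib_left sum.distrib)
    also have "\<dots> = (A1 + X1 + s * X2 + (\<Sum>a<K. \<Sum>i<K. taylor z n a * taylor z m i * U1 a i)) -
        s * (A2 + X2 + s * X1 + (\<Sum>a<K. \<Sum>i<K. taylor z n a * taylor z m i * U2 i a))"
    proof -
      have "s * (s * X1) = X1" unfolding mult.assoc[symmetric] s by simp
      then show ?thesis by (simp only: distrib_left) simp
    qed
    finally show ?case unfolding S1 S2 U2 s_def[symmetric] p_def[symmetric] by simp
  qed
qed

end

lemma sum_simplex:
  fixes f :: "nat \<Rightarrow> nat \<Rightarrow> nat \<Rightarrow> 'c::comm_monoid_add"
  assumes "\<And>i j k. i \<ge> A \<or> j \<ge> B \<or> k \<ge> C \<Longrightarrow> f i j k = 0" and "A + B + C \<le> M"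
  shows "(\<Sum>c<M. \<Sum>(i, j, k)\<in>simplex c. f i j k) = (\<Sum>j<B. \<Sum>k<C. \<Sum>i<A. f i j k)"
proof -
  have "(\<Sum>c<M. \<Sum>(i, j, k)\<in>simplex c. f i j k) = (\<Sum>(c, i, j, k)\<in>(SIGMA c:{..<M}. simplex c). f i j k)"
    by (subst sum.Sigma) (auto simp: finite_simplex split_beta)
  also have "\<dots> = (\<Sum>(j, k, i)\<in>{(j, k, i). i + j + k < M}. f i j k)"
    by (rule sum.reindex_bij_witness[of _ "\<lambda>(j, k, i). (i + j + k, i, j, k)" "\<lambda>(c, i, j, k). (j, k, i)"])
      (auto simp: simplex_def)
  also have "\<dots> = (\<Sum>(j, k, i)\<in>{..<B} \<times> {..<C} \<times> {..<A}. f i j k)"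
  proof (rule sum.mono_neutral_right)
    have "{(j, k, i). i + j + k < M} \<subseteq> {..<M} \<times> {..<M} \<times> {..<M}" by auto
    then show "finite {(j, k, i). i + j + k < M}" by (rule finite_subset) simp
    show "\<forall>x\<in>{(j, k, i). i + j + k < M} - {..<B} \<times> {..<C} \<times> {..<A}. (case x of (j, k, i) \<Rightarrow> f i j k) = 0"
      using assms(1) by (auto simp flip: not_le)
  qed (use assms(2) in auto)
  finally show ?thesis by (simp add: sum.cartesian_product)
qed

lemma sum_swap_nested:
  fixes c :: "'i \<Rightarrow> 'c::comm_semiring_0"
  shows "(\<Sum>i\<in>A. c i * (\<Sum>j\<in>B. \<Sum>k\<in>C. d j k * f i j k)) = (\<Sum>j\<in>B. \<Sum>k\<in>C. d j k * (\<Sum>i\<in>A. c i * f i j k))"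
proof -
  have "(\<Sum>i\<in>A. c i * (\<Sum>j\<in>B. \<Sum>k\<in>C. d j k * f i j k)) = (\<Sum>i\<in>A. \<Sum>j\<in>B. \<Sum>k\<in>C. d j k * (c i * f i j k))"
    by (simp only: sum_distrib_left mult.left_commute[of "c i" for i])
  also have "\<dots> = (\<Sum>j\<in>B. \<Sum>i\<in>A. \<Sum>k\<in>C. d j k * (c i * f i j k))"
    by (rule sum.swap)
  also have "\<dots> = (\<Sum>j\<in>B. \<Sum>k\<in>C. \<Sum>i\<in>A. d j k * (c i * f i j k))"
    by (rule sum.cong[OF refl]) (rule sum.swap)
  finally show ?thesis by (simp only: sum_distrib_left)
qed

section \<open>The Jacobi identity for \<open>Y_prime\<close> on homogeneous vectors\<close>

context P_z
begin

definition compatible :: "('a \<Rightarrow> 'b \<Rightarrow> complex) \<Rightarrow> bool" where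
  "compatible \<Lambda> \<longleftrightarrow> \<Lambda> \<in> T \<and> (\<forall>v. bounded_at_infinity v \<Lambda>)"

lemma compatible_iff: "\<Lambda> \<in> T \<Longrightarrow> compatible \<Lambda> \<longleftrightarrow> P_compatible V Y1 Y2 z \<Lambda>"
  by (simp add: compatible_def P_compatible_iff)

lemma compatible_mem_T: "compatible \<Lambda> \<Longrightarrow> \<Lambda> \<in> T"
  by (simp add: compatible_def)

lemma act_sum: "(\<And>i. i \<in> A \<Longrightarrow> f i \<in> T) \<Longrightarrow> act v l m (\<Sum>i\<in>A. f i) = (\<Sum>i\<in>A. act v l m (f i))"
proof (induction A rule: infinite_finite_induct)
  case (insert i A)
  have "act v l m (f i + sum f A) = act v l m (f i) + act v l m (sum f A)"
    using insert.prems by (intro act_add F.subspace_sum subspace_T) auto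
  moreover have "act v l m (sum f A) = (\<Sum>i\<in>A. act v l m (f i))"
    using insert.IH insert.prems by blast
  ultimately show ?case by (simp only: sum.insert[OF insert.hyps])
qed (simp_all add: rational_action_def fun_eq_iff)

lemma act_sum_left:
  assumes L: "\<Lambda> \<in> T"
  shows "act (\<Sum>i\<in>A. f i) l m \<Lambda> = (\<Sum>i\<in>A. act (f i) l m \<Lambda>)"
  by (induction A rule: infinite_finite_induct) (simp_all add: act_zero_left act_add_left L)

lemma subspace_compatible: "F.subspace {\<Lambda>. compatible \<Lambda>}"
  unfolding F.subspace_def mem_Collect_eq
proof (intro conjI allI ballI)
  have "act v l m 0 = 0" for v l m by (simp add: rational_action_def fun_eq_iff)
  then show "compatible 0"
    by (simp add: compatible_def bounded_at_infinity_def F.subspace_0 subspace_T)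
next
  fix \<Lambda> M assume "\<Lambda> \<in> {\<Lambda>. compatible \<Lambda>}" "M \<in> {\<Lambda>. compatible \<Lambda>}"
  then have T: "\<Lambda> \<in> T" "M \<in> T" and B: "\<And>v. bounded_at_infinity v \<Lambda>" "\<And>v. bounded_at_infinity v M"
    by (simp_all add: compatible_def)
  have "bounded_at_infinity v (\<Lambda> + M)" for v
  proof -
    obtain N N' where "\<And>l m. l + m \<le> N \<Longrightarrow> act v l m \<Lambda> = 0" "\<And>l m. l + m \<le> N' \<Longrightarrow> act v l m M = 0"
      using B unfolding bounded_at_infinity_def by blast
    then have "\<forall>l m. l + m \<le> min N N' \<longrightarrow> act v l m (\<Lambda> + M) = 0"
      by (simp add: act_add T)
    then show ?thesis unfolding bounded_at_infinity_def by blast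
  qed
  then show "compatible (\<Lambda> + M)" using T by (simp add: compatible_def F.subspace_add subspace_T)
next
  fix c \<Lambda> assume "\<Lambda> \<in> {\<Lambda>. compatible \<Lambda>}"
  then have T: "\<Lambda> \<in> T" and B: "\<And>v. bounded_at_infinity v \<Lambda>" by (simp_all add: compatible_def)
  have "bounded_at_infinity v (scale_form c \<Lambda>)" for v
  proof -
    obtain N where "\<And>l m. l + m \<le> N \<Longrightarrow> act v l m \<Lambda> = 0"
      using B unfolding bounded_at_infinity_def by blast
    then have "\<forall>l m. l + m \<le> N \<longrightarrow> act v l m (scale_form c \<Lambda>) = 0"
      by (simp add: act_scale T)
    then show ?thesis unfolding bounded_at_infinity_def by blast
  qed
  then show "compatible (scale_form c \<Lambda>)" using T by (simp add: compatible_def F.subspace_scale subspace_T)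
qed

text \<open>\<open>Y'\<close> is a finite sum of actions with \<open>l = 0\<close>, the case covered
  by \<open>act_bounded_at_infinity\<close>.\<close>

lemma compatible_Y': "compatible \<Lambda> \<Longrightarrow> compatible (Y' v n \<Lambda>)"
proof -
  assume c: "compatible \<Lambda>"
  then have "compatible (act u 0 m \<Lambda>)" for u m
    by (simp add: compatible_def act_bounded_at_infinity act_mem_T)
  then have "Y' v n \<Lambda> \<in> {\<Lambda>. compatible \<Lambda>}"
    unfolding Y'_eq_tau tau_act_support[OF compatible_mem_T[OF c]]
    by (intro F.subspace_sum subspace_compatible) simp
  then show ?thesis by simp
qed

lemma Y'_mem_T: "\<Lambda> \<in> T \<Longrightarrow> Y' v n \<Lambda> \<in> T"
  unfolding Y'_eq_tau by (rule tau_mem_T)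

lemma Y'_truncation: "compatible \<Lambda> \<Longrightarrow> \<exists>N. \<forall>n\<ge>N. Y' v n \<Lambda> = 0"
  using compatible_iff compatible_mem_T unfolding P_compatible_def by blast

lemma Y'_homogeneous:
  assumes "\<Lambda> \<in> T" and "v \<in> wt a" and "\<And>j. j \<ge> J \<Longrightarrow> (L 1 ^^ j) v = 0"
  shows "Y' v m \<Lambda> = (\<Sum>j<J. scale_form ((-1) powi a / fact j) (act ((L 1 ^^ j) v) 0 (2 * a - int j - m - 2) \<Lambda>))"
  unfolding Y'_eq_tau by (rule tau_homogeneous[OF assms])

lemma Y'_Y'_homogeneous:
  assumes "\<Lambda> \<in> T" and "u \<in> wt a" "\<And>j. j \<ge> J \<Longrightarrow> (L 1 ^^ j) u = 0"
    and "v \<in> wt b" "\<And>j. j \<ge> J' \<Longrightarrow> (L 1 ^^ j) v = 0"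
  shows "Y' u m (Y' v n \<Lambda>) w1 w2 = (\<Sum>j<J. \<Sum>k<J'. (-1) powi a * (-1) powi b / (fact j * fact k) *
    act ((L 1 ^^ j) u) 0 (2 * a - int j - m - 2) (act ((L 1 ^^ k) v) 0 (2 * b - int k - n - 2) \<Lambda>) w1 w2)"
proof -
  have "Y' u m (Y' v n \<Lambda>) =
    (\<Sum>j<J. scale_form ((-1) powi a / fact j) (act ((L 1 ^^ j) u) 0 (2 * a - int j - m - 2) (Y' v n \<Lambda>)))"
    by (rule Y'_homogeneous[OF Y'_mem_T[OF assms(1)] assms(2,3)])
  also have "\<dots> = (\<Sum>j<J. scale_form ((-1) powi a / fact j) (\<Sum>k<J'. scale_form ((-1) powi b / fact k)
      (act ((L 1 ^^ j) u) 0 (2 * a - int j - m - 2) (act ((L 1 ^^ k) v) 0 (2 * b - int k - n - 2) \<Lambda>))))"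
  proof -
    have Y: "Y' v n \<Lambda> = (\<Sum>k<J'. scale_form ((-1) powi b / fact k) (act ((L 1 ^^ k) v) 0 (2 * b - int k - n - 2) \<Lambda>))"
      by (rule Y'_homogeneous[OF assms(1,4,5)])
    have "act x 0 k (Y' v n \<Lambda>) = (\<Sum>k'<J'. scale_form ((-1) powi b / fact k')
      (act x 0 k (act ((L 1 ^^ k') v) 0 (2 * b - int k' - n - 2) \<Lambda>)))" for x k
      unfolding Y by (subst act_sum) (simp_all add: act_scale act_mem_T assms(1) F.subspace_scale subspace_T)
    then show ?thesis by (simp only:)
  qed
  finally show ?thesis
    by (simp add: sum_fun_apply2 scale_form_def sum_distrib_left mult_ac)
qed

text \<open>
  With \<open>y\<^sub>i = x\<^sub>i\<^bsup>-1\<^esup>\<close> one has \<open>(x\<^sub>1 - x\<^sub>2)\<^sup>l = (-1)\<^sup>l (y\<^sub>1 - y\<^sub>2)\<^sup>l (y\<^sub>1y\<^sub>2)\<^bsup>-l\<^esup>\<close>, and the two regions of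
  expansion are interchanged.
\<close>

lemma Y'_jacobi_homogeneous:
  assumes c: "compatible \<Lambda>" and u: "u \<in> wt a" and v: "v \<in> wt b"
  shows "\<forall>\<^sub>F K in sequentially.
    (\<Sum>i<K. (-1) ^ i * ibinom l i * Y' u (m + l - int i) (Y' v (n + int i) \<Lambda>) w1 w2) -
    (-1) powi l * (\<Sum>i<K. (-1) ^ i * ibinom l i * Y' v (n + l - int i) (Y' u (m + int i) \<Lambda>) w1 w2) =
    (\<Sum>i<K. ibinom m i * Y' (opV V u (l + int i) v) (m + n - int i) \<Lambda> w1 w2)"
proof -
  have LT: "\<Lambda> \<in> T" and B: "\<And>v. bounded_at_infinity v \<Lambda>" using c by (simp_all add: compatible_def)
  obtain J1 where J1: "\<And>j. j \<ge> J1 \<Longrightarrow> (L 1 ^^ j) u = 0" using L1_nilpotent[OF u] by blast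
  obtain J2 where J2: "\<And>j. j \<ge> J2 \<Longrightarrow> (L 1 ^^ j) v = 0" using L1_nilpotent[OF v] by blast
  \<comment> \<open>With these exponents the mode \<open>m + l - i\<close> of \<open>u\<close>
    corresponds to the power \<open>M j + i\<close>, and \<open>m + i\<close> to
    \<open>M j + l - i\<close>. This exchanges the two products in
    \<open>opposite_jacobi\<close>.\<close>
  define M where "M j = 2 * a - int j - l - m - 2" for j
  define N where "N k = 2 * b - int k - l - n - 2" for k
  \<comment> \<open>\<open>a + b - l - 1\<close> is the weight of \<open>opV V u l v\<close>;
    \<open>Q\<close> and \<open>\<sigma>\<close> are the exponent and the sign that
    \<open>Y'_homogeneous\<close> attaches to that vector.\<close>
  define Q where "Q = 2 * (a + b - l - 1) - m - n - 2"
  define \<phi> where "\<phi> k x = act x 0 k \<Lambda> w1 w2" for k x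
  define \<psi> where "\<psi> i j k = ibinom (M j) i / (fact j * fact k) *
      \<phi> (Q - int (i + j + k)) (opV V ((L 1 ^^ j) u) (l + int i) ((L 1 ^^ k) v))" for i j k
  define \<sigma> where "\<sigma> = (-1 :: complex) powi (a + b - l - 1)"
  define s where "s = (-1 :: complex) powi l"
  define e where "e = (-1 :: complex) powi a * (-1) powi b"
  have \<sigma>: "\<sigma> = - (s * e)"
  proof -
    have "(-1 :: complex) powi (a + b - l - 1) = (-1) powi (a + (b + (- l + (- 1))))" by (simp add: algebra_simps)
    also have "\<dots> = (-1) powi a * ((-1) powi b * ((-1) powi (- l) * (-1) powi (- 1)))"
    proof -
      have "(-1 :: complex) powi (x + y) = (-1) powi x * (-1) powi y" for x y
        by (simp add: power_int_add)
      then show ?thesis by (simp only:)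
    qed
    finally show ?thesis by (simp add: \<sigma>_def s_def e_def power_int_minus_one_minus)
  qed
  have s: "s * s = 1" by (simp add: s_def flip: power_int_add mult_2)
  have \<phi>_sum: "\<phi> k (\<Sum>i\<in>A. f i) = (\<Sum>i\<in>A. \<phi> k (f i))" for k f and A :: "'x set"
    by (simp add: \<phi>_def act_sum_left[OF LT] sum_fun_apply2)
  have \<phi>_scale: "\<phi> k (sV r x) = r * \<phi> k x" for k r x
    by (simp add: \<phi>_def act_scale_left[OF LT] scale_form_def)
  have \<phi>_0: "\<phi> k 0 = 0" for k by (simp add: \<phi>_def act_zero_left[OF LT])
  obtain A where A: "\<And>i. i \<ge> A \<Longrightarrow> opV V u (l + int i) v = 0"
    using V.Y_truncation_nat[of v u l] by auto
  have "\<exists>J. \<forall>i. \<forall>j\<ge>J. (L 1 ^^ j) (opV V u (l + int i) v) = 0"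
  proof -
    have "\<forall>\<^sub>F J in sequentially. \<forall>i. \<forall>j\<ge>J. (L 1 ^^ j) (opV V u (l + int i) v) = 0"
    proof (rule eventually_uniform_bound[of _ A])
      fix i
      show "\<forall>\<^sub>F J in sequentially. \<forall>j\<ge>J. (L 1 ^^ j) (opV V u (l + int i) v) = 0"
        using L1_nilpotent[OF op_mem_wt[OF u v]] unfolding eventually_sequentially by (meson order_trans)
    qed (simp add: A L1_pow_linear)
    then show ?thesis by (auto simp: eventually_sequentially)
  qed
  then obtain J3 where J3: "\<And>i j. j \<ge> J3 \<Longrightarrow> (L 1 ^^ j) (opV V u (l + int i) v) = 0" by blast
  have zero: "\<forall>\<^sub>F K in sequentially. \<forall>j\<in>{..<J1}. \<forall>k\<in>{..<J2}. \<forall>i\<ge>K. opV V ((L 1 ^^ j) u) (l + int i) ((L 1 ^^ k) v) = 0"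
    by (intro eventually_ball_finite finite_lessThan ballI op_eventually_zero)
  have jac: "\<forall>\<^sub>F K in sequentially. \<forall>j\<in>{..<J1}. \<forall>k\<in>{..<J2}.
    (\<Sum>i<K. (-1) ^ i * ibinom l i * act ((L 1 ^^ k) v) 0 (N k + int i) (act ((L 1 ^^ j) u) 0 (M j + l - int i) \<Lambda>) w1 w2) -
    s * (\<Sum>i<K. (-1) ^ i * ibinom l i * act ((L 1 ^^ j) u) 0 (M j + int i) (act ((L 1 ^^ k) v) 0 (N k + l - int i) \<Lambda>) w1 w2) =
    (\<Sum>i<K. ibinom (M j) i * act (opV V ((L 1 ^^ j) u) (l + int i) ((L 1 ^^ k) v)) 0 (M j + N k - int i) \<Lambda> w1 w2)"
    unfolding s_def by (intro eventually_ball_finite finite_lessThan ballI opposite_jacobi[OF LT B B])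
  show ?thesis
    using zero jac eventually_ge_at_top[of A]
  proof eventually_elim
    case (elim K)
    have \<psi>0: "\<psi> i j k = 0" if "i \<ge> K \<or> j \<ge> J1 \<or> k \<ge> J2" for i j k
    proof -
      have "opV V ((L 1 ^^ j) u) (l + int i) ((L 1 ^^ k) v) = 0"
        using elim(1) J1[of j] J2[of k] that
        by (cases "j < J1 \<and> k < J2") (auto simp: V.Y_zero V.Y_zero_left)
      then show ?thesis by (simp add: \<psi>_def \<phi>_0)
    qed
    define R1 where "R1 j k = (\<Sum>i<K. (-1) ^ i * ibinom l i *
      act ((L 1 ^^ j) u) 0 (M j + int i) (act ((L 1 ^^ k) v) 0 (N k + l - int i) \<Lambda>) w1 w2)" for j k
    define R2 where "R2 j k = (\<Sum>i<K. (-1) ^ i * ibinom l i *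
      act ((L 1 ^^ k) v) 0 (N k + int i) (act ((L 1 ^^ j) u) 0 (M j + l - int i) \<Lambda>) w1 w2)" for j k
    have E1: "(\<Sum>i<K. (-1) ^ i * ibinom l i * Y' u (m + l - int i) (Y' v (n + int i) \<Lambda>) w1 w2) =
      (\<Sum>j<J1. \<Sum>k<J2. e / (fact j * fact k) * R1 j k)"
    proof -
      have i: "2 * a - int j - (m + l - int i) - 2 = M j + int i" "2 * b - int k - (n + int i) - 2 = N k + l - int i" for i j k
        by (simp_all add: M_def N_def)
      have yy: "Y' u m (Y' v n \<Lambda>) w1 w2 = (\<Sum>j<J1. \<Sum>k<J2. (-1) powi a * (-1) powi b / (fact j * fact k) *
        act ((L 1 ^^ j) u) 0 (2 * a - int j - m - 2) (act ((L 1 ^^ k) v) 0 (2 * b - int k - n - 2) \<Lambda>) w1 w2)" for m n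
        by (rule Y'_Y'_homogeneous[OF LT u J1 v J2])
      show ?thesis
        unfolding yy i R1_def e_def[symmetric] by (rule sum_swap_nested)
    qed
    have E2: "(\<Sum>i<K. (-1) ^ i * ibinom l i * Y' v (n + l - int i) (Y' u (m + int i) \<Lambda>) w1 w2) =
      (\<Sum>j<J1. \<Sum>k<J2. e / (fact j * fact k) * R2 j k)"
    proof -
      have i: "2 * b - int k - (n + l - int i) - 2 = N k + int i" "2 * a - int j - (m + int i) - 2 = M j + l - int i" for i j k
        by (simp_all add: M_def N_def)
      have yy: "Y' v m (Y' u n \<Lambda>) w1 w2 = (\<Sum>k<J2. \<Sum>j<J1. (-1) powi b * (-1) powi a / (fact k * fact j) *
        act ((L 1 ^^ k) v) 0 (2 * b - int k - m - 2) (act ((L 1 ^^ j) u) 0 (2 * a - int j - n - 2) \<Lambda>) w1 w2)" for m n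
        by (rule Y'_Y'_homogeneous[OF LT v J2 u J1])
      have "(\<Sum>i<K. (-1) ^ i * ibinom l i * Y' v (n + l - int i) (Y' u (m + int i) \<Lambda>) w1 w2) =
        (\<Sum>k<J2. \<Sum>j<J1. e / (fact j * fact k) * R2 j k)"
        unfolding yy i R2_def e_def mult.commute[of "(-1) powi b" "(-1) powi a"] mult.commute[of "fact k" "fact j" for j k]
        by (rule sum_swap_nested)
      also have "\<dots> = (\<Sum>j<J1. \<Sum>k<J2. e / (fact j * fact k) * R2 j k)" by (rule sum.swap)
      finally show ?thesis .
    qed
    \<comment> \<open>\<open>opposite_jacobi\<close> has the products in the other order; the factor
      \<open>- s\<close> exchanges them because \<open>s * s = 1\<close>, and together with
      \<open>e\<close> it gives \<open>\<sigma>\<close>.\<close>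
    have "R1 j k - s * R2 j k = - s * (\<Sum>i<K. ibinom (M j) i * \<phi> (Q - int (i + j + k)) (opV V ((L 1 ^^ j) u) (l + int i) ((L 1 ^^ k) v)))"
      if "j < J1" "k < J2" for j k
    proof -
      have q: "M j + N k - int i = Q - int (i + j + k)" for i by (simp add: M_def N_def Q_def)
      have "R2 j k - s * R1 j k = (\<Sum>i<K. ibinom (M j) i * \<phi> (Q - int (i + j + k)) (opV V ((L 1 ^^ j) u) (l + int i) ((L 1 ^^ k) v)))"
        using elim(2) that unfolding R1_def R2_def \<phi>_def q[symmetric] by blast
      moreover have "R1 j k - s * R2 j k = - s * (R2 j k - s * R1 j k)"
        using s by (simp add: right_diff_distrib mult.assoc[symmetric])
      ultimately show ?thesis by (simp only:)
    qed
    then have "e / (fact j * fact k) * (R1 j k - s * R2 j k) = \<sigma> * (\<Sum>i<K. \<psi> i j k)" if "j < J1" "k < J2" for j k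
      using that by (simp add: \<sigma> \<psi>_def sum_distrib_left sum_negf[symmetric] mult_ac)
    then have "(\<Sum>j<J1. \<Sum>k<J2. e / (fact j * fact k) * (R1 j k - s * R2 j k)) = \<sigma> * (\<Sum>j<J1. \<Sum>k<J2. \<Sum>i<K. \<psi> i j k)"
      unfolding sum_distrib_left by (intro sum.cong refl) simp
    \<comment> \<open>Both sides are sorted by the total degree \<open>c\<close>; including
      \<open>J3\<close> makes the same bound valid for the iterate side.\<close>
    also have "(\<Sum>j<J1. \<Sum>k<J2. \<Sum>i<K. \<psi> i j k) = (\<Sum>c<K + J1 + J2 + J3. \<Sum>(i, j, k)\<in>simplex c. \<psi> i j k)"
      using \<psi>0 by (intro sum_simplex[symmetric]) auto
    also have "\<sigma> * \<dots> = (\<Sum>i<K. ibinom m i * Y' (opV V u (l + int i) v) (m + n - int i) \<Lambda> w1 w2)"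
    proof -
      define h where "h i j = \<sigma> * ((-1) ^ i * ibinom m i / fact j * \<phi> (Q - int (i + j)) ((L 1 ^^ j) (opV V u (l + int i) v)))" for i j
      have h0: "h i j = 0" if "i \<ge> K \<or> j \<ge> J3" for i j
        using that A[of i] J3[of j i] elim(3) by (auto simp: h_def L1_pow_linear \<phi>_0)
      have "(\<Sum>i<K. ibinom m i * Y' (opV V u (l + int i) v) (m + n - int i) \<Lambda> w1 w2) = (\<Sum>i<K. \<Sum>j<J3. h i j)"
      proof (rule sum.cong[OF refl])
        fix i
        have q: "2 * (a + b - (l + int i) - 1) - int j - (m + n - int i) - 2 = Q - int (i + j)" for j
          by (simp add: Q_def)
        have \<sigma>i: "(-1) powi (a + b - (l + int i) - 1) = \<sigma> * (-1) ^ i"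
        proof -
          have i: "a + b - (l + int i) - 1 = a + b - l - 1 - int i" by simp
          show ?thesis
            unfolding i using power_int_add[of "-1 :: complex" "a + b - l - 1" "- int i"]
            by (simp add: \<sigma>_def power_int_minus_one_minus)
        qed
        have "Y' (opV V u (l + int i) v) (m + n - int i) \<Lambda> w1 w2 =
          (\<Sum>j<J3. \<sigma> * (-1) ^ i / fact j * \<phi> (Q - int (i + j)) ((L 1 ^^ j) (opV V u (l + int i) v)))"
          by (subst Y'_homogeneous[OF LT op_mem_wt[OF u v]], rule J3, assumption)
            (simp only: q \<sigma>i sum_fun_apply2 \<phi>_def scale_form_def)
        then show "ibinom m i * Y' (opV V u (l + int i) v) (m + n - int i) \<Lambda> w1 w2 = (\<Sum>j<J3. h i j)"
          by (simp add: h_def sum_distrib_left mult_ac)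
      qed
      also have "\<dots> = (\<Sum>c<K + J1 + J2 + J3. \<Sum>i\<le>c. h i (c - i))"
        using h0 by (intro sum_convolution[symmetric]) auto
      \<comment> \<open>In degree \<open>c\<close> all values are taken by the same linear
        functional \<open>\<phi> (Q - int c)\<close>, so \<open>exp_L1_iterate\<close> can be
        applied inside it.\<close>
      also have "\<dots> = (\<Sum>c<K + J1 + J2 + J3. \<sigma> * (\<Sum>(i, j, k)\<in>simplex c. \<psi> i j k))"
      proof (rule sum.cong[OF refl])
        fix c
        have "(\<Sum>i\<le>c. h i (c - i)) = \<sigma> * \<phi> (Q - int c) (\<Sum>i\<le>c. sV ((-1) ^ i * ibinom m i / fact (c - i)) ((L 1 ^^ (c - i)) (opV V u (l + int i) v)))"
          unfolding \<phi>_sum \<phi>_scale sum_distrib_left h_def by (intro sum.cong refl) simp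
        also have "\<dots> = \<sigma> * (\<Sum>(i, j, k)\<in>simplex c. \<psi> i j k)"
        proof -
          have "\<phi> (Q - int c) (case x of (i, j, k) \<Rightarrow> sV (ibinom (2 * a - int j - l - m - 2) i / (fact j * fact k))
              (opV V ((L 1 ^^ j) u) (l + int i) ((L 1 ^^ k) v))) = (case x of (i, j, k) \<Rightarrow> \<psi> i j k)" if "x \<in> simplex c" for x
          proof -
            obtain i j k where x: "x = (i, j, k)" by (rule prod_cases3)
            have c: "c = i + j + k" using that by (simp add: x simplex_def)
            show ?thesis unfolding x split \<phi>_scale \<psi>_def M_def c ..
          qed
          then show ?thesis unfolding exp_L1_iterate[OF u] \<phi>_sum by (intro arg_cong[where f = "(*) \<sigma>"] sum.cong refl)
        qed
        finally show "(\<Sum>i\<le>c. h i (c - i)) = \<sigma> * (\<Sum>(i, j, k)\<in>simplex c. \<psi> i j k)" .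
      qed
      finally show ?thesis by (simp only: sum_distrib_left)
    qed
    finally show ?case
      unfolding E1 E2 s_def[symmetric]
      by (simp add: right_diff_distrib sum_subtractf sum_distrib_left mult_ac)
  qed
qed

end

subsection \<open>Compatible modules and gradings\<close>

text \<open>A finite spanning set of \<open>B\<close> need not meet \<open>A\<close>; it does bound
  the size of an independent subset of \<open>A\<close>, hence of a basis of
  \<open>A\<close>.\<close>

lemma finite_dim_subspace:
  assumes "vector_space s" and "finite_dim s B" and "module.subspace s A" and "A \<subseteq> B"
  shows "finite_dim s A"
proof -
  interpret vector_space s by fact
  obtain C where C: "finite C" "span C = B" using assms(2) unfolding finite_dim_def by blast
  obtain D where D: "D \<subseteq> A" "independent D" "A \<subseteq> span D" by (rule maximal_independent_subset)
  have "finite D" using independent_span_bound[OF C(1) D(2)] D(1) assms(4) C(2) by blast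
  moreover have "span D = A" using D assms(3) by (simp add: span_minimal subset_antisym)
  ultimately show ?thesis unfolding finite_dim_def by blast
qed

lemma finite_dim_sums:
  assumes "vector_space s" and "finite_dim s A" and "finite_dim s B"
  shows "finite_dim s {x + y | x y. x \<in> A \<and> y \<in> B}"
proof -
  interpret vector_space s by fact
  obtain C D where "finite C" "span C = A" "finite D" "span D = B"
    using assms unfolding finite_dim_def by blast
  then show ?thesis unfolding finite_dim_def using span_Un[of C D] finite_Un by blast
qed

lemma (in vector_space) span_Union_decomposition:
  assumes E: "\<And>k. subspace (E k)" and x: "x \<in> span (\<Union>k. E k)"
  shows "\<exists>F e. finite F \<and> (\<forall>k. e k \<in> E k) \<and> x = (\<Sum>k\<in>F. e k)"
  using x
proof (induction rule: span_induct_alt)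
  case base
  show ?case using subspace_0[OF E] by (intro exI[of _ "{}"] exI[of _ "\<lambda>k. 0"]) simp
next
  case (step c y x)
  then obtain F e where F: "finite F" "\<And>k. e k \<in> E k" "x = (\<Sum>k\<in>F. e k)" by blast
  obtain h where h: "y \<in> E h" using step by blast
  define e0 where "e0 k = (if k \<in> F then e k else 0)" for k
  define e' where "e' k = (if k = h then scale c y else 0) + e0 k" for k
  have "scale c y + x = (\<Sum>k\<in>insert h F. e' k)"
    using F(1,3) by (simp add: e'_def e0_def sum.distrib insert_absorb sum.inter_restrict[symmetric] Int_absorb1 subset_insertI)
  moreover have "e' k \<in> E k" for k
    using F(2) h subspace_0[OF E] by (simp add: e'_def e0_def subspace_add[OF E] subspace_scale[OF E])
  ultimately show ?case using F(1) by (intro exI[of _ "insert h F"] exI[of _ e']) simp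
qed

text \<open>Applying \<open>L - h\<close> removes the component at \<open>h\<close> and scales the
  others by the nonzero numbers \<open>k - h\<close>. For \<open>U = {0}\<close> this is
  independence of eigenspaces, for stable \<open>U\<close> it says that \<open>U\<close> is graded.
  Linearity is assumed on \<open>T\<close> only, because for \<open>Y'\<close> it is available only
  on bilinear forms.\<close>

lemma (in vector_space) eigenvector_components_mem:
  assumes T: "subspace T" and L: "\<And>x y. x \<in> T \<Longrightarrow> y \<in> T \<Longrightarrow> L (x + y) = L x + L y"
      "\<And>c x. x \<in> T \<Longrightarrow> L (scale c x) = scale c (L x)"
    and U: "subspace U" "\<And>x. x \<in> U \<Longrightarrow> L x \<in> U"
  shows "finite F \<Longrightarrow> (\<And>k. k \<in> F \<Longrightarrow> e k \<in> T \<and> L (e k) = scale k (e k)) \<Longrightarrow> (\<Sum>k\<in>F. e k) \<in> U \<Longrightarrow> k \<in> F \<Longrightarrow> e k \<in> U"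
proof (induction F arbitrary: e k rule: finite_induct)
  case (insert h F)
  have L_sum: "L (\<Sum>k\<in>A. e k) = (\<Sum>k\<in>A. L (e k))" if "A \<subseteq> insert h F" for A
    using finite_subset[OF that] insert.hyps(1) that
  proof (induction A rule: infinite_finite_induct)
    case empty
    show ?case using L(2)[of 0 0] subspace_0[OF T] by simp
  next
    case (insert a A)
    have "e k \<in> T" if "k \<in> insert a A" for k using insert.prems that \<open>\<And>k. k \<in> insert h F \<Longrightarrow> e k \<in> T \<and> _ k\<close> by blast
    then have "e a \<in> T" "(\<Sum>k\<in>A. e k) \<in> T" by (auto intro: subspace_sum[OF T])
    then show ?case using insert by (simp add: L(1))
  qed simp
  have "L (\<Sum>k\<in>insert h F. e k) - scale h (\<Sum>k\<in>insert h F. e k) \<in> U"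
    using U insert.prems(2) by (simp only: subspace_diff subspace_scale)
  moreover have "L (\<Sum>k\<in>insert h F. e k) - scale h (\<Sum>k\<in>insert h F. e k) = (\<Sum>k\<in>F. scale (k - h) (e k))"
  proof -
    have "L (\<Sum>k\<in>insert h F. e k) - scale h (\<Sum>k\<in>insert h F. e k) = (\<Sum>k\<in>insert h F. scale (k - h) (e k))"
      unfolding L_sum[OF subset_refl] scale_sum_right sum_subtractf[symmetric]
      using insert.prems(1) by (intro sum.cong refl) (simp add: scale_left_diff_distrib)
    then show ?thesis using insert.hyps by simp
  qed
  ultimately have "(\<Sum>k\<in>F. scale (k - h) (e k)) \<in> U" by simp
  then have "scale (k - h) (e k) \<in> U" if "k \<in> F" for k
    using that insert.prems(1) by (intro insert.IH[of "\<lambda>k. scale (k - h) (e k)"])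
      (auto simp: L(2) scale_left_commute subspace_scale[OF T])
  then have F: "e k \<in> U" if "k \<in> F" for k
  proof -
    have "k \<noteq> h" using that insert.hyps by blast
    then have "e k = scale (inverse (k - h)) (scale (k - h) (e k))" by simp
    also have "\<dots> \<in> U"
      using \<open>\<And>k. k \<in> F \<Longrightarrow> scale (k - h) (e k) \<in> U\<close>[OF that] by (rule subspace_scale[OF U(1)])
    finally show ?thesis .
  qed
  have "e h = (\<Sum>k\<in>insert h F. e k) - (\<Sum>k\<in>F. e k)" using insert.hyps by simp
  also have "\<dots> \<in> U" by (rule subspace_diff[OF U(1) insert.prems(2) subspace_sum[OF U(1)]]) (rule F)
  finally show ?case using F insert.prems(3) by blast
qed simp

section \<open>Module axioms on compatible functionals\<close>

context P_z
begin

lemma Y'_add_left: "\<Lambda> \<in> T \<Longrightarrow> Y' (u + v) n \<Lambda> = Y' u n \<Lambda> + Y' v n \<Lambda>"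
  and Y'_scale_left: "\<Lambda> \<in> T \<Longrightarrow> Y' (sV c v) n \<Lambda> = scale_form c (Y' v n \<Lambda>)"
  and Y'_add: "\<Lambda> \<in> T \<Longrightarrow> M \<in> T \<Longrightarrow> Y' v n (\<Lambda> + M) = Y' v n \<Lambda> + Y' v n M"
  and Y'_scale: "\<Lambda> \<in> T \<Longrightarrow> Y' v n (scale_form c \<Lambda>) = scale_form c (Y' v n \<Lambda>)"
  unfolding Y'_eq_tau by (rule tau_add_left tau_scale_left tau_add tau_scale; assumption)+

lemma Y'_zero: "Y' v n 0 = 0"
  using Y'_scale[of 0 v n 0] by (simp add: F.subspace_0 subspace_T)

text \<open>L(1) kills the vacuum, so only \<open>j = 0\<close> remains. The vacuum has no
  nonnegative modes, so the first factor contributes nothing and the second only its mode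
  -1.\<close>

lemma Y'_vacuum:
  assumes "\<Lambda> \<in> T"
  shows "Y' (vacuum V) n \<Lambda> = (if n = -1 then \<Lambda> else 0)"
proof (intro ext)
  fix w1 w2
  have "(L 1 ^^ j) (vacuum V) = 0" if "j \<ge> 1" for j
    using that by (cases j) (simp_all add: funpow_Suc_right L1_vacuum L1_pow_linear del: funpow.simps)
  moreover have "vacuum V \<in> wt 0" using vacuum_mem_wt by simp
  ultimately have "Y' (vacuum V) n \<Lambda> =
    (\<Sum>j<1. scale_form ((-1) powi 0 / fact j) (act ((L 1 ^^ j) (vacuum V)) 0 (2 * 0 - int j - n - 2) \<Lambda>))"
    by (intro Y'_homogeneous[OF assms]) simp_all
  then have "Y' (vacuum V) n \<Lambda> w1 w2 = act (vacuum V) 0 (- n - 2) \<Lambda> w1 w2"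
    by (simp add: scale_form_def)
  also have "\<dots> = \<Lambda> w1 (Y2 (vacuum V) (- n - 2) w2) +
      (\<Sum>i<0. taylor z (- n - 2) i * \<Lambda> (Y1 (vacuum V) (int i) w1) w2)"
    by (rule act_0_finite[OF assms]) (simp add: M1.Y_vacuum)
  also have "\<dots> = (if n = -1 then \<Lambda> else 0) w1 w2"
    by (auto simp: M2.Y_vacuum T_zero2[OF assms])
  finally show "Y' (vacuum V) n \<Lambda> w1 w2 = (if n = -1 then \<Lambda> else 0) w1 w2" .
qed

text \<open>
  Stated with partial sums, so that additivity in \<open>u\<close> and \<open>v\<close> needs no conditions on supports.
\<close>

definition jacobi_holds where
  "jacobi_holds \<Lambda> l m n u v \<longleftrightarrow> (\<forall>w1 w2. \<forall>\<^sub>F K in sequentially.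
    (\<Sum>i<K. (-1) ^ i * ibinom l i * Y' u (m + l - int i) (Y' v (n + int i) \<Lambda>) w1 w2) -
    (-1) powi l * (\<Sum>i<K. (-1) ^ i * ibinom l i * Y' v (n + l - int i) (Y' u (m + int i) \<Lambda>) w1 w2) =
    (\<Sum>i<K. ibinom m i * Y' (opV V u (l + int i) v) (m + n - int i) \<Lambda> w1 w2))"

lemma jacobi_holds_add:
  assumes "\<Lambda> \<in> T"
  shows "jacobi_holds \<Lambda> l m n u v \<Longrightarrow> jacobi_holds \<Lambda> l m n u' v \<Longrightarrow> jacobi_holds \<Lambda> l m n (u + u') v"
    and "jacobi_holds \<Lambda> l m n u v \<Longrightarrow> jacobi_holds \<Lambda> l m n u v' \<Longrightarrow> jacobi_holds \<Lambda> l m n u (v + v')"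
proof -
  assume "jacobi_holds \<Lambda> l m n u v" "jacobi_holds \<Lambda> l m n u' v"
  note J = this[unfolded jacobi_holds_def, rule_format]
  show "jacobi_holds \<Lambda> l m n (u + u') v"
    unfolding jacobi_holds_def
  proof (intro allI)
    fix w1 w2
    show "\<forall>\<^sub>F K in sequentially.
      (\<Sum>i<K. (-1) ^ i * ibinom l i * Y' (u + u') (m + l - int i) (Y' v (n + int i) \<Lambda>) w1 w2) -
      (-1) powi l * (\<Sum>i<K. (-1) ^ i * ibinom l i * Y' v (n + l - int i) (Y' (u + u') (m + int i) \<Lambda>) w1 w2) =
      (\<Sum>i<K. ibinom m i * Y' (opV V (u + u') (l + int i) v) (m + n - int i) \<Lambda> w1 w2)"
      using J(1)[of w1 w2] J(2)[of w1 w2]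
      by eventually_elim
        (simp only: Y'_add_left Y'_add Y'_mem_T assms V.Y_add_left UNIV_I plus_fun_apply distrib_left sum.distrib add_diff_add)
  qed
next
  assume "jacobi_holds \<Lambda> l m n u v" "jacobi_holds \<Lambda> l m n u v'"
  note J = this[unfolded jacobi_holds_def, rule_format]
  show "jacobi_holds \<Lambda> l m n u (v + v')"
    unfolding jacobi_holds_def
  proof (intro allI)
    fix w1 w2
    show "\<forall>\<^sub>F K in sequentially.
      (\<Sum>i<K. (-1) ^ i * ibinom l i * Y' u (m + l - int i) (Y' (v + v') (n + int i) \<Lambda>) w1 w2) -
      (-1) powi l * (\<Sum>i<K. (-1) ^ i * ibinom l i * Y' (v + v') (n + l - int i) (Y' u (m + int i) \<Lambda>) w1 w2) =
      (\<Sum>i<K. ibinom m i * Y' (opV V u (l + int i) (v + v')) (m + n - int i) \<Lambda> w1 w2)"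
      using J(1)[of w1 w2] J(2)[of w1 w2]
      by eventually_elim
        (simp only: Y'_add_left Y'_add Y'_mem_T assms V.Y_add UNIV_I plus_fun_apply distrib_left sum.distrib add_diff_add)
  qed
qed

lemma jacobi_holds_scale:
  assumes "\<Lambda> \<in> T" and "jacobi_holds \<Lambda> l m n u v"
  shows "jacobi_holds \<Lambda> l m n (sV c u) v" and "jacobi_holds \<Lambda> l m n u (sV c v)"
proof -
  note J = assms(2)[unfolded jacobi_holds_def, rule_format]
  have s: "scale_form c x w1 w2 = c * x w1 w2" for c w1 w2 and x :: "'a \<Rightarrow> 'b \<Rightarrow> complex"
    by (simp add: scale_form_def)
  have pull: "(\<Sum>i<K. (a i :: complex) * (c * b i)) = c * (\<Sum>i<K. a i * b i)" for a b and K :: nat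
    by (simp add: sum_distrib_left mult_ac)
  have fin: "c * A - r * (c * B) = c * C" if "A - r * B = C" for A B C r :: complex
    unfolding that[symmetric] by (simp add: algebra_simps)
  show "jacobi_holds \<Lambda> l m n (sV c u) v"
    unfolding jacobi_holds_def
  proof (intro allI)
    fix w1 w2
    show "\<forall>\<^sub>F K in sequentially.
      (\<Sum>i<K. (-1) ^ i * ibinom l i * Y' (sV c u) (m + l - int i) (Y' v (n + int i) \<Lambda>) w1 w2) -
      (-1) powi l * (\<Sum>i<K. (-1) ^ i * ibinom l i * Y' v (n + l - int i) (Y' (sV c u) (m + int i) \<Lambda>) w1 w2) =
      (\<Sum>i<K. ibinom m i * Y' (opV V (sV c u) (l + int i) v) (m + n - int i) \<Lambda> w1 w2)"
      using J[of w1 w2]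
      by eventually_elim
        (simp only: Y'_scale_left Y'_scale Y'_mem_T assms(1) V.Y_scale_left UNIV_I s pull, rule fin)
  qed
  show "jacobi_holds \<Lambda> l m n u (sV c v)"
    unfolding jacobi_holds_def
  proof (intro allI)
    fix w1 w2
    show "\<forall>\<^sub>F K in sequentially.
      (\<Sum>i<K. (-1) ^ i * ibinom l i * Y' u (m + l - int i) (Y' (sV c v) (n + int i) \<Lambda>) w1 w2) -
      (-1) powi l * (\<Sum>i<K. (-1) ^ i * ibinom l i * Y' (sV c v) (n + l - int i) (Y' u (m + int i) \<Lambda>) w1 w2) =
      (\<Sum>i<K. ibinom m i * Y' (opV V u (l + int i) (sV c v)) (m + n - int i) \<Lambda> w1 w2)"
      using J[of w1 w2]
      by eventually_elim
        (simp only: Y'_scale_left Y'_scale Y'_mem_T assms(1) V.Y_scale UNIV_I s pull, rule fin)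
  qed
qed

text \<open>The conjugation formula depends on weights, so homogeneous vectors come first; the
  identity extends by additivity and scaling in one argument at a time.\<close>

lemma compatible_jacobi_holds:
  assumes c: "compatible \<Lambda>"
  shows "jacobi_holds \<Lambda> l m n u v"
proof -
  note LT = compatible_mem_T[OF c]
  have zero: "jacobi_holds \<Lambda> l m n 0 v" "jacobi_holds \<Lambda> l m n u 0" for u v
  proof -
    have "Y' 0 n M = 0" if "M \<in> T" for n M
      using Y'_scale_left[OF that, of 0 0 n] by simp
    then show "jacobi_holds \<Lambda> l m n 0 v" "jacobi_holds \<Lambda> l m n u 0"
      by (simp_all add: jacobi_holds_def Y'_mem_T LT Y'_zero V.Y_zero V.Y_zero_left)
  qed
  have 1: "jacobi_holds \<Lambda> l m n u v" if v: "v \<in> wt b" for u v b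
  proof -
    have "u \<in> V.span (\<Union>n. wt n)" by (simp add: span_wt)
    then show ?thesis
    proof (induction rule: V.span_induct)
      case base
      show ?case unfolding V.subspace_def
        using zero jacobi_holds_add(1)[OF LT] jacobi_holds_scale(1)[OF LT] by blast
    next
      case (step u)
      then obtain a where "u \<in> wt a" by blast
      then show ?case unfolding jacobi_holds_def using Y'_jacobi_homogeneous[OF c _ v] by blast
    qed
  qed
  have "v \<in> V.span (\<Union>n. wt n)" by (simp add: span_wt)
  then show ?thesis
  proof (induction rule: V.span_induct)
    case base
    show ?case unfolding V.subspace_def
      using zero jacobi_holds_add(2)[OF LT] jacobi_holds_scale(2)[OF LT] by blast
  next
    case (step v)
    then show ?case using 1 by blast
  qed
qed

lemma Y'_jacobi:
  assumes c: "compatible \<Lambda>"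
  shows "Sum_any (\<lambda>i::nat. scale_form ((-1) ^ i * ibinom l i) (Y' u (m + l - int i) (Y' v (n + int i) \<Lambda>)))
     - Sum_any (\<lambda>i::nat. scale_form ((-1) powi l * (-1) ^ i * ibinom l i) (Y' v (n + l - int i) (Y' u (m + int i) \<Lambda>)))
     = Sum_any (\<lambda>i::nat. scale_form (ibinom m i) (Y' (opV V u (l + int i) v) (m + n - int i) \<Lambda>))"
    (is "Sum_any ?f - Sum_any ?g = Sum_any ?h")
proof (intro ext)
  fix w1 w2
  note LT = compatible_mem_T[OF c]
  have trunc: "\<exists>K::nat. \<forall>i\<ge>K. Y' v (n + int i) \<Lambda> = 0" for v n
  proof -
    obtain N where "\<forall>n\<ge>N. Y' v n \<Lambda> = 0" using Y'_truncation[OF c] by blast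
    then have "Y' v (n + int i) \<Lambda> = 0" if "i \<ge> nat (N - n)" for i using that by auto
    then show ?thesis by blast
  qed
  obtain K1 where K1: "\<And>i. i \<ge> K1 \<Longrightarrow> Y' v (n + int i) \<Lambda> = 0" using trunc by blast
  obtain K2 where K2: "\<And>i. i \<ge> K2 \<Longrightarrow> Y' u (m + int i) \<Lambda> = 0" using trunc by blast
  obtain K3 where K3: "\<And>i. i \<ge> K3 \<Longrightarrow> opV V u (l + int i) v = 0" using V.Y_truncation_nat[of v u l] by auto
  have Y'0: "Y' 0 k \<Lambda> = 0" for k using Y'_scale_left[OF LT, of 0 0 k] by simp
  have s: "scale_form c x w1 w2 = c * x w1 w2" for c and x :: "'a \<Rightarrow> 'b \<Rightarrow> complex"
    by (simp add: scale_form_def)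
  have "\<forall>\<^sub>F K in sequentially. (Sum_any ?f - Sum_any ?g) w1 w2 = Sum_any ?h w1 w2"
    using compatible_jacobi_holds[OF c, of l m n u v, unfolded jacobi_holds_def, rule_format, of w1 w2]
      eventually_ge_at_top[of K1] eventually_ge_at_top[of K2] eventually_ge_at_top[of K3]
  proof eventually_elim
    case (elim K)
    have "Sum_any ?f w1 w2 = (\<Sum>i<K. ?f i w1 w2)"
      using K1 elim(2) by (intro Sum_any_fun_apply2) (simp add: Y'_zero)
    moreover have "Sum_any ?g w1 w2 = (\<Sum>i<K. ?g i w1 w2)"
      using K2 elim(3) by (intro Sum_any_fun_apply2) (simp add: Y'_zero)
    moreover have "Sum_any ?h w1 w2 = (\<Sum>i<K. ?h i w1 w2)"
      using K3 elim(4) by (intro Sum_any_fun_apply2) (simp add: Y'0)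
    ultimately show ?case
      using elim(1) by (simp add: s sum_distrib_left mult.assoc)
  qed
  then show "(Sum_any ?f - Sum_any ?g) w1 w2 = Sum_any ?h w1 w2" by simp
qed

end

lemma subset_sums:
  fixes A B :: "'a::monoid_add set"
  shows "0 \<in> B \<Longrightarrow> A \<subseteq> {x + y | x y. x \<in> A \<and> y \<in> B}"
    and "0 \<in> A \<Longrightarrow> B \<subseteq> {x + y | x y. x \<in> A \<and> y \<in> B}"
proof -
  show "A \<subseteq> {x + y | x y. x \<in> A \<and> y \<in> B}" if "0 \<in> B"
  proof
    fix x assume "x \<in> A"
    then have "x = x + 0 \<and> x \<in> A \<and> 0 \<in> B" using that by simp
    then show "x \<in> {x + y | x y. x \<in> A \<and> y \<in> B}" by blast
  qed
  show "B \<subseteq> {x + y | x y. x \<in> A \<and> y \<in> B}" if "0 \<in> A"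
  proof
    fix y assume "y \<in> B"
    then have "y = 0 + y \<and> 0 \<in> A \<and> y \<in> B" using that by simp
    then show "y \<in> {x + y | x y. x \<in> A \<and> y \<in> B}" by blast
  qed
qed

context P_z
begin

lemma ibinom_minus_2: "ibinom (- 2) i = (-1) ^ i * of_nat (Suc i)"
  using ibinom_uminus[of 2 i] binomial_symmetric[of i "Suc i"]
  by (simp add: add.commute binomial_gbinomial[symmetric] flip: of_nat_Suc)

text \<open>The Jacobi identity with \<open>l = -2\<close> and \<open>m = 0\<close> for \<open>v\<close> and the vacuum.\<close>

lemma Y'_translation:
  assumes c: "compatible \<Lambda>"
  shows "Y' (L (-1) v) n \<Lambda> = scale_form (- of_int n) (Y' v (n - 1) \<Lambda>)"
proof -
  note LT = compatible_mem_T[OF c]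
  \<comment> \<open>Creation makes the left side L(-1)v, and translation makes the right side mode
    -2 of \<open>v\<close> on the vacuum.\<close>
  have "opV V (L (-1) v) (-1) (vacuum V) = sV (- of_int (-1)) (opV V v (-1 - 1) (vacuum V))"
    by (rule V.Y_translation) simp
  then have Lv: "opV V v (-2) (vacuum V) = L (-1) v" by (simp add: creation)
  have Y'0: "Y' v k 0 = 0" for v k by (rule Y'_zero)
  have c1: "(-1) ^ i * ibinom (-2) i = of_nat (Suc i)" for i
    unfolding ibinom_minus_2 by (simp flip: power_add mult_2 mult.assoc)
  have single: "Sum_any (\<lambda>i. if i = k then x else 0) = x" for k :: nat and x :: "'a \<Rightarrow> 'b \<Rightarrow> complex"
    by simp
  \<comment> \<open>Only mode -1 of the vacuum survives: here \<open>i = -1 - n\<close>, possible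
    for \<open>n \<le> -1\<close>, and in \<open>B\<close> it is \<open>i = n - 1\<close>, possible
    for \<open>n \<ge> 1\<close>. For \<open>n = 0\<close> both sums vanish.\<close>
  have A: "Sum_any (\<lambda>i::nat. scale_form ((-1) ^ i * ibinom (-2) i) (Y' v (0 + (-2) - int i) (Y' (vacuum V) (n + int i) \<Lambda>))) =
    (if n \<le> -1 then scale_form (- of_int n) (Y' v (n - 1) \<Lambda>) else 0)"
  proof -
    have "(\<lambda>i::nat. scale_form ((-1) ^ i * ibinom (-2) i) (Y' v (0 + (-2) - int i) (Y' (vacuum V) (n + int i) \<Lambda>))) =
      (\<lambda>i. if i = nat (- 1 - n) then (if n \<le> -1 then scale_form (- of_int n) (Y' v (n - 1) \<Lambda>) else 0) else 0)"
    proof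
      fix i :: nat
      show "scale_form ((-1) ^ i * ibinom (-2) i) (Y' v (0 + (-2) - int i) (Y' (vacuum V) (n + int i) \<Lambda>)) =
        (if i = nat (- 1 - n) then (if n \<le> -1 then scale_form (- of_int n) (Y' v (n - 1) \<Lambda>) else 0) else 0)"
      proof (cases "n + int i = -1")
        case True
        then have n: "n = - 1 - int i" by simp
        have i: "- of_int (- 1 - int i) = (of_nat (Suc i) :: complex)" "- 1 - int i - 1 = 0 + - 2 - int i" by simp_all
        show ?thesis unfolding c1 Y'_vacuum[OF LT] n i by simp
      next
        case False
        then have "\<not> (i = nat (- 1 - n) \<and> n \<le> -1)" by auto
        then show ?thesis using False by (auto simp: Y'_vacuum LT Y'0)
      qed
    qed
    then show ?thesis by (simp only: single)
  qed
  have B: "Sum_any (\<lambda>i::nat. scale_form ((-1) powi (-2) * (-1) ^ i * ibinom (-2) i) (Y' (vacuum V) (n + (-2) - int i) (Y' v (0 + int i) \<Lambda>))) =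
    (if n \<ge> 1 then scale_form (of_int n) (Y' v (n - 1) \<Lambda>) else 0)"
  proof -
    have "(\<lambda>i::nat. scale_form ((-1) powi (-2) * (-1) ^ i * ibinom (-2) i) (Y' (vacuum V) (n + (-2) - int i) (Y' v (0 + int i) \<Lambda>))) =
      (\<lambda>i. if i = nat (n - 1) then (if n \<ge> 1 then scale_form (of_int n) (Y' v (n - 1) \<Lambda>) else 0) else 0)"
    proof
      fix i :: nat
      show "scale_form ((-1) powi (-2) * (-1) ^ i * ibinom (-2) i) (Y' (vacuum V) (n + (-2) - int i) (Y' v (0 + int i) \<Lambda>)) =
        (if i = nat (n - 1) then (if n \<ge> 1 then scale_form (of_int n) (Y' v (n - 1) \<Lambda>) else 0) else 0)"
      proof (cases "n + (-2) - int i = -1")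
        case True
        then have n: "n = int i + 1" by simp
        have i: "(-1) powi (-2) * (-1) ^ i * ibinom (-2) i = of_int (int i + 1)" unfolding mult.assoc c1 by simp
        show ?thesis unfolding Y'_vacuum[OF Y'_mem_T[OF LT]] i n by simp
      next
        case False
        then have "\<not> (i = nat (n - 1) \<and> n \<ge> 1)" by auto
        then show ?thesis using False by (auto simp: Y'_vacuum Y'_mem_T LT)
      qed
    qed
    then show ?thesis by (simp only: single)
  qed
  have C: "Sum_any (\<lambda>i::nat. scale_form (ibinom 0 i) (Y' (opV V v (- 2 + int i) (vacuum V)) (0 + n - int i) \<Lambda>)) = Y' (L (-1) v) n \<Lambda>"
  proof -
    have "(\<lambda>i::nat. scale_form (ibinom 0 i) (Y' (opV V v (- 2 + int i) (vacuum V)) (0 + n - int i) \<Lambda>)) =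
      (\<lambda>i. if i = 0 then Y' (L (-1) v) n \<Lambda> else 0)"
      by (intro ext[of _ "\<lambda>i. if i = 0 then Y' (L (-1) v) n \<Lambda> else 0"]) (simp add: gbinomial_0_left Lv)
    then show ?thesis by (simp only: single)
  qed
  have "Y' (L (-1) v) n \<Lambda> = (if n \<le> -1 then scale_form (- of_int n) (Y' v (n - 1) \<Lambda>) else 0) -
      (if n \<ge> 1 then scale_form (of_int n) (Y' v (n - 1) \<Lambda>) else 0)"
    using Y'_jacobi[OF c, of "-2" v 0 "vacuum V" n] unfolding A B C by (rule sym)
  also have "\<dots> = scale_form (- of_int n) (Y' v (n - 1) \<Lambda>)"
  proof -
    consider "n \<le> -1" | "n = 0" | "n \<ge> 1" by linarith
    then show ?thesis by cases (simp_all add: F.scale_minus_left)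
  qed
  finally show ?thesis .
qed

section \<open>Stable subspaces and their weights\<close>

definition stable :: "('a \<Rightarrow> 'b \<Rightarrow> complex) set \<Rightarrow> bool" where
  "stable W \<longleftrightarrow> F.subspace W \<and> (\<forall>v n. \<forall>\<Lambda>\<in>W. Y' v n \<Lambda> \<in> W)"

lemma vertex_operator_map_Y':
  assumes W: "stable W" "W \<subseteq> {\<Lambda>. compatible \<Lambda>}"
  shows "vertex_operator_map V scale_form W Y'"
proof -
  have c: "compatible \<Lambda>" "\<Lambda> \<in> T" if "\<Lambda> \<in> W" for \<Lambda> using that W(2) compatible_mem_T by auto
  show ?thesis
    unfolding vertex_operator_map_def jacobi_identity_def
    using W(1) c Y'_jacobi Y'_translation Y'_vacuum Y'_truncation
    by (simp add: stable_def F.vector_space_axioms Y'_add_left Y'_scale_left Y'_add Y'_scale)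
qed

lemma stable_compatible: "stable {\<Lambda>. compatible \<Lambda>}"
  by (simp add: stable_def subspace_compatible compatible_Y')

text \<open>Makes the commutator formulas, in particular \<open>L0_commutator\<close>, available for
  \<open>Y'\<close>.\<close>

sublocale C: vertex_map V scale_form "{\<Lambda>. compatible \<Lambda>}" Y'
  by unfold_locales (rule vertex_operator_map_Y'[OF stable_compatible order_refl])

abbreviation wtF where "wtF X n \<equiv> weight_space V scale_form X Y' n"

lemma mem_wtF: "\<Lambda> \<in> wtF X n \<longleftrightarrow> \<Lambda> \<in> X \<and> Vir V Y' 0 \<Lambda> = scale_form n \<Lambda>"
  by (simp add: weight_space_def)

lemma subspace_wtF:
  assumes "F.subspace X" "X \<subseteq> T"
  shows "F.subspace (wtF X n)"
  unfolding F.subspace_def mem_wtF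
proof (intro conjI ballI allI)
  show "0 \<in> X" by (rule F.subspace_0[OF assms(1)])
  show "Vir V Y' 0 0 = scale_form n 0" by (simp add: Vir_def Y'_zero)
next
  fix x y assume "x \<in> wtF X n" "y \<in> wtF X n"
  then have xy: "x \<in> X" "y \<in> X" "x \<in> T" "y \<in> T" "Vir V Y' 0 x = scale_form n x" "Vir V Y' 0 y = scale_form n y"
    using assms(2) by (auto simp: mem_wtF)
  show "x + y \<in> X" using xy by (intro F.subspace_add[OF assms(1)])
  show "Vir V Y' 0 (x + y) = scale_form n (x + y)"
    using xy by (simp only: Vir_def Y'_add F.scale_right_distrib)
next
  fix c x assume "x \<in> wtF X n"
  then have x: "x \<in> X" "x \<in> T" "Vir V Y' 0 x = scale_form n x"
    using assms(2) by (auto simp: mem_wtF)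
  show "scale_form c x \<in> X" using x by (intro F.subspace_scale[OF assms(1)])
  show "Vir V Y' 0 (scale_form c x) = scale_form n (scale_form c x)"
    using x by (simp only: Vir_def Y'_scale F.scale_left_commute)
qed

lemma weight_components_mem:
  assumes U: "stable U" "U \<subseteq> T" and x: "x \<in> U" "x \<in> F.span (\<Union>n. wtF T n)"
  shows "x \<in> F.span (\<Union>n. wtF U n)"
proof -
  obtain A e where e: "finite A" "\<And>k. e k \<in> wtF T k" "x = (\<Sum>k\<in>A. e k)"
    using F.span_Union_decomposition[OF subspace_wtF[OF subspace_T order_refl] x(2)] by blast
  have "e k \<in> U" if "k \<in> A" for k
  proof (rule F.eigenvector_components_mem[of T "Vir V Y' 0" U A e k])
    show "Vir V Y' 0 x \<in> U" if "x \<in> U" for x using U(1) that by (simp add: stable_def Vir_def)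
    show "(\<Sum>k\<in>A. e k) \<in> U" using x(1) e(3) by simp
    show "e k \<in> T \<and> Vir V Y' 0 (e k) = scale_form k (e k)" for k using e(2)[of k] by (simp add: mem_wtF)
  qed (use U e that subspace_T in \<open>simp_all add: stable_def Vir_def Y'_add Y'_scale\<close>)
  then have "e k \<in> F.span (\<Union>n. wtF U n)" if "k \<in> A" for k
    using that e(2)[of k] by (intro F.span_base) (auto simp: mem_wtF)
  then show ?thesis unfolding e(3) by (rule F.span_sum)
qed

lemma Y'_wtF:
  assumes W: "stable W" "W \<subseteq> {\<Lambda>. compatible \<Lambda>}" and x: "x \<in> wtF W k" and v: "v \<in> wt a"
  shows "Y' v n x \<in> wtF W (k + of_int a - of_int n - 1)"
proof -
  have xc: "compatible x" "x \<in> W" "x \<in> T" "Vir V Y' 0 x = scale_form k x"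
    using x W(2) compatible_mem_T by (auto simp: mem_wtF)
  have "Vir V Y' 0 (Y' v n x) = Y' v n (Vir V Y' 0 x) + scale_form (of_int a - of_int n - 1) (Y' v n x)"
    by (rule C.L0_commutator) (use xc v in \<open>simp_all add: mem_wt\<close>)
  also have "\<dots> = scale_form (k + (of_int a - of_int n - 1)) (Y' v n x)"
    unfolding xc(4) Y'_scale[OF xc(3)] by (rule F.scale_left_distrib[symmetric])
  finally show ?thesis
    using W(1) xc(2) by (simp add: mem_wtF stable_def algebra_simps)
qed

section \<open>Compatible modules and generated spaces\<close>

definition compatible_modules where
  "compatible_modules = {W. W \<subseteq> tensor_dual s1 s2 \<and> voa_module V scale_form W (Y_prime V Y1 Y2 z) \<and>
          (\<forall>\<Lambda>\<in>W. P_compatible V Y1 Y2 z \<Lambda>)}"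

text \<open>On a stable subspace of compatible functionals the vertex operator axioms hold by
  \<open>vertex_operator_map_Y'\<close>, so only conditions on the subspace and its grading are
  left.\<close>

lemma mem_compatible_modules_iff:
  "W \<in> compatible_modules \<longleftrightarrow> W \<subseteq> {\<Lambda>. compatible \<Lambda>} \<and> stable W \<and> F.span (\<Union>n. wtF W n) = W \<and> grading_restricted V scale_form W Y'"
proof
  assume W: "W \<in> compatible_modules"
  then have "W \<subseteq> {\<Lambda>. compatible \<Lambda>}" by (auto simp: compatible_modules_def compatible_iff)
  moreover have "stable W"
    using W by (simp add: compatible_modules_def voa_module_def generalized_module_def vertex_operator_map_def stable_def)
  ultimately show "W \<subseteq> {\<Lambda>. compatible \<Lambda>} \<and> stable W \<and> F.span (\<Union>n. wtF W n) = W \<and> grading_restricted V scale_form W Y'"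
    using W by (simp add: compatible_modules_def voa_module_def generalized_module_def)
next
  assume W: "W \<subseteq> {\<Lambda>. compatible \<Lambda>} \<and> stable W \<and> F.span (\<Union>n. wtF W n) = W \<and> grading_restricted V scale_form W Y'"
  then have "W \<subseteq> T" using compatible_mem_T by blast
  moreover have "\<forall>\<Lambda>\<in>W. P_compatible V Y1 Y2 z \<Lambda>" using W \<open>W \<subseteq> T\<close> compatible_iff by blast
  ultimately show "W \<in> compatible_modules"
    using W vertex_operator_map_Y' by (simp add: compatible_modules_def voa_module_def generalized_module_def)
qed

abbreviation gen where "gen \<equiv> generated_space V s1 Y1 s2 Y2 z"

lemma gen_def: "gen \<Lambda> = \<Inter>{U. U \<subseteq> T \<and> stable U \<and> \<Lambda> \<in> U}"
  unfolding generated_space_def Y_prime_def[symmetric] stable_def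
  by (rule arg_cong[where f = Inter]) blast

lemma gen_least: "stable U \<Longrightarrow> U \<subseteq> T \<Longrightarrow> \<Lambda> \<in> U \<Longrightarrow> gen \<Lambda> \<subseteq> U"
  unfolding gen_def by blast

lemma stable_gen: "stable (gen \<Lambda>)"
  unfolding gen_def stable_def F.subspace_def by blast

lemma mem_gen: "\<Lambda> \<in> gen \<Lambda>"
  unfolding gen_def by blast

lemma gen_compatible: "compatible \<Lambda> \<Longrightarrow> gen \<Lambda> \<subseteq> {\<Lambda>. compatible \<Lambda>}"
  by (rule gen_least[OF stable_compatible]) (use compatible_mem_T in auto)

text \<open>Modes of homogeneous vectors shift weights, so the weight vectors in
  \<open>gen \<Lambda>\<close> span a stable subspace. It contains \<Lambda>, whose weight
  components lie in the stable space \<open>gen \<Lambda>\<close>, and minimality gives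
  equality.\<close>

lemma span_weights_gen:
  assumes c: "compatible \<Lambda>" and w: "\<Lambda> \<in> F.span (\<Union>n. wtF T n)"
  shows "F.span (\<Union>n. wtF (gen \<Lambda>) n) = gen \<Lambda>"
proof
  define W where "W = gen \<Lambda>"
  define D where "D = F.span (\<Union>n. wtF W n)"
  have W: "stable W" "W \<subseteq> {\<Lambda>. compatible \<Lambda>}" "W \<subseteq> T" "F.subspace W"
    using stable_gen[of \<Lambda>] gen_compatible[OF c] compatible_mem_T by (auto simp: W_def stable_def)
  have DW: "D \<subseteq> W"
    unfolding D_def by (rule F.span_minimal[OF _ W(4)]) (auto simp: mem_wtF)
  then show "F.span (\<Union>n. wtF (gen \<Lambda>) n) \<subseteq> gen \<Lambda>" unfolding D_def W_def .
  have D: "F.subspace D" by (simp add: D_def)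
  have "Y' v n x \<in> D" if x: "x \<in> wtF W k" for v n x k
  proof -
    have xT: "x \<in> T" using x W(3) by (auto simp: mem_wtF)
    have "v \<in> V.span (\<Union>n. wt n)" by (simp add: span_wt)
    then show ?thesis
    proof (induction rule: V.span_induct)
      case base
      have "Y' 0 n x = 0" using Y'_scale_left[OF xT, of 0 0 n] by simp
      then show ?case
        by (simp add: V.subspace_def Y'_add_left Y'_scale_left xT F.subspace_0 F.subspace_add F.subspace_scale D)
    next
      case (step v)
      then obtain a where "v \<in> wt a" by blast
      from Y'_wtF[OF W(1,2) x this] show ?case unfolding D_def by (intro F.span_base UN_I UNIV_I)
    qed
  qed
  note weight = this
  have "Y' v n x \<in> D" if "x \<in> D" for v n x
  proof -
    have "F.subspace {x \<in> T. Y' v n x \<in> D}"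
    proof (rule F.subspaceI)
      show "0 \<in> {x \<in> T. Y' v n x \<in> D}"
        by (simp add: Y'_zero F.subspace_0 subspace_T D)
    next
      fix x y assume "x \<in> {x \<in> T. Y' v n x \<in> D}" "y \<in> {x \<in> T. Y' v n x \<in> D}"
      then have xy: "x \<in> T" "y \<in> T" "Y' v n x \<in> D" "Y' v n y \<in> D" by blast+
      show "x + y \<in> {x \<in> T. Y' v n x \<in> D}"
        unfolding mem_Collect_eq Y'_add[OF xy(1,2)]
        by (intro conjI F.subspace_add subspace_T D xy)
    next
      fix c x assume "x \<in> {x \<in> T. Y' v n x \<in> D}"
      then have x: "x \<in> T" "Y' v n x \<in> D" by blast+
      show "scale_form c x \<in> {x \<in> T. Y' v n x \<in> D}"
        unfolding mem_Collect_eq Y'_scale[OF x(1)]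
        by (intro conjI F.subspace_scale subspace_T D x)
    qed
    moreover have "(\<Union>n. wtF W n) \<subseteq> {x \<in> T. Y' v n x \<in> D}"
    proof
      fix x assume "x \<in> (\<Union>n. wtF W n)"
      then obtain k where x: "x \<in> wtF W k" by (rule UN_E)
      then have "x \<in> T" using W(3) by (auto simp: mem_wtF)
      then show "x \<in> {x \<in> T. Y' v n x \<in> D}" using weight[OF x] by simp
    qed
    ultimately have "D \<subseteq> {x \<in> T. Y' v n x \<in> D}"
      unfolding D_def by (rule F.span_minimal[rotated])
    then show ?thesis using that by blast
  qed
  then have "stable D" by (simp add: stable_def D)
  moreover have "\<Lambda> \<in> D"
    unfolding D_def by (rule weight_components_mem[OF W(1,3) _ w]) (simp add: W_def mem_gen)
  ultimately show "gen \<Lambda> \<subseteq> F.span (\<Union>n. wtF (gen \<Lambda>) n)"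
    using gen_least[of D \<Lambda>] DW W(3) unfolding D_def W_def by blast
qed

definition restricted_space where
  "restricted_space = {\<Lambda> \<in> tensor_dual s1 s2. P_compatible V Y1 Y2 z \<Lambda> \<and> P_local_grading_restricted V s1 Y1 s2 Y2 z \<Lambda>}"

lemma mem_restricted_space_iff: "\<Lambda> \<in> restricted_space \<longleftrightarrow> compatible \<Lambda> \<and> \<Lambda> \<in> F.span (\<Union>n. wtF T n) \<and>
    grading_restricted V scale_form (gen \<Lambda>) Y'"
  unfolding restricted_space_def P_local_grading_restricted_def using compatible_iff compatible_mem_T by blast

lemma gen_mem_compatible_modules: "\<Lambda> \<in> restricted_space \<Longrightarrow> gen \<Lambda> \<in> compatible_modules"
  unfolding mem_restricted_space_iff mem_compatible_modules_iff by (intro conjI gen_compatible stable_gen span_weights_gen) simp_all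

lemma grading_restricted_subspace:
  assumes "grading_restricted V scale_form W Y'" "F.subspace U" "U \<subseteq> W" "U \<subseteq> T"
  shows "grading_restricted V scale_form U Y'"
proof -
  have sub: "wtF U n \<subseteq> wtF W n" for n using assms(3) by (auto simp: mem_wtF)
  have "finite_dim scale_form (wtF U n)" for n
    using assms(1) unfolding grading_restricted_def
    by (intro finite_dim_subspace[OF F.vector_space_axioms _ subspace_wtF[OF assms(2,4)] sub]) simp
  moreover obtain r where "\<And>n. Re n < r \<Longrightarrow> wtF W n = {0}"
    using assms(1) unfolding grading_restricted_def by blast
  then have "\<forall>n. Re n < r \<longrightarrow> wtF U n = {0}"
    using sub F.subspace_0[OF subspace_wtF[OF assms(2,4)]] by blast
  ultimately show ?thesis unfolding grading_restricted_def by blast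
qed

text \<open>The space generated by an element lies inside the module, and the grading restriction
  passes to subspaces.\<close>

lemma compatible_modules_subset_restricted_space:
  assumes "W \<in> compatible_modules"
  shows "W \<subseteq> restricted_space"
proof
  fix \<Lambda> assume L: "\<Lambda> \<in> W"
  have W: "W \<subseteq> {\<Lambda>. compatible \<Lambda>}" "stable W" "F.span (\<Union>n. wtF W n) = W" "grading_restricted V scale_form W Y'"
    using assms by (simp_all add: mem_compatible_modules_iff)
  have WT: "W \<subseteq> T" using W(1) compatible_mem_T by blast
  have "(\<Union>n. wtF W n) \<subseteq> (\<Union>n. wtF T n)" using WT by (auto simp: mem_wtF)
  then have "\<Lambda> \<in> F.span (\<Union>n. wtF T n)" using F.span_mono W(3) L by blast
  moreover have "gen \<Lambda> \<subseteq> W" by (rule gen_least[OF W(2) WT L])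
  then have "grading_restricted V scale_form (gen \<Lambda>) Y'"
    using WT stable_gen[of \<Lambda>] by (intro grading_restricted_subspace[OF W(4)]) (auto simp: stable_def)
  ultimately show "\<Lambda> \<in> restricted_space" using W(1) L by (auto simp: mem_restricted_space_iff)
qed

text \<open>The grading restriction needs the weight spaces of the sum to be the sums
  \<open>E n\<close>: a weight vector a + b might have summands that are not weight vectors.
  Independence of weights lets it be rewritten with summands of the same weight.\<close>

lemma compatible_modules_sums:
  assumes "A \<in> compatible_modules" "B \<in> compatible_modules"
  shows "{x + y | x y. x \<in> A \<and> y \<in> B} \<in> compatible_modules"
proof -
  define C where "C = {x + y | x y. x \<in> A \<and> y \<in> B}"
  have A: "A \<subseteq> {\<Lambda>. compatible \<Lambda>}" "stable A" "F.span (\<Union>n. wtF A n) = A" "grading_restricted V scale_form A Y'"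
    and B: "B \<subseteq> {\<Lambda>. compatible \<Lambda>}" "stable B" "F.span (\<Union>n. wtF B n) = B" "grading_restricted V scale_form B Y'"
    using assms by (simp_all add: mem_compatible_modules_iff)
  have sub: "F.subspace A" "F.subspace B" using A B by (simp_all add: stable_def)
  have T: "A \<subseteq> T" "B \<subseteq> T" using A(1) B(1) compatible_mem_T by auto
  have AC: "A \<subseteq> C" "B \<subseteq> C"
    unfolding C_def by (intro subset_sums F.subspace_0 sub)+
  have subC: "F.subspace C" unfolding C_def by (rule F.subspace_sums[OF sub])
  have CT: "C \<subseteq> T" using T F.subspace_add[OF subspace_T] unfolding C_def by blast
  have Ccomp: "C \<subseteq> {\<Lambda>. compatible \<Lambda>}"
    using A(1) B(1) F.subspace_add[OF subspace_compatible] unfolding C_def by blast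
  have stC: "stable C"
    unfolding stable_def
  proof (intro conjI subC allI ballI)
    fix v n \<Lambda> assume "\<Lambda> \<in> C"
    then obtain x y where xy: "\<Lambda> = x + y" "x \<in> A" "y \<in> B" unfolding C_def by blast
    then have "Y' v n \<Lambda> = Y' v n x + Y' v n y" "Y' v n x \<in> A" "Y' v n y \<in> B"
      using T A(2) B(2) Y'_add[of x y v n] by (auto simp only: stable_def)
    then show "Y' v n \<Lambda> \<in> C" unfolding C_def by blast
  qed
  define E where "E n = {x + y | x y. x \<in> wtF A n \<and> y \<in> wtF B n}" for n
  have subE: "F.subspace (E n)" for n
    unfolding E_def by (rule F.subspace_sums[OF subspace_wtF[OF sub(1) T(1)] subspace_wtF[OF sub(2) T(2)]])
  have wA: "wtF A n \<subseteq> E n" and wB: "wtF B n \<subseteq> E n" for n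
    unfolding E_def by (intro subset_sums F.subspace_0 subspace_wtF sub T)+
  have EC: "E n \<subseteq> wtF C n" for n
  proof
    fix x assume "x \<in> E n"
    then obtain a b where ab: "x = a + b" "a \<in> wtF A n" "b \<in> wtF B n" unfolding E_def by blast
    then have "a \<in> wtF C n" "b \<in> wtF C n" using AC by (auto simp: mem_wtF)
    then show "x \<in> wtF C n" unfolding ab(1) by (rule F.subspace_add[OF subspace_wtF[OF subC CT]])
  qed
  have spanE: "C \<subseteq> F.span (\<Union>n. E n)"
  proof
    fix x assume "x \<in> C"
    then obtain a b where ab: "x = a + b" "a \<in> A" "b \<in> B" unfolding C_def by blast
    have "a \<in> F.span (\<Union>n. E n)"
      using ab(2) A(3) F.span_mono[of "\<Union>n. wtF A n" "\<Union>n. E n"] wA by blast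
    moreover have "b \<in> F.span (\<Union>n. E n)"
      using ab(3) B(3) F.span_mono[of "\<Union>n. wtF B n" "\<Union>n. E n"] wB by blast
    ultimately show "x \<in> F.span (\<Union>n. E n)" unfolding ab(1) by (rule F.span_add)
  qed
  have "F.span (\<Union>n. wtF C n) = C"
  proof
    show "F.span (\<Union>n. wtF C n) \<subseteq> C"
      by (rule F.span_minimal[OF _ subC]) (auto simp: mem_wtF)
    show "C \<subseteq> F.span (\<Union>n. wtF C n)"
      using spanE F.span_mono[of "\<Union>n. E n" "\<Union>n. wtF C n"] EC by blast
  qed
  moreover have CE: "wtF C n = E n" for n
  proof
    show "wtF C n \<subseteq> E n"
    proof
      fix x assume x: "x \<in> wtF C n"
      then have "x \<in> C" by (simp add: mem_wtF)
      then have "x \<in> F.span (\<Union>n. E n)" using spanE by (rule subsetD[rotated])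
      from F.span_Union_decomposition[OF subE this]
      obtain G e where e: "finite G" "\<And>k. e k \<in> E k" "x = (\<Sum>k\<in>G. e k)" by blast
      have eT: "e k \<in> T" "Vir V Y' 0 (e k) = scale_form k (e k)" for k
      proof -
        have "e k \<in> wtF C k" using EC e(2) by (rule subsetD)
        then show "e k \<in> T" "Vir V Y' 0 (e k) = scale_form k (e k)"
          using subsetD[OF CT, of "e k"] by (simp_all add: mem_wtF)
      qed
      \<comment> \<open>L(0) - n kills \<open>x\<close> and multiplies the component at
        \<open>k\<close> by \<open>k - n\<close>; independence, as the case \<open>U = {0}\<close>,
        makes each resulting term zero.\<close>
      have vanish: "scale_form (k - n) (e k) \<in> {0}" if "k \<in> G" for k
      proof (rule F.eigenvector_components_mem[of T "Vir V Y' 0" "{0}" G "\<lambda>k. scale_form (k - n) (e k)" k])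
        have "(\<Sum>k\<in>G. scale_form (k - n) (e k)) = (\<Sum>k\<in>G. Vir V Y' 0 (e k)) - scale_form n x"
          unfolding e(3) F.scale_sum_right sum_subtractf[symmetric] eT(2)
          by (intro sum.cong refl F.scale_left_diff_distrib)
        also have "(\<Sum>k\<in>G. Vir V Y' 0 (e k)) = Vir V Y' 0 x"
          unfolding e(3) using e(1)
        proof (induction G rule: finite_induct)
          case empty
          show ?case by (simp only: sum.empty Vir_def Y'_zero)
        next
          case (insert k G)
          have eq: "Vir V Y' 0 (e k + sum e G) = Vir V Y' 0 (e k) + Vir V Y' 0 (sum e G)"
            unfolding Vir_def by (intro Y'_add eT F.subspace_sum[OF subspace_T])
          show ?case unfolding sum.insert[OF insert.hyps(1,2)] insert.IH by (rule eq[symmetric])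
        qed
        also have "Vir V Y' 0 x - scale_form n x = 0" using x by (simp add: mem_wtF)
        finally show "(\<Sum>k\<in>G. scale_form (k - n) (e k)) \<in> {0}" by simp
        show "scale_form (k - n) (e k) \<in> T \<and> Vir V Y' 0 (scale_form (k - n) (e k)) = scale_form k (scale_form (k - n) (e k))" for k
          using eT[of k] F.subspace_scale[OF subspace_T eT(1)] unfolding Vir_def
          by (simp only: Y'_scale F.scale_left_commute simp_thms)
      qed (use e that in \<open>simp_all add: subspace_T Vir_def Y'_add Y'_scale Y'_zero F.subspace_0 F.subspace_single_0\<close>)
      have "e k \<in> E n" if "k \<in> G" for k
      proof (cases "k = n")
        case True
        then show ?thesis using e(2) by simp
      next
        case False
        then have "e k = 0" using vanish[OF that]
          by (simp only: singleton_iff F.scale_eq_0_iff right_minus_eq simp_thms)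
        then show ?thesis using F.subspace_0[OF subE] by (simp only:)
      qed
      then show "x \<in> E n" unfolding e(3) by (rule F.subspace_sum[OF subE])
    qed
  qed (rule EC)
  have "grading_restricted V scale_form C Y'"
  proof -
    have "finite_dim scale_form (wtF C n)" for n
      unfolding CE E_def using A(4) B(4)
      by (intro finite_dim_sums[OF F.vector_space_axioms]) (simp_all add: grading_restricted_def)
    moreover obtain r where r: "\<And>n. Re n < r \<Longrightarrow> wtF A n = {0}"
      using A(4) unfolding grading_restricted_def by blast
    moreover obtain r' where r': "\<And>n. Re n < r' \<Longrightarrow> wtF B n = {0}"
      using B(4) unfolding grading_restricted_def by blast
    have "wtF C n = {0}" if "Re n < min r r'" for n
      unfolding CE E_def using r[of n] r'[of n] that by simp
    ultimately show ?thesis unfolding grading_restricted_def by blast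
  qed
  ultimately show ?thesis
    using stC Ccomp unfolding mem_compatible_modules_iff C_def[symmetric] by blast
qed

lemma zero_mem_compatible_modules: "{0} \<in> compatible_modules"
proof -
  have st: "stable {0}" by (simp add: stable_def Y'_zero F.subspace_single_0)
  have w: "wtF {0} n = {0}" for n by (auto simp: mem_wtF Vir_def Y'_zero)
  have "finite_dim scale_form {0 :: 'a \<Rightarrow> 'b \<Rightarrow> complex}"
    unfolding finite_dim_def by (rule exI[of _ "{}"]) simp
  then show ?thesis
    using st F.subspace_0[OF subspace_compatible]
    by (simp add: mem_compatible_modules_iff w grading_restricted_def F.span_insert_0)
qed

text \<open>The local condition on x + y is not implied by those on x and y alone; it holds because
  x + y lies in the compatible module \<open>gen x\<close> + \<open>gen y\<close>.\<close>

lemma subspace_restricted_space: "F.subspace restricted_space"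
  unfolding F.subspace_def
proof (intro conjI ballI allI)
  show "0 \<in> restricted_space" using compatible_modules_subset_restricted_space[OF zero_mem_compatible_modules] by simp
  fix x y assume "x \<in> restricted_space" "y \<in> restricted_space"
  then have "{a + b | a b. a \<in> gen x \<and> b \<in> gen y} \<subseteq> restricted_space"
    by (intro compatible_modules_subset_restricted_space compatible_modules_sums gen_mem_compatible_modules)
  then show "x + y \<in> restricted_space" using mem_gen by blast
next
  fix c x assume x: "x \<in> restricted_space"
  have "scale_form c x \<in> gen x"
    using stable_gen[of x] mem_gen F.subspace_scale by (simp add: stable_def)
  then show "scale_form c x \<in> restricted_space" using compatible_modules_subset_restricted_space[OF gen_mem_compatible_modules[OF x]] by blast
qed

lemma restricted_space_eq_P_diamond: "restricted_space = P_diamond V s1 Y1 s2 Y2 z"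
proof -
  have "P_diamond V s1 Y1 s2 Y2 z = F.span (\<Union>compatible_modules)"
    by (simp add: P_diamond_def compatible_modules_def)
  moreover have "F.span (\<Union>compatible_modules) \<subseteq> restricted_space"
    using compatible_modules_subset_restricted_space by (intro F.span_minimal subspace_restricted_space) blast
  moreover have "restricted_space \<subseteq> F.span (\<Union>compatible_modules)"
    using gen_mem_compatible_modules mem_gen by (blast intro: F.span_base)
  ultimately show ?thesis by blast
qed

lemma generalized_module_restricted_space: "generalized_module V scale_form restricted_space Y'"
  unfolding generalized_module_def
proof
  have "stable restricted_space"
    unfolding stable_def
  proof (intro conjI subspace_restricted_space allI ballI)
    fix v n \<Lambda> assume L: "\<Lambda> \<in> restricted_space"
    have "Y' v n \<Lambda> \<in> gen \<Lambda>" using stable_gen[of \<Lambda>] mem_gen by (simp add: stable_def)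
    then show "Y' v n \<Lambda> \<in> restricted_space" using compatible_modules_subset_restricted_space[OF gen_mem_compatible_modules[OF L]] by blast
  qed
  then show "vertex_operator_map V scale_form restricted_space Y'"
    by (rule vertex_operator_map_Y') (auto simp: mem_restricted_space_iff)
  show "F.span (\<Union>n. wtF restricted_space n) = restricted_space"
  proof
    show "F.span (\<Union>n. wtF restricted_space n) \<subseteq> restricted_space"
      by (rule F.span_minimal[OF _ subspace_restricted_space]) (auto simp: mem_wtF)
    show "restricted_space \<subseteq> F.span (\<Union>n. wtF restricted_space n)"
    proof
      fix \<Lambda> assume L: "\<Lambda> \<in> restricted_space"
      have "(\<Union>n. wtF (gen \<Lambda>) n) \<subseteq> (\<Union>n. wtF restricted_space n)"
        using compatible_modules_subset_restricted_space[OF gen_mem_compatible_modules[OF L]] by (auto simp: mem_wtF)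
      moreover have "\<Lambda> \<in> F.span (\<Union>n. wtF (gen \<Lambda>) n)"
        using gen_mem_compatible_modules[OF L] mem_gen by (simp add: mem_compatible_modules_iff)
      ultimately show "\<Lambda> \<in> F.span (\<Union>n. wtF restricted_space n)" using F.span_mono by blast
    qed
  qed
qed

end

theorem theorem13p10:
  fixes V :: "'v::ab_group_add vertex_data"
    and s1 :: "complex \<Rightarrow> 'a::ab_group_add \<Rightarrow> 'a" and Y1 :: "'v \<Rightarrow> int \<Rightarrow> 'a \<Rightarrow> 'a"
    and s2 :: "complex \<Rightarrow> 'b::ab_group_add \<Rightarrow> 'b" and Y2 :: "'v \<Rightarrow> int \<Rightarrow> 'b \<Rightarrow> 'b"
    and z :: complex
  assumes "vertex_operator_algebra V"
    and "z \<noteq> 0"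
    and "voa_module V s1 UNIV Y1"
    and "voa_module V s2 UNIV Y2"
  shows "let S = {\<Lambda> \<in> tensor_dual s1 s2. P_compatible V Y1 Y2 z \<Lambda> \<and>
                    P_local_grading_restricted V s1 Y1 s2 Y2 z \<Lambda>}
    in generalized_module V scale_form S (Y_prime V Y1 Y2 z) \<and> S = P_diamond V s1 Y1 s2 Y2 z"
proof -
  interpret P_z V s1 Y1 s2 Y2 z
    using assms by unfold_locales (simp_all add: voa_module_def generalized_module_def)
  show ?thesis
    unfolding Let_def restricted_space_def[symmetric] using generalized_module_restricted_space restricted_space_eq_P_diamond by blast
qed

end
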